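(* Let $\Sigma$ be the set of pairs $\sigma=(\sigma_1,\sigma_2)$ with $0\le\sigma_2\le\sigma_1<1$ and $\sqrt{1-\sigma_1^2}+\sqrt{1-\sigma_2^2}>1$, and put $g_\sigma(z)=1+\sigma_1z_1^2+\sigma_2z_2^2$ on $\mathbb C^2$. Fix $\sigma\in\Sigma$ and a positive integer $N$. (a) If $\sigma\ne(0,0)$, then there is a reduced pointed degree-three sphere map $P/g_\sigma$ on $\mathbb B^2$ with denominator $g_\sigma$ and minimal target $\mathbb B^N$ if and only if $4\le N\le 9$. (b) If $\sigma=(0,0)$, such a map exists if and only if $3\le N\le 9$. In particular, for every $\sigma\in\Sigma$ with $\sigma\neq(0,0)$, the denominator $g_\sigma$ occurs for a reduced pointed degree-three sphere map into $\mathbb B^4$, and four is the smallest target dimension for which this happens, for every such $\sigma$.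
   Context: $\mathbb B^n$ is the open unit ball of $\mathbb C^n$. A (rational) sphere map in $n$ variables is a rational map $F=P/g$, holomorphic on $\mathbb B^n$, where $P=(p_1,\dots,p_M)^t$ is a polynomial map $\mathbb C^n\to\mathbb C^M$ and $g$ a scalar polynomial, satisfying $\|P(z)\|^2=|g(z)|^2$ for all $z\in\partial\mathbb B^n$. It is reduced if $g,p_1,\dots,p_M$ have no common nonconstant polynomial factor; then $\deg F=\max\{\deg P,\deg g\}$. With $g(0)=1$, it is pointed if $P(0)=0$. The minimal target dimension of $P$ is $\dim_{\mathbb C}\operatorname{span}_{\mathbb C}\{p_1,\dots,p_M\}$, equivalently the smallest $k$ such that a unitary map of the target carries the image into $\mathbb B^k\subset\mathbb B^M$; "minimal target $\mathbb B^N$" means that the minimal target dimension equals $N$. *)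

theory Defs
  imports "HOL-Analysis.Analysis" "HOL-Computational_Algebra.Computational_Algebra"
begin

(* The points of C^2 are the pairs of type complex \<times> complex, whose library norm is Euclidean, so the
   unit ball and sphere of C^2 are ball 0 1 and sphere 0 1.

   Elements of C[z1,z2] have type complex poly poly, the inner variable being z1 and the outer
   one z2: the coefficient of z1^i z2^j in p is coeff (coeff p j) i. *)

type_synonym bipoly = "complex poly poly"

definition bieval :: "bipoly \<Rightarrow> complex \<times> complex \<Rightarrow> complex" where
  "bieval p z = poly (poly p [:snd z:]) (fst z)"

definition total_degree :: "bipoly \<Rightarrow> nat" where
  "total_degree p = Max (insert 0 {i + j | i j. coeff (coeff p j) i \<noteq> 0})"

lemma finite_total_degree_set: "finite {i + j | i j. coeff (coeff (p :: bipoly) j) i \<noteq> 0}"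
proof (rule finite_subset)
  let ?S = "\<Union>j\<in>{..degree p}. (\<lambda>i. i + j) ` {..degree (coeff p j)}"
  show "finite ?S" by simp
  show "{i + j | i j. coeff (coeff p j) i \<noteq> 0} \<subseteq> ?S"
  proof
    fix k assume "k \<in> {i + j | i j. coeff (coeff p j) i \<noteq> 0}"
    then obtain i j where k: "k = i + j" "coeff (coeff p j) i \<noteq> 0" by blast
    moreover from k(2) have "i \<le> degree (coeff p j)" by (rule le_degree)
    moreover from k(2) have "j \<le> degree p" by (intro le_degree) auto
    ultimately show "k \<in> ?S" by auto
  qed
qed

interpretation bipoly: vector_space "\<lambda>(c :: complex) (p :: bipoly). smult [:c:] p"
  by unfold_locales (simp_all add: smult_add_right smult_add_left[symmetric] mult.commute flip: one_pCons)

definition holomorphic2_on :: "(complex \<times> complex \<Rightarrow> complex) \<Rightarrow> (complex \<times> complex) set \<Rightarrow> bool"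
    where
  "holomorphic2_on f S \<longleftrightarrow>
     (\<forall>z\<in>S. \<exists>a b. (f has_derivative (\<lambda>h. a * fst h + b * snd h)) (at z within S))"

(* A polynomial map P = (p_1, ..., p_M) from C^2 to C^M is the list of its components, so M is length P.
   P / g is holomorphic on the ball if each p_i / g, defined where g does not vanish, extends
   to a holomorphic function on the ball. *)

definition sphere_map :: "bipoly list \<Rightarrow> bipoly \<Rightarrow> bool" where
  "sphere_map P g \<longleftrightarrow>
     g \<noteq> 0 \<and>
     (\<forall>p\<in>set P. \<exists>f. holomorphic2_on f (ball 0 1) \<and>
        (\<forall>z\<in>ball 0 1. bieval g z \<noteq> 0 \<longrightarrow> f z = bieval p z / bieval g z)) \<and>
     (\<forall>z\<in>sphere 0 1. (\<Sum>p\<leftarrow>P. (norm (bieval p z))\<^sup>2) = (norm (bieval g z))\<^sup>2)"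

definition reduced :: "bipoly list \<Rightarrow> bipoly \<Rightarrow> bool" where
  "reduced P g \<longleftrightarrow> (\<forall>h. h dvd g \<and> (\<forall>p\<in>set P. h dvd p) \<longrightarrow> total_degree h = 0)"

definition pointed :: "bipoly list \<Rightarrow> bipoly \<Rightarrow> bool" where
  "pointed P g \<longleftrightarrow> bieval g 0 = 1 \<and> (\<forall>p\<in>set P. bieval p 0 = 0)"

(* The degree of P / g; meaningful when P / g is reduced. *)
definition map_degree :: "bipoly list \<Rightarrow> bipoly \<Rightarrow> nat" where
  "map_degree P g = Max (insert (total_degree g) (total_degree ` set P))"

definition min_target_dim :: "bipoly list \<Rightarrow> nat" where
  "min_target_dim P = bipoly.dim (bipoly.span (set P))"

definition reduced_pointed_cubic_sphere_map :: "bipoly list \<Rightarrow> bipoly \<Rightarrow> bool" where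
  "reduced_pointed_cubic_sphere_map P g \<longleftrightarrow>
     sphere_map P g \<and> reduced P g \<and> pointed P g \<and> map_degree P g = 3"

definition param_set :: "(real \<times> real) set" where
  "param_set = {(s1, s2). 0 \<le> s2 \<and> s2 \<le> s1 \<and> s1 < 1 \<and> sqrt (1 - s1\<^sup>2) + sqrt (1 - s2\<^sup>2) > 1}"

definition denom :: "real \<times> real \<Rightarrow> bipoly" where
  "denom \<sigma> = [:[:1, 0, of_real (fst \<sigma>):], 0, [:of_real (snd \<sigma>):]:]"

lemma bieval_denom:
  "bieval (denom \<sigma>) (z1, z2) = 1 + of_real (fst \<sigma>) * z1\<^sup>2 + of_real (snd \<sigma>) * z2\<^sup>2"
  by (simp add: bieval_def denom_def power2_eq_square algebra_simps)

end

theory Submission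
  imports Defs
begin

text \<open>
Write \<open>q = \<sigma>1 z1\<^sup>2 + \<sigma>2 z2\<^sup>2\<close>, so that the denominator is \<open>1 + q\<close>, and let \<open>P\<close> be the numerator of a reduced
pointed map of degree three. Every component of \<open>P\<close> is a polynomial of degree at most three without
constant term, and there are nine monomials of that kind. This gives the upper bound nine
(\<open>min_target_dim_le_9\<close>).

For the lower bound suppose that \<open>q \<noteq> 0\<close> and that the components of \<open>P\<close> span a space of dimension at
most three. A unitary change of the target, which preserves the span and the Gram function
\<open>(z, w) \<mapsto> \<Sum> p(z) cnj (p(w))\<close>, leaves three components. Split them into their linear, quadratic and
cubic parts. Rotating \<open>z\<close> by unit scalars separates the sphere identity by degree, and polarization turns
the result into identities in independent variables \<open>z\<close> and \<open>u\<close> in place of \<open>cnj z\<close>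
(\<open>polarized_identities\<close>). A unitary change of the source moves a root of \<open>q\<close> to \<open>(0,1)\<close>, a further one
of the target makes the linear part triangular, and two identities remain between \<open>q\<close>, the Gram matrix
of the linear part, the quadratic part and the cubic part \<open>c\<close> of the third component; they are collected
in the locale \<open>rank3_system\<close>. If \<open>q\<close> and \<open>c\<close> had no common root, then putting \<open>u = (-z2, z1)\<close>, where
\<open>z1 u1 + z2 u2\<close> vanishes, would give divisibilities that determine all forms up to a few constants, and
these constants contradict each other (\<open>rank3_system.common_root\<close>). So a common root exists; it is a root
of the cubic parts of all components, and a rotation moves it to \<open>(0,1)\<close>. Comparing coefficients then
leaves two possibilities (\<open>shared_root_system.common_factor\<close>): all components are linear forms times
\<open>1 + q\<close>, or \<open>\<sigma>2 = 0\<close> and all components vanish on a line \<open>z1 = T\<close> on which \<open>1 + q\<close> vanishes too. Either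
way \<open>P / (1 + q)\<close> is not reduced, so four components are needed (\<open>min_target_dim_ge_4\<close>). If \<open>q = 0\<close>, two
components are excluded because the cubic part of such a map would vanish (\<open>min_target_dim_ge_3\<close>).

For existence take components \<open>sqrt (1 - a_i) z_i (1 + q / (1 - a_i))\<close> for \<open>i = 1, 2\<close>. The rest of the
sphere identity is an identity between Hermitian forms that is met by adding cubic components
\<open>z_i (\<beta>_i z2\<^sup>2 + \<alpha>_i z1\<^sup>2)\<close>, \<open>\<epsilon>_i z_i z1\<^sup>2\<close> and, optionally, multiples of the three quadratic monomials, as
soon as two real binary quadratic forms depending on \<open>a1, a2\<close> are positive semidefinite
(\<open>family_exists\<close>). Their determinants are positive multiples of \<open>slack1\<close> and \<open>slack2\<close>. Along a suitable
curve of parameters \<open>slack1\<close> is zero and \<open>slack2\<close> changes sign; that it is positive near the start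
rests on the inequality \<open>sqrt (1 - \<sigma>1\<^sup>2) + sqrt (1 - \<sigma>2\<^sup>2) > 1\<close> (\<open>exists_ray\<close>). Each slack that vanishes
saves one component: four components when both vanish, five when one does, six when neither does, and
seven to nine after splitting off quadratic monomials with small coefficients. For \<open>q = 0\<close> the
dimensions three to five are realized by monomial maps.
\<close>

section \<open>Cubic polynomials without constant term\<close>

lemma nsq: "z * cnj z = complex_of_real ((cmod z)\<^sup>2)" "cnj z * z = complex_of_real ((cmod z)\<^sup>2)"
  by (simp_all add: complex_norm_square[symmetric] mult.commute)

text \<open>Binary quadratic and cubic forms; the coefficients are listed by decreasing powers of the first
variable.\<close>
definition qf :: "complex \<Rightarrow> complex \<Rightarrow> complex \<Rightarrow> complex \<Rightarrow> complex \<Rightarrow> complex" where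
  "qf a b c s t = a* s\<^sup>2 + b* s*t + c*t\<^sup>2"
definition cf :: "complex \<Rightarrow> complex \<Rightarrow> complex \<Rightarrow> complex \<Rightarrow> complex \<Rightarrow> complex \<Rightarrow> complex" where
  "cf a b c d s t = a* s^3 + b* s\<^sup>2*t + c* s*t\<^sup>2 + d*t^3"

abbreviation cc :: "bipoly \<Rightarrow> nat \<Rightarrow> nat \<Rightarrow> complex" where "cc p i j \<equiv> coeff (coeff p j) i"

text \<open>The general polynomial of degree at most three without constant term; \<open>aij\<close> is the coefficient of
\<open>z1\<^sup>i z2\<^sup>j\<close>.\<close>
definition bp :: "complex \<Rightarrow> complex \<Rightarrow> complex \<Rightarrow> complex \<Rightarrow> complex \<Rightarrow> complex \<Rightarrow> complex \<Rightarrow> complex \<Rightarrow> complex \<Rightarrow> bipoly" where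
  "bp a10 a01 a20 a11 a02 a30 a21 a12 a03 = [:[:0,a10,a20,a30:], [:a01,a11,a21:], [:a02,a12:], [:a03:]:]"

definition lf :: "complex \<Rightarrow> complex \<Rightarrow> complex \<Rightarrow> complex \<Rightarrow> complex" where "lf a b s t = a * s + b * t"

lemma bieval_bp: "bieval (bp a10 a01 a20 a11 a02 a30 a21 a12 a03) (s, t) = lf a10 a01 s t + qf a20 a11 a02 s t + cf a30 a21 a12 a03 s t"
  by (simp add: bieval_def bp_def lf_def qf_def cf_def power2_eq_square power3_eq_cube algebra_simps)

lemma cc_bp:
  "cc (bp a10 a01 a20 a11 a02 a30 a21 a12 a03) (Suc 0) 0 = a10"
  "cc (bp a10 a01 a20 a11 a02 a30 a21 a12 a03) 0 (Suc 0) = a01"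
  "cc (bp a10 a01 a20 a11 a02 a30 a21 a12 a03) 2 0 = a20"
  "cc (bp a10 a01 a20 a11 a02 a30 a21 a12 a03) (Suc 0) (Suc 0) = a11"
  "cc (bp a10 a01 a20 a11 a02 a30 a21 a12 a03) 0 2 = a02"
  "cc (bp a10 a01 a20 a11 a02 a30 a21 a12 a03) 3 0 = a30"
  "cc (bp a10 a01 a20 a11 a02 a30 a21 a12 a03) 2 (Suc 0) = a21"
  "cc (bp a10 a01 a20 a11 a02 a30 a21 a12 a03) (Suc 0) 2 = a12"
  "cc (bp a10 a01 a20 a11 a02 a30 a21 a12 a03) 0 3 = a03"
  by (simp_all add: bp_def numeral_2_eq_2 numeral_3_eq_3)

text \<open>The polynomials that can be components of a pointed cubic map.\<close>
definition cubic0 :: "bipoly \<Rightarrow> bool" where "cubic0 p \<longleftrightarrow> (\<forall>i j. cc p i j \<noteq> 0 \<longrightarrow> 1 \<le> i + j \<and> i + j \<le> 3)"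

lemma cubic0_bp: "cubic0 (bp a10 a01 a20 a11 a02 a30 a21 a12 a03)"
  by (auto simp: cubic0_def bp_def coeff_pCons split: nat.splits)

lemma cubic0_eq: assumes "cubic0 p"
  shows "p = bp (cc p 1 0) (cc p 0 1) (cc p 2 0) (cc p 1 1) (cc p 0 2) (cc p 3 0) (cc p 2 1) (cc p 1 2) (cc p 0 3)"
    (is "p = ?b")
proof (rule poly_eqI, rule poly_eqI)
  fix i j
  show "cc p j i = cc ?b j i"
  proof (cases "1 \<le> j + i \<and> j + i \<le> 3")
    case False
    thus ?thesis using assms cubic0_bp unfolding cubic0_def by metis
  next
    case True
    hence "j = 0 \<or> j = 1 \<or> j = 2 \<or> j = 3" "i = 0 \<or> i = 1 \<or> i = 2 \<or> i = 3" by linarith+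
    thus ?thesis using True by (elim disjE) (simp_all add: cc_bp)
  qed
qed

lemma cc_bound: "cc p i j \<noteq> 0 \<Longrightarrow> i + j \<le> total_degree p"
  unfolding total_degree_def by (rule Max_ge) (use finite_total_degree_set[of p] in auto)

lemma bieval_0: "bieval p 0 = cc p 0 0"
proof -
  have "[:0:] = (0 :: complex poly)" by simp
  thus ?thesis by (simp add: bieval_def poly_0_coeff_0)
qed

lemma cubic0I: "total_degree p \<le> 3 \<Longrightarrow> bieval p 0 = 0 \<Longrightarrow> cubic0 p"
  unfolding cubic0_def bieval_0 using cc_bound by (metis add_is_0 le_trans not_less_eq_eq One_nat_def le0 nat_less_le not_less_eq less_Suc0)

lemma total_degree_le: "(\<And>i j. cc p i j \<noteq> 0 \<Longrightarrow> i + j \<le> n) \<Longrightarrow> total_degree p \<le> n"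
  unfolding total_degree_def by (subst Max_le_iff) (use finite_total_degree_set[of p] in auto)

lemma total_degree_cubic0: "cubic0 p \<Longrightarrow> total_degree p \<le> 3"
  by (rule total_degree_le) (auto simp: cubic0_def)

lemma bieval_add: "bieval (p + q) z = bieval p z + bieval q z" by (simp add: bieval_def)
lemma bieval_diff: "bieval (p - q) z = bieval p z - bieval q z" by (simp add: bieval_def)
lemma bieval_mult: "bieval (p * q) z = bieval p z * bieval q z" by (simp add: bieval_def)
lemma bieval_smult: "bieval (smult [:c:] p) z = c * bieval p z" by (simp add: bieval_def)
lemma bieval_zero: "bieval 0 z = 0" by (simp add: bieval_def)

text \<open>The constants \<open>[:t:]\<close> are infinitely many points at which the outer polynomial vanishes.\<close>
lemma bieval_ext: assumes "\<And>z. bieval p z = bieval q z" shows "p = q"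
proof -
  have "poly (p - q) [:t:] = 0" for t
  proof -
    have "poly (poly (p - q) [:t:]) s = 0" for s
      using assms[of "(s,t)"] by (simp add: bieval_def)
    thus ?thesis using poly_all_0_iff_0 by blast
  qed
  hence "range (\<lambda>t. [:t:]) \<subseteq> {x. poly (p - q) x = 0}" by auto
  moreover have "infinite (range (\<lambda>t::complex. [:t:]))"
    by (subst finite_image_iff) (auto intro: injI simp: infinite_UNIV_char_0)
  ultimately have "p - q = 0" using poly_roots_finite finite_subset by blast
  thus ?thesis by simp
qed

lemma cubic0_subspace: "bipoly.subspace {p. cubic0 p}"
  unfolding bipoly.subspace_def
proof (intro conjI ballI allI)
  show "0 \<in> {p. cubic0 p}" by (simp add: cubic0_def)
  show "x + y \<in> {p. cubic0 p}" if "x \<in> {p. cubic0 p}" "y \<in> {p. cubic0 p}" for x y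
    using that unfolding cubic0_def mem_Collect_eq coeff_add by (metis add_0_right)
  show "smult [:c:] x \<in> {p. cubic0 p}" if "x \<in> {p. cubic0 p}" for c x
    using that by (auto simp: cubic0_def)
qed

section \<open>Gram functions of polynomial maps\<close>

text \<open>The polarized squared norm of the map. It is unchanged under unitary changes of the target, and it is
all that the sphere identity sees of the map.\<close>
definition gram :: "bipoly list \<Rightarrow> complex \<times> complex \<Rightarrow> complex \<times> complex \<Rightarrow> complex" where
  "gram P z w = (\<Sum>p\<leftarrow>P. bieval p z * cnj (bieval p w))"

locale functional =
  fixes \<phi> :: "bipoly \<Rightarrow> complex"
  assumes add: "\<phi> (p + q) = \<phi> p + \<phi> q" and scale: "\<phi> (smult [:c:] p) = c * \<phi> p"
begin

lemma span_zero: assumes "\<And>p. p \<in> S \<Longrightarrow> \<phi> p = 0" and "x \<in> bipoly.span S" shows "\<phi> x = 0"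
proof -
  have 0: "\<phi> 0 = 0" using scale[of 0 0] by simp
  have "bipoly.subspace {p. \<phi> p = 0}"
    unfolding bipoly.subspace_def by (auto simp: add scale 0)
  hence "bipoly.span S \<subseteq> {p. \<phi> p = 0}" using assms(1) by (intro bipoly.span_minimal) auto
  thus ?thesis using assms(2) by auto
qed

text \<open>A rotation in the plane of \<open>p\<close> and \<open>g\<close> with coefficients proportional to \<open>cnj (\<phi> p)\<close> and \<open>cnj (\<phi> g)\<close> moves
the whole value of \<open>\<phi>\<close> into one of the two polynomials, as in Gaussian elimination by unitary matrices.\<close>
lemma rotate_two:
  obtains f h where "\<phi> h = 0" "\<And>z w. bieval f z * cnj (bieval f w) + bieval h z * cnj (bieval h w) = bieval p z * cnj (bieval p w) + bieval g z * cnj (bieval g w)"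
    "f \<in> bipoly.span {p, g}" "h \<in> bipoly.span {p, g}" "p \<in> bipoly.span {f, h}" "g \<in> bipoly.span {f, h}"
proof (cases "\<phi> p = 0 \<and> \<phi> g = 0")
  case True
  thus ?thesis by (intro that[of g p]) (auto intro: bipoly.span_base)
next
  case False
  define n where "n = sqrt ((cmod (\<phi> p))\<^sup>2 + (cmod (\<phi> g))\<^sup>2)"
  have n2: "n\<^sup>2 = (cmod (\<phi> p))\<^sup>2 + (cmod (\<phi> g))\<^sup>2" by (simp add: n_def)
  have n0: "n \<noteq> 0" using False unfolding n_def by (auto simp: sum_power2_eq_zero_iff)
  define a where "a = \<phi> p / n"
  define b where "b = \<phi> g / n"
  have ab: "a * cnj a + b * cnj b = 1"
  proof -
    have "a * cnj a + b * cnj b = complex_of_real (((cmod (\<phi> p))\<^sup>2 + (cmod (\<phi> g))\<^sup>2) / n\<^sup>2)"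
      by (simp add: a_def b_def nsq power2_eq_square add_divide_distrib)
    thus ?thesis unfolding n2[symmetric] using n0 by simp
  qed
  define f where "f = smult [:cnj a:] p + smult [:cnj b:] g"
  define h where "h = smult [:- b:] p + smult [:a:] g"
  have ev: "bieval f z = cnj a * bieval p z + cnj b * bieval g z" "bieval h z = - b * bieval p z + a * bieval g z" for z
    unfolding f_def h_def bieval_add bieval_smult by simp_all
  have p: "p = smult [:a:] f + smult [:- cnj b:] h"
    by (rule bieval_ext, unfold bieval_add bieval_smult ev) (use ab in algebra)
  have g: "g = smult [:b:] f + smult [:cnj a:] h"
    by (rule bieval_ext, unfold bieval_add bieval_smult ev) (use ab in algebra)
  show ?thesis
  proof (rule that)
    show "\<phi> h = 0" unfolding h_def add scale a_def b_def by simp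
    show "bieval f z * cnj (bieval f w) + bieval h z * cnj (bieval h w) = bieval p z * cnj (bieval p w) + bieval g z * cnj (bieval g w)" for z w
      unfolding ev complex_cnj_add complex_cnj_mult complex_cnj_cnj complex_cnj_minus using ab by algebra
    show "f \<in> bipoly.span {p, g}" "h \<in> bipoly.span {p, g}" unfolding f_def h_def
      by (intro bipoly.span_add bipoly.span_scale bipoly.span_base; simp)+
    show "p \<in> bipoly.span {f, h}" by (subst p) (intro bipoly.span_add bipoly.span_scale bipoly.span_base; simp)
    show "g \<in> bipoly.span {f, h}" by (subst g) (intro bipoly.span_add bipoly.span_scale bipoly.span_base; simp)
  qed
qed

text \<open>Iterating the rotation of two components concentrates \<open>\<phi>\<close> in a single component, with neither the
Gram function nor the span changed.\<close>
lemma gram_reduce: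
  assumes "P \<noteq> []"
  shows "\<exists>f Q. length P = Suc (length Q) \<and> (\<forall>q\<in>set Q. \<phi> q = 0) \<and> gram (f # Q) = gram P \<and> bipoly.span (set (f # Q)) = bipoly.span (set P)"
  using assms
proof (induction P)
  case Nil thus ?case by simp
next
  case (Cons p P)
  show ?case
  proof (cases "P = []")
    case True
    thus ?thesis by (intro exI[of _ p] exI[of _ "[]"]) simp
  next
    case False
    then obtain g Q where Q: "length P = Suc (length Q)" "\<forall>q\<in>set Q. \<phi> q = 0" "gram (g # Q) = gram P" "bipoly.span (set (g # Q)) = bipoly.span (set P)"
      using Cons.IH by blast
    obtain f h where fh: "\<phi> h = 0" "\<And>z w. bieval f z * cnj (bieval f w) + bieval h z * cnj (bieval h w) = bieval p z * cnj (bieval p w) + bieval g z * cnj (bieval g w)"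
      "f \<in> bipoly.span {p, g}" "h \<in> bipoly.span {p, g}" "p \<in> bipoly.span {f, h}" "g \<in> bipoly.span {f, h}"
      by (rule rotate_two[of p g]) (rule that, assumption+)
    have "gram (f # h # Q) z w = gram (p # P) z w" for z w
    proof -
      have "gram (f # h # Q) z w = (bieval f z * cnj (bieval f w) + bieval h z * cnj (bieval h w)) + gram Q z w"
        by (simp add: gram_def)
      also have "\<dots> = bieval p z * cnj (bieval p w) + gram (g # Q) z w" unfolding fh(2) by (simp add: gram_def)
      also have "\<dots> = gram (p # P) z w" unfolding Q(3) by (simp add: gram_def)
      finally show ?thesis .
    qed
    hence gr: "gram (f # h # Q) = gram (p # P)" by (intro ext) auto
    have s1: "bipoly.span {p, g} \<subseteq> bipoly.span (insert p (insert g (set Q)))" "bipoly.span {f, h} \<subseteq> bipoly.span (insert f (insert h (set Q)))"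
      by (intro bipoly.span_mono; auto)+
    have "bipoly.span (insert f (insert h (set Q))) = bipoly.span (insert p (insert g (set Q)))"
      unfolding bipoly.span_eq using fh s1 by (auto intro: bipoly.span_base)
    also have "\<dots> = bipoly.span (insert p (set P))"
    proof -
      show ?thesis using Q(4) by (simp add: bipoly.span_insert)
    qed
    finally show ?thesis using Q fh gr by (intro exI[of _ f] exI[of _ "h # Q"]) simp
  qed
qed

end

lemma functional_cc: "functional (\<lambda>p. cc p i j)" by unfold_locales simp_all

text \<open>Taking a nonzero coefficient of some component for \<open>\<phi>\<close>, the component that carries it is independent of
the others, so repeated reduction ends with a basis of the span.\<close>
lemma gram_basis:
  "\<exists>F. gram F = gram P \<and> bipoly.span (set F) = bipoly.span (set P) \<and> distinct F \<and> bipoly.independent (set F)"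
proof (induction "length P" arbitrary: P)
  case 0
  thus ?case by (intro exI[of _ "[]"]) (simp add: bipoly.independent_empty)
next
  case (Suc n)
  show ?case
  proof (cases "\<forall>p\<in>set P. p = 0")
    case True
    have "gram P z w = 0" for z w using True
      by (induction P) (simp_all add: gram_def bieval_zero)
    moreover have "set P = {0}" using True Suc(2) by (cases P) auto
    hence "bipoly.span (set P) = bipoly.span {}" by (simp add: bipoly.span_insert_0)
    ultimately show ?thesis by (intro exI[of _ "[]"]) (auto simp: gram_def fun_eq_iff bipoly.independent_empty)
  next
    case False
    then obtain p where p: "p \<in> set P" "p \<noteq> 0" by auto
    then obtain j where "coeff p j \<noteq> 0" by (meson leading_coeff_0_iff)
    then obtain i where ij: "cc p i j \<noteq> 0" by (meson leading_coeff_0_iff)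
    interpret functional "\<lambda>p. cc p i j" by (rule functional_cc)
    obtain f Q where Q: "length P = Suc (length Q)" "\<forall>q\<in>set Q. cc q i j = 0" "gram (f # Q) = gram P" "bipoly.span (set (f # Q)) = bipoly.span (set P)"
      using gram_reduce[of P] p by fastforce
    obtain F where F: "gram F = gram Q" "bipoly.span (set F) = bipoly.span (set Q)" "distinct F" "bipoly.independent (set F)"
      using Suc(1)[of Q] Q(1) Suc(2) by auto
    have fz: "cc f i j \<noteq> 0"
    proof
      assume "cc f i j = 0"
      hence "\<And>q. q \<in> set (f # Q) \<Longrightarrow> cc q i j = 0" using Q(2) by auto
      moreover have "p \<in> bipoly.span (set (f # Q))" using Q(4) p bipoly.span_base by auto
      ultimately have "cc p i j = 0" by (rule span_zero)
      thus False using ij by simp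
    qed
    have nf: "f \<notin> bipoly.span (set F)"
      using span_zero[of "set Q" f] Q(2) fz unfolding F(2) by auto
    have "gram (f # F) = gram P" using F(1) Q(3) by (auto simp: gram_def fun_eq_iff)
    moreover have "bipoly.span (set (f # F)) = bipoly.span (set P)"
      using F(2) unfolding Q(4)[symmetric] by (simp add: bipoly.span_insert)
    moreover have "distinct (f # F)" using F(3) nf bipoly.span_base by auto
    moreover have "bipoly.independent (set (f # F))"
      using nf F(4) by (simp add: bipoly.independent_insertI)
    ultimately show ?thesis by blast
  qed
qed

text \<open>A basis of the span with the same Gram function has as many elements as the minimal target dimension, and
zeros may be added to it.\<close>
lemma gram_fixed_length:
  assumes "min_target_dim P \<le> k"
  obtains F where "length F = k" "gram F = gram P" "bipoly.span (set F) = bipoly.span (set P)"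
proof -
  obtain F where F: "gram F = gram P" "bipoly.span (set F) = bipoly.span (set P)" "distinct F" "bipoly.independent (set F)"
    using gram_basis by blast
  have "length F = card (set F)" using F(3) by (simp add: distinct_card)
  also have "\<dots> = min_target_dim P"
    unfolding min_target_dim_def F(2)[symmetric] using F(4) by (simp add: bipoly.dim_eq_card_independent bipoly.dim_span)
  finally have l: "length F \<le> k" using assms by simp
  have "gram (F @ replicate (k - length F) 0) z w = gram F z w" for z w
    by (simp add: gram_def sum_list_replicate map_replicate bieval_zero)
  hence "gram (F @ replicate (k - length F) 0) = gram P" using F(1) by (auto simp: fun_eq_iff)
  moreover have "bipoly.span (set (F @ replicate (k - length F) 0)) = bipoly.span (set P)"
    using F(2) by (simp add: set_replicate_conv_if bipoly.span_insert_0)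
  ultimately show ?thesis using l that[of "F @ replicate (k - length F) 0"] by simp
qed

section \<open>Polarization of the sphere identity\<close>

text \<open>Polynomial functions of one complex variable, described by closure properties so that membership of
explicit expressions follows from introduction rules.\<close>
definition polyfun :: "(complex \<Rightarrow> complex) \<Rightarrow> bool" where "polyfun f \<longleftrightarrow> (\<exists>P. \<forall>t. f t = poly P t)"

lemma polyfun_const: "polyfun (\<lambda>t. c)" unfolding polyfun_def by (rule exI[of _ "[:c:]"]) simp
lemma polyfun_id: "polyfun (\<lambda>t. t)" unfolding polyfun_def by (rule exI[of _ "[:0,1:]"]) simp
lemma polyfun_add: "polyfun f \<Longrightarrow> polyfun g \<Longrightarrow> polyfun (\<lambda>t. f t + g t)"
  unfolding polyfun_def by (metis poly_add)
lemma polyfun_diff: "polyfun f \<Longrightarrow> polyfun g \<Longrightarrow> polyfun (\<lambda>t. f t - g t)"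
  unfolding polyfun_def by (metis poly_diff)
lemma polyfun_mult: "polyfun f \<Longrightarrow> polyfun g \<Longrightarrow> polyfun (\<lambda>t. f t * g t)"
  unfolding polyfun_def by (metis poly_mult)
lemma polyfun_power: "polyfun f \<Longrightarrow> polyfun (\<lambda>t. f t ^ n)"
  unfolding polyfun_def by (metis poly_power)
lemma polyfun_sum_list: "(\<And>x. polyfun (f x)) \<Longrightarrow> polyfun (\<lambda>t. \<Sum>x\<leftarrow>xs. f x t)"
  by (induction xs) (auto intro: polyfun_const polyfun_add)
lemmas polyfun_intros = polyfun_const polyfun_id polyfun_add polyfun_diff polyfun_mult polyfun_power polyfun_sum_list

lemma polyfun_zero:
  assumes "polyfun f" and "\<And>x::real. f (of_real x) = 0" shows "f t = 0"
proof -
  obtain P where P: "\<And>t. f t = poly P t" using assms(1) unfolding polyfun_def by blast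
  have "infinite (range complex_of_real)"
    by (subst finite_image_iff) (auto intro: injI simp: infinite_UNIV_char_0)
  moreover have "range complex_of_real \<subseteq> {x. poly P x = 0}" using assms(2) P by auto
  ultimately have "P = 0" using poly_roots_finite finite_subset by blast
  thus ?thesis using P by simp
qed

text \<open>In the coordinates \<open>z = x + \<i> y\<close>, \<open>u = x - \<i> y\<close> the hypothesis says that the polynomial vanishes at all
real \<open>x1, x2, y1, y2\<close>. A polynomial in one variable that vanishes on the reals is zero, so the four real
variables can be made complex one after the other.\<close>
lemma polarization:
  fixes H :: "complex \<Rightarrow> complex \<Rightarrow> complex \<Rightarrow> complex \<Rightarrow> complex"
  assumes poly: "\<And>a b c d a' b' c' d'. polyfun (\<lambda>t. H (a + a' * t) (b + b' * t) (c + c' * t) (d + d' * t))"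
    and diag: "\<And>z1 z2. H z1 z2 (cnj z1) (cnj z2) = 0"
  shows "H z1 z2 u1 u2 = 0"
proof -
  define G where "G x1 x2 y1 y2 = H (x1 + \<i> * y1) (x2 + \<i> * y2) (x1 - \<i> * y1) (x2 - \<i> * y2)" for x1 x2 y1 y2
  have G0: "G (of_real x1) (of_real x2) (of_real y1) (of_real y2) = 0" for x1 x2 y1 y2 :: real
    using diag[of "of_real x1 + \<i> * of_real y1" "of_real x2 + \<i> * of_real y2"] by (simp add: G_def)
  have G1: "G x1 (of_real x2) (of_real y1) (of_real y2) = 0" for x1 and x2 y1 y2 :: real
    by (rule polyfun_zero[of "\<lambda>x1. G x1 (of_real x2) (of_real y1) (of_real y2)"])
       (use poly[of "\<i> * y1" 1 "x2 + \<i> * y2" 0 "- \<i> * y1" 1 "x2 - \<i> * y2" 0] G0 in \<open>simp_all add: G_def add.commute\<close>)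
  have G2: "G x1 x2 (of_real y1) (of_real y2) = 0" for x1 x2 and y1 y2 :: real
    by (rule polyfun_zero[of "\<lambda>x2. G x1 x2 (of_real y1) (of_real y2)"])
       (use poly[of "x1 + \<i> * y1" 0 "\<i> * y2" 1 "x1 - \<i> * y1" 0 "- \<i> * y2" 1] G1 in \<open>simp_all add: G_def add.commute\<close>)
  have G3: "G x1 x2 y1 (of_real y2) = 0" for x1 x2 y1 and y2 :: real
    by (rule polyfun_zero[of "\<lambda>y1. G x1 x2 y1 (of_real y2)"])
       (use poly[of "x1" "\<i>" "x2 + \<i> * y2" 0 "x1" "- \<i>" "x2 - \<i> * y2" 0] G2 in \<open>simp_all add: G_def\<close>)
  have G4: "G x1 x2 y1 y2 = 0" for x1 x2 y1 y2
    by (rule polyfun_zero[of "\<lambda>y2. G x1 x2 y1 y2"])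
       (use poly[of "x1 + \<i> * y1" 0 "x2" "\<i>" "x1 - \<i> * y1" 0 "x2" "- \<i>"] G3 in \<open>simp_all add: G_def\<close>)
  have "(z1 + u1) / 2 + \<i> * ((z1 - u1) / (2 * \<i>)) = z1" "(z1 + u1) / 2 - \<i> * ((z1 - u1) / (2 * \<i>)) = u1" for z1 u1
    by (simp_all add: field_simps)
  thus ?thesis using G4[of "(z1 + u1) / 2" "(z2 + u2) / 2" "(z1 - u1) / (2 * \<i>)" "(z2 - u2) / (2 * \<i>)"]
    unfolding G_def by simp
qed

text \<open>The homogeneous parts of a cubic polynomial, and below the forms with conjugated coefficients, which
replace the complex conjugates of the parts after polarization.\<close>
definition linp :: "bipoly \<Rightarrow> complex \<Rightarrow> complex \<Rightarrow> complex" where "linp p = lf (cc p 1 0) (cc p 0 1)"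
definition quadp :: "bipoly \<Rightarrow> complex \<Rightarrow> complex \<Rightarrow> complex" where "quadp p = qf (cc p 2 0) (cc p 1 1) (cc p 0 2)"
definition cubp :: "bipoly \<Rightarrow> complex \<Rightarrow> complex \<Rightarrow> complex" where "cubp p = cf (cc p 3 0) (cc p 2 1) (cc p 1 2) (cc p 0 3)"

definition linb :: "bipoly \<Rightarrow> complex \<Rightarrow> complex \<Rightarrow> complex" where "linb p = lf (cnj (cc p 1 0)) (cnj (cc p 0 1))"
definition quadb :: "bipoly \<Rightarrow> complex \<Rightarrow> complex \<Rightarrow> complex" where "quadb p = qf (cnj (cc p 2 0)) (cnj (cc p 1 1)) (cnj (cc p 0 2))"
definition cubb :: "bipoly \<Rightarrow> complex \<Rightarrow> complex \<Rightarrow> complex" where "cubb p = cf (cnj (cc p 3 0)) (cnj (cc p 2 1)) (cnj (cc p 1 2)) (cnj (cc p 0 3))"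

lemma conjugate_forms: "linb p (cnj s) (cnj t) = cnj (linp p s t)" "quadb p (cnj s) (cnj t) = cnj (quadp p s t)" "cubb p (cnj s) (cnj t) = cnj (cubp p s t)"
  by (simp_all add: linb_def quadb_def cubb_def linp_def quadp_def cubp_def lf_def qf_def cf_def)

lemma bieval_cubic0: "cubic0 p \<Longrightarrow> bieval p (s,t) = linp p s t + quadp p s t + cubp p s t"
  unfolding linp_def quadp_def cubp_def by (subst cubic0_eq, assumption) (rule bieval_bp)

lemma homogeneous: "linp p (k * s) (k * t) = k * linp p s t" "quadp p (k * s) (k * t) = k\<^sup>2 * quadp p s t" "cubp p (k * s) (k * t) = k^3 * cubp p s t"
   "qf a b c (k * s) (k * t) = k\<^sup>2 * qf a b c s t"
  by (simp_all add: linp_def quadp_def cubp_def lf_def qf_def cf_def power2_eq_square power3_eq_cube algebra_simps)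

text \<open>Coefficient comparison for a real trigonometric polynomial of degree two; the values at the eighth
roots of unity suffice.\<close>
lemma trig_zero:
  fixes A B C :: complex
  assumes "\<And>k. cmod k = 1 \<Longrightarrow> A * k\<^sup>2 + B * k + C + cnj B * cnj k + cnj A * cnj (k\<^sup>2) = 0" and "cnj C = C"
  shows "A = 0" "B = 0" "C = 0"
proof -
  have 1: "A + B + C + cnj B + cnj A = 0" using assms(1)[of 1] by simp
  have 2: "A - B + C - cnj B + cnj A = 0" using assms(1)[of "-1"] by simp
  have 3: "- A + \<i> * B + C - \<i> * cnj B - cnj A = 0" using assms(1)[of \<i>] by (simp add: algebra_simps)
  have 4: "- A - \<i> * B + C + \<i> * cnj B - cnj A = 0" using assms(1)[of "-\<i>"] by (simp add: algebra_simps)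
  have C: "4 * C = 0" using 1 2 3 4 by algebra
  thus C: "C = 0" by simp
  have "4 * \<i> * B = \<i> * ((A + B + C + cnj B + cnj A) - (A - B + C - cnj B + cnj A))
      + ((- A + \<i> * B + C - \<i> * cnj B - cnj A) - (- A - \<i> * B + C + \<i> * cnj B - cnj A))"
    by (simp add: algebra_simps)
  also have "\<dots> = 0" unfolding 1 2 3 4 by simp
  finally show B: "B = 0" by simp
  have 5: "A + cnj A = 0" using 1 B C by simp
  define k where "k = Complex (sqrt (1/2)) (sqrt (1/2))"
  have k2: "k\<^sup>2 = \<i>" by (simp add: k_def complex_eq_iff power2_eq_square)
  have "cmod k = 1" by (simp add: k_def cmod_def)
  hence "A * \<i> - cnj A * \<i> = 0" using assms(1)[of k] k2 B C by simp
  hence "\<i> * (A - cnj A) = 0" by (simp add: algebra_simps)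
  thus "A = 0" using 5 by (simp add: algebra_simps)
qed

lemma sum_list_cnj: "cnj (\<Sum>x\<leftarrow>xs. f x) = (\<Sum>x\<leftarrow>xs. cnj (f x))" by (induction xs) simp_all

context
  fixes F :: "bipoly list" and qa qb qc :: complex
  assumes cub: "\<And>f. f \<in> set F \<Longrightarrow> cubic0 f"
    and sph: "\<And>s t. (cmod s)\<^sup>2 + (cmod t)\<^sup>2 = 1 \<Longrightarrow> gram F (s,t) (s,t) = (1 + qf qa qb qc s t) * cnj (1 + qf qa qb qc s t)"
begin

text \<open>Replacing \<open>(s,t)\<close> by \<open>(k s, k t)\<close> with \<open>|k| = 1\<close> stays on the sphere and multiplies the part of degree
\<open>d\<close> by \<open>k ^ d\<close>, so the sphere identity becomes a trigonometric polynomial in \<open>k\<close> whose coefficients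
vanish separately.\<close>
lemma sphere_identities:
  assumes st: "(cmod s)\<^sup>2 + (cmod t)\<^sup>2 = 1"
  shows "(\<Sum>f\<leftarrow>F. cubp f s t * cnj (linp f s t)) = qf qa qb qc s t" (is "?c2 = ?q")
    "(\<Sum>f\<leftarrow>F. cubp f s t * cnj (quadp f s t) + quadp f s t * cnj (linp f s t)) = 0" (is "?c1 = 0")
    "(\<Sum>f\<leftarrow>F. cubp f s t * cnj (cubp f s t) + quadp f s t * cnj (quadp f s t) + linp f s t * cnj (linp f s t)) = 1 + qf qa qb qc s t * cnj (qf qa qb qc s t)" (is "?c0 = _")
proof -
  have E: "(?c2 - ?q) * k\<^sup>2 + ?c1 * k + (?c0 - (1 + ?q * cnj ?q)) + cnj ?c1 * cnj k + cnj (?c2 - ?q) * cnj (k\<^sup>2) = 0"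
    if k: "cmod k = 1" for k
  proof -
    have kk: "k * cnj k = 1" using k by (simp add: nsq)
    have "(cmod (k * s))\<^sup>2 + (cmod (k * t))\<^sup>2 = 1" using st k by (simp add: norm_mult)
    note S = sph[OF this]
    have "gram F (k * s, k * t) (k * s, k * t) = ?c2 * k\<^sup>2 + ?c1 * k + ?c0 + cnj ?c1 * cnj k + cnj ?c2 * cnj (k\<^sup>2)"
      using cub
    proof (induction F)
      case Nil thus ?case by (simp add: gram_def)
    next
      case (Cons f F)
      have "cubic0 f" using Cons.prems by simp
      hence e: "bieval f (k * s, k * t) = k * linp f s t + k\<^sup>2 * quadp f s t + k^3 * cubp f s t"
        by (simp add: bieval_cubic0 homogeneous)
      define l where "l = linp f s t" define m where "m = quadp f s t" define n where "n = cubp f s t"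
      have "bieval f (k * s, k * t) * cnj (bieval f (k * s, k * t)) =
         n * cnj l * k\<^sup>2 + (n * cnj m + m * cnj l) * k + (n * cnj n + m * cnj m + l * cnj l) + cnj (n * cnj m + m * cnj l) * cnj k + cnj (n * cnj l) * cnj (k\<^sup>2)"
        unfolding e l_def[symmetric] m_def[symmetric] n_def[symmetric] complex_cnj_add complex_cnj_mult complex_cnj_power complex_cnj_cnj
        using kk by algebra
      thus ?case using Cons.IH Cons.prems
        by (simp add: gram_def l_def m_def n_def algebra_simps)
    qed
    moreover have "(1 + qf qa qb qc (k * s) (k * t)) * cnj (1 + qf qa qb qc (k * s) (k * t)) = 1 + ?q * cnj ?q + ?q * k\<^sup>2 + cnj ?q * cnj (k\<^sup>2)"
      unfolding homogeneous complex_cnj_add complex_cnj_mult complex_cnj_power complex_cnj_one using kk by algebra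
    ultimately show ?thesis using S by (simp add: algebra_simps)
  qed
  have R: "cnj (?c0 - (1 + ?q * cnj ?q)) = ?c0 - (1 + ?q * cnj ?q)"
    by (simp add: sum_list_cnj mult.commute)
  show "?c2 = ?q" using trig_zero(1)[OF E R] by simp
  show "?c1 = 0" by (rule trig_zero(2)[OF E R])
  show "?c0 = 1 + ?q * cnj ?q" using trig_zero(3)[OF E R] by simp
qed

lemma sum_list_scale: "(\<Sum>x\<leftarrow>xs. c * f x) = c * (\<Sum>x\<leftarrow>xs. f x :: complex)" by (induction xs) (simp_all add: algebra_simps)

text \<open>The identities on the sphere are made homogeneous by powers of \<open>z1 cnj z1 + z2 cnj z2\<close>, hence hold at all
points, and then polarized.\<close>
lemma polarized_identities:
  "(\<Sum>f\<leftarrow>F. cubp f z1 z2 * linb f u1 u2) = qf qa qb qc z1 z2 * (z1*u1 + z2*u2)"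
  "(\<Sum>f\<leftarrow>F. cubp f z1 z2 * quadb f u1 u2) + (z1*u1 + z2*u2) * (\<Sum>f\<leftarrow>F. quadp f z1 z2 * linb f u1 u2) = 0"
  "(\<Sum>f\<leftarrow>F. cubp f z1 z2 * cubb f u1 u2)
     + (z1*u1 + z2*u2) * ((\<Sum>f\<leftarrow>F. quadp f z1 z2 * quadb f u1 u2) - qf qa qb qc z1 z2 * qf (cnj qa) (cnj qb) (cnj qc) u1 u2)
     + (z1*u1 + z2*u2)\<^sup>2 * (\<Sum>f\<leftarrow>F. linp f z1 z2 * linb f u1 u2) - (z1*u1 + z2*u2)^3 = 0"
proof -
  note defs = linb_def quadb_def cubb_def linp_def quadp_def cubp_def lf_def qf_def cf_def
  have diag: "(\<Sum>f\<leftarrow>F. cubp f z1 z2 * linb f (cnj z1) (cnj z2)) - qf qa qb qc z1 z2 * (z1*cnj z1 + z2*cnj z2) = 0 \<and>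
    (\<Sum>f\<leftarrow>F. cubp f z1 z2 * quadb f (cnj z1) (cnj z2)) + (z1*cnj z1 + z2*cnj z2) * (\<Sum>f\<leftarrow>F. quadp f z1 z2 * linb f (cnj z1) (cnj z2)) = 0 \<and>
    (\<Sum>f\<leftarrow>F. cubp f z1 z2 * cubb f (cnj z1) (cnj z2))
     + (z1*cnj z1 + z2*cnj z2) * ((\<Sum>f\<leftarrow>F. quadp f z1 z2 * quadb f (cnj z1) (cnj z2)) - qf qa qb qc z1 z2 * qf (cnj qa) (cnj qb) (cnj qc) (cnj z1) (cnj z2))
     + (z1*cnj z1 + z2*cnj z2)\<^sup>2 * (\<Sum>f\<leftarrow>F. linp f z1 z2 * linb f (cnj z1) (cnj z2)) - (z1*cnj z1 + z2*cnj z2)^3 = 0" for z1 z2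
  proof (cases "z1 = 0 \<and> z2 = 0")
    case True
    thus ?thesis by (simp add: defs)
  next
    case False
    define n where "n = sqrt ((cmod z1)\<^sup>2 + (cmod z2)\<^sup>2)"
    have n2: "n\<^sup>2 = (cmod z1)\<^sup>2 + (cmod z2)\<^sup>2" by (simp add: n_def)
    have n0: "n \<noteq> 0" using False unfolding n_def by (auto simp: sum_power2_eq_zero_iff)
    define s where "s = z1 / n" define t where "t = z2 / n"
    have z: "z1 = n * s" "z2 = n * t" using n0 by (simp_all add: s_def t_def)
    have "(cmod s)\<^sup>2 + (cmod t)\<^sup>2 = ((cmod z1)\<^sup>2 + (cmod z2)\<^sup>2) / n\<^sup>2"
      using n0 by (simp add: s_def t_def norm_divide power_divide add_divide_distrib)
    hence st: "(cmod s)\<^sup>2 + (cmod t)\<^sup>2 = 1" unfolding n2[symmetric] using n0 by simp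
    note S = sphere_identities[OF st]
    have nn: "z1*cnj z1 + z2*cnj z2 = complex_of_real n ^ 2" using n2 by (simp add: nsq flip: of_real_add of_real_power)
    define N where "N = complex_of_real n"
    have cN: "cnj N = N" by (simp add: N_def)
    have qq: "qf (cnj qa) (cnj qb) (cnj qc) (cnj z1) (cnj z2) = cnj (qf qa qb qc z1 z2)" by (simp add: qf_def)
    have a: "(\<Sum>f\<leftarrow>F. cubp f z1 z2 * linb f (cnj z1) (cnj z2)) = N^4 * (\<Sum>f\<leftarrow>F. cubp f s t * cnj (linp f s t))"
      unfolding conjugate_forms unfolding z N_def[symmetric] homogeneous sum_list_scale[symmetric] complex_cnj_mult complex_cnj_power cN
      by (intro arg_cong[of _ _ sum_list] map_cong refl) algebra
    have b: "(\<Sum>f\<leftarrow>F. cubp f z1 z2 * quadb f (cnj z1) (cnj z2)) + N\<^sup>2 * (\<Sum>f\<leftarrow>F. quadp f z1 z2 * linb f (cnj z1) (cnj z2))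
       = N^5 * (\<Sum>f\<leftarrow>F. cubp f s t * cnj (quadp f s t) + quadp f s t * cnj (linp f s t))"
      unfolding conjugate_forms unfolding z N_def[symmetric] homogeneous sum_list_scale[symmetric] complex_cnj_mult complex_cnj_power cN sum_list_addf[symmetric]
      by (intro arg_cong[of _ _ sum_list] map_cong refl) algebra
    have c: "(\<Sum>f\<leftarrow>F. cubp f z1 z2 * cubb f (cnj z1) (cnj z2)) + N\<^sup>2 * (\<Sum>f\<leftarrow>F. quadp f z1 z2 * quadb f (cnj z1) (cnj z2))
        + (N\<^sup>2)\<^sup>2 * (\<Sum>f\<leftarrow>F. linp f z1 z2 * linb f (cnj z1) (cnj z2))
       = N^6 * (\<Sum>f\<leftarrow>F. cubp f s t * cnj (cubp f s t) + quadp f s t * cnj (quadp f s t) + linp f s t * cnj (linp f s t))"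
      unfolding conjugate_forms unfolding z N_def[symmetric] homogeneous sum_list_scale[symmetric] complex_cnj_mult complex_cnj_power cN sum_list_addf[symmetric]
      by (intro arg_cong[of _ _ sum_list] map_cong refl) algebra
    have q: "qf qa qb qc z1 z2 = N\<^sup>2 * qf qa qb qc s t" unfolding z N_def[symmetric] homogeneous ..
    show ?thesis unfolding nn qq N_def[symmetric]
    proof (intro conjI)
      show "(\<Sum>f\<leftarrow>F. cubp f z1 z2 * linb f (cnj z1) (cnj z2)) - qf qa qb qc z1 z2 * N\<^sup>2 = 0"
        unfolding a S(1) q by algebra
      show "(\<Sum>f\<leftarrow>F. cubp f z1 z2 * quadb f (cnj z1) (cnj z2)) + N\<^sup>2 * (\<Sum>f\<leftarrow>F. quadp f z1 z2 * linb f (cnj z1) (cnj z2)) = 0"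
        unfolding b S(2) by simp
      show "(\<Sum>f\<leftarrow>F. cubp f z1 z2 * cubb f (cnj z1) (cnj z2))
         + N\<^sup>2 * ((\<Sum>f\<leftarrow>F. quadp f z1 z2 * quadb f (cnj z1) (cnj z2)) - qf qa qb qc z1 z2 * cnj (qf qa qb qc z1 z2))
         + (N\<^sup>2)\<^sup>2 * (\<Sum>f\<leftarrow>F. linp f z1 z2 * linb f (cnj z1) (cnj z2)) - (N\<^sup>2)^3 = 0"
        using c unfolding S(3) q complex_cnj_mult complex_cnj_power cN by algebra
    qed
  qed
  have "(\<Sum>f\<leftarrow>F. cubp f z1 z2 * linb f u1 u2) - qf qa qb qc z1 z2 * (z1*u1 + z2*u2) = 0"
    by (rule polarization[of "\<lambda>z1 z2 u1 u2. (\<Sum>f\<leftarrow>F. cubp f z1 z2 * linb f u1 u2) - qf qa qb qc z1 z2 * (z1*u1 + z2*u2)"])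
       (use diag in \<open>auto simp: defs intro!: polyfun_intros\<close>)
  thus "(\<Sum>f\<leftarrow>F. cubp f z1 z2 * linb f u1 u2) = qf qa qb qc z1 z2 * (z1*u1 + z2*u2)" by simp
  show "(\<Sum>f\<leftarrow>F. cubp f z1 z2 * quadb f u1 u2) + (z1*u1 + z2*u2) * (\<Sum>f\<leftarrow>F. quadp f z1 z2 * linb f u1 u2) = 0"
    by (rule polarization[of "\<lambda>z1 z2 u1 u2. (\<Sum>f\<leftarrow>F. cubp f z1 z2 * quadb f u1 u2) + (z1*u1 + z2*u2) * (\<Sum>f\<leftarrow>F. quadp f z1 z2 * linb f u1 u2)"],
        unfold defs, intro polyfun_intros) (use diag in \<open>simp add: defs\<close>)
  show "(\<Sum>f\<leftarrow>F. cubp f z1 z2 * cubb f u1 u2)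
     + (z1*u1 + z2*u2) * ((\<Sum>f\<leftarrow>F. quadp f z1 z2 * quadb f u1 u2) - qf qa qb qc z1 z2 * qf (cnj qa) (cnj qb) (cnj qc) u1 u2)
     + (z1*u1 + z2*u2)\<^sup>2 * (\<Sum>f\<leftarrow>F. linp f z1 z2 * linb f u1 u2) - (z1*u1 + z2*u2)^3 = 0"
    by (rule polarization[of "\<lambda>z1 z2 u1 u2. (\<Sum>f\<leftarrow>F. cubp f z1 z2 * cubb f u1 u2)
     + (z1*u1 + z2*u2) * ((\<Sum>f\<leftarrow>F. quadp f z1 z2 * quadb f u1 u2) - qf qa qb qc z1 z2 * qf (cnj qa) (cnj qb) (cnj qc) u1 u2)
     + (z1*u1 + z2*u2)\<^sup>2 * (\<Sum>f\<leftarrow>F. linp f z1 z2 * linb f u1 u2) - (z1*u1 + z2*u2)^3"],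
        unfold defs, intro polyfun_intros) (use diag in \<open>simp add: defs\<close>)
qed

end

section \<open>The equations for three components\<close>

text \<open>The conditions that the sphere identity imposes on three components. Let \<open>\<Gamma>\<close> be the Gram matrix of the
linear part, with entries \<open>p, w, cnj w, r\<close>; after a unitary change of the target the third component has
no linear part. The quadratic part of the first two components is the linear part applied to
\<open>J = (qf x0 x1 x2, qf y0 y1 y2)\<close>, the third component has quadratic part \<open>m\<close> and cubic part \<open>c\<close>, and the
cubic part of the first two components is already determined by \<open>q\<close> and \<open>\<Gamma>\<close>. With
\<open>\<langle>z,u\<rangle> = z1 u1 + z2 u2\<close>, the identity \<open>I\<close> reads
\<open>q \<langle>z,cnj J\<rangle> + c cnj m + \<langle>z,u\<rangle> \<Gamma>(J,u) = 0\<close> and \<open>II\<close> reads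
\<open>q cnj q \<Gamma>\<inverse> + c cnj c + \<langle>z,u\<rangle> (\<Gamma>(J,J) + m cnj m - q cnj q) + \<langle>z,u\<rangle>\<^sup>2 \<Gamma> - \<langle>z,u\<rangle>\<^sup>3 = 0\<close>.
The point \<open>(0,1)\<close> is a root of \<open>q\<close>.\<close>
locale rank3_system =
  fixes q0 q1 x0 x1 x2 y0 y1 y2 m0 m1 m2 c0 c1 c2 c3 w :: complex and p r :: real
  assumes p: "p > 0" and det: "p * r - (cmod w)\<^sup>2 > 0" and q: "q0 \<noteq> 0 \<or> q1 \<noteq> 0"
  and I: "\<And>(z1::complex) (z2::complex) (u1::complex) (u2::complex). qf q0 q1 0 z1 z2 * (z1 * qf (cnj x0) (cnj x1) (cnj x2) u1 u2 + z2 * qf (cnj y0) (cnj y1) (cnj y2) u1 u2)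
     + cf c0 c1 c2 c3 z1 z2 * qf (cnj m0) (cnj m1) (cnj m2) u1 u2
     + (z1*u1+z2*u2) * (u1 * (p * qf x0 x1 x2 z1 z2 + w * qf y0 y1 y2 z1 z2) + u2 * (cnj w * qf x0 x1 x2 z1 z2 + r * qf y0 y1 y2 z1 z2)) = 0"
  and II: "\<And>(z1::complex) (z2::complex) (u1::complex) (u2::complex). qf q0 q1 0 z1 z2 * qf (cnj q0) (cnj q1) 0 u1 u2 *
        ((complex_of_real r*z1*u1 - w*z2*u1 - cnj w*z1*u2 + complex_of_real p*z2*u2) / complex_of_real (p * r - (cmod w)\<^sup>2))
     + cf c0 c1 c2 c3 z1 z2 * cf (cnj c0) (cnj c1) (cnj c2) (cnj c3) u1 u2
     + (z1*u1+z2*u2) * (qf (cnj x0) (cnj x1) (cnj x2) u1 u2 * (p * qf x0 x1 x2 z1 z2 + w * qf y0 y1 y2 z1 z2)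
         + qf (cnj y0) (cnj y1) (cnj y2) u1 u2 * (cnj w * qf x0 x1 x2 z1 z2 + r * qf y0 y1 y2 z1 z2)
         + qf m0 m1 m2 z1 z2 * qf (cnj m0) (cnj m1) (cnj m2) u1 u2 - qf q0 q1 0 z1 z2 * qf (cnj q0) (cnj q1) 0 u1 u2)
     + (z1*u1+z2*u2)\<^sup>2 * (u1*(p*z1 + w*z2) + u2*(cnj w*z1 + r*z2)) - (z1*u1+z2*u2)^3 = 0"

lemma cubic_zero:
  fixes a b c d :: complex
  assumes "\<And>t. a + b*t + c*t\<^sup>2 + d*t^3 = 0"
  shows "a = 0" "b = 0" "c = 0" "d = 0"
proof -
  show a: "a = 0" using assms[of 0] by simp
  have 1: "b + c + d = 0" "-b + c - d = 0" "2*b+4*c+8*d = 0"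
    using assms[of 1] assms[of "-1"] assms[of 2] a by (simp_all add: algebra_simps)
  have "2 * c = (b + c + d) + (-b + c - d)" by (simp add: algebra_simps)
  also have "\<dots> = 0" unfolding 1 by simp
  finally show c: "c = 0" by simp
  have "b + d = 0" "2 * b + 8 * d = 0" using 1 c by simp_all
  hence "6 * d = 0" by algebra
  thus d: "d = 0" by simp
  show "b = 0" using 1(1) c d by simp
qed

text \<open>Coefficient comparison for polynomials of degree at most three in each of two variables. It is applied to
identities in \<open>z = (1, s)\<close> and \<open>u = (1, t)\<close>.\<close>
lemma bicubic_zero:
  fixes h00 :: complex
  assumes "\<And>s t. (h00+h01*t+h02*t\<^sup>2+h03*t^3) + (h10+h11*t+h12*t\<^sup>2+h13*t^3)* s
     + (h20+h21*t+h22*t\<^sup>2+h23*t^3)* s\<^sup>2 + (h30+h31*t+h32*t\<^sup>2+h33*t^3)* s^3 = 0"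
  shows "h00=0" "h01=0" "h02=0" "h03=0" "h10=0" "h11=0" "h12=0" "h13=0"
    "h20=0" "h21=0" "h22=0" "h23=0" "h30=0" "h31=0" "h32=0" "h33=0"
proof -
  note A = cubic_zero[OF assms]
  show "h00=0" "h01=0" "h02=0" "h03=0" by (rule cubic_zero[OF A(1)])+
  show "h10=0" "h11=0" "h12=0" "h13=0" by (rule cubic_zero[OF A(2)])+
  show "h20=0" "h21=0" "h22=0" "h23=0" by (rule cubic_zero[OF A(3)])+
  show "h30=0" "h31=0" "h32=0" "h33=0" by (rule cubic_zero[OF A(4)])+
qed

section \<open>Quadratic and cubic part with a common root\<close>

lemma three_squares_zero: "(cmod a)\<^sup>2 + (cmod b)\<^sup>2 + (cmod c)\<^sup>2 = 0 \<Longrightarrow> a = 0 \<and> b = 0 \<and> c = 0"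
  by (metis add_nonneg_eq_0_iff add_nonneg_nonneg norm_eq_zero power2_eq_square power_eq_0_iff zero_le_power2)

text \<open>The coefficient equations for a common root at \<open>(0,1)\<close> when \<open>m2 = 0\<close>, in which case \<open>r = 1\<close>, \<open>w = 0\<close> and the
second component of \<open>J\<close> vanishes. The first alternative is the map \<open>z (1 + q)\<close>. In the second one \<open>T\<close> is
the first coordinate of a line on which all components vanish; its value is forced by \<open>1 + x0 T = 1 / p\<close>.\<close>
lemma degenerate_shared_root:
  fixes q0 q1 x0 x1 k0 k1 k2 m0 m1 :: complex and p :: real
  assumes p: "p > 0" and q: "q0 \<noteq> 0 \<or> q1 \<noteq> 0"
   and a0: "q0*cnj x0 + k0*cnj m0 + p*x0=0"
   and a1: "q1*cnj x0 + k1*cnj m0+p*x1=0"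
   and a2: "k2*cnj m0=0"
   and b0: "q0*cnj x1+k0*cnj m1=0"
   and b1: "q1*cnj x1+k1*cnj m1+p*x0=0"
   and b2: "k2*cnj m1+p*x1=0"
   and r00: "(cmod q0)\<^sup>2/p+(cmod k0)\<^sup>2+p*(cmod x0)\<^sup>2-(cmod q0)\<^sup>2+(cmod m0)\<^sup>2=1-p"
   and c10: "q1*cnj q0/p+k1*cnj k0+p*x1*cnj x0 - q1*cnj q0+m1*cnj m0=0"
   and c20: "k2*cnj k0=0"
   and r11: "(cmod q1)\<^sup>2/p+(cmod k1)\<^sup>2+p*(cmod x1)\<^sup>2-(cmod q1)\<^sup>2+p*(cmod x0)\<^sup>2+(cmod m1)\<^sup>2+(cmod m0)\<^sup>2=2*(1-p)"
   and c21: "k2*cnj k1+p*x1*cnj x0+m1*cnj m0=0"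
   and r22: "(cmod k2)\<^sup>2+p*(cmod x1)\<^sup>2+(cmod m1)\<^sup>2=1-p"
  shows "(p=1 \<and> x0=0 \<and> x1=0 \<and> m0=0 \<and> m1=0 \<and> k0=0 \<and> k1=0 \<and> k2=0) \<or>
    (q1=0 \<and> x1=0 \<and> k0=0 \<and> k2=0 \<and> m0=0 \<and> (\<exists>T. q0*T\<^sup>2=-1 \<and> 1+x0*T=1/p \<and> m1+k1*T=0))"
proof -
  have le: "p \<le> 1" using r22 mult_nonneg_nonneg[OF less_imp_le[OF p] zero_le_power2[of "cmod x1"]]
      zero_le_power2[of "cmod k2"] zero_le_power2[of "cmod m1"]
    by linarith
  show ?thesis
  proof (cases "p = 1")
    case True
    have "k2 = 0 \<and> x1 = 0 \<and> m1 = 0"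
      by (rule three_squares_zero) (use r22 True in simp)
    hence 1: "k2 = 0" "x1 = 0" "m1 = 0" by simp_all
    have "k1 = 0 \<and> x0 = 0 \<and> m0 = 0"
      by (rule three_squares_zero) (use r11 True 1 in simp)
    hence 2: "k1 = 0" "x0 = 0" "m0 = 0" by simp_all
    with r00 True have "k0 = 0" by simp
    with 1 2 True show ?thesis by simp
  next
    case False
    with le have n: "p < 1" by simp
    define n where "n = 1 - p"
    have npos: "n > 0" using n by (simp add: n_def)
    have pc: "complex_of_real p \<noteq> 0" using p by simp
    have qdiff: "(cmod z)\<^sup>2/p - (cmod z)\<^sup>2 = (cmod z)\<^sup>2 * n / p" for z :: complex
      using p by (simp add: n_def field_simps)
    have c10z: "q1 * cnj q0 = 0" if "k1 * cnj k0 = 0" "x1 * cnj x0 = 0" "m1 * cnj m0 = 0"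
    proof -
      have "q1*cnj q0/p - q1*cnj q0 = 0" using c10 that by auto
      hence "q1*cnj q0 * (1 - complex_of_real p) = 0" using pc by (simp add: field_simps)
      thus ?thesis using False by (metis eq_iff_diff_eq_0 mult_eq_0_iff of_real_1 of_real_eq_iff)
    qed
    show ?thesis
    proof (cases "x0 = 0 \<and> x1 = 0")
      case True
      hence x: "x0 = 0" "x1 = 0" by auto
      have F: False
      proof (cases "k0 = 0 \<and> k1 = 0 \<and> k2 = 0")
        case True
        hence k: "k0 = 0" "k1 = 0" "k2 = 0" by auto
        have m1: "(cmod m1)\<^sup>2 = n" using r22 k x by (simp add: n_def)
        hence "m1 \<noteq> 0" using npos by auto
        with c21 k x have m0: "m0 = 0" by simp
        from r00 k x m0 have "(cmod q0)\<^sup>2 * n / p = n" using qdiff[of q0] by (simp add: n_def)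
        hence "q0 \<noteq> 0" using npos by auto
        moreover have "q1 * cnj q0 = 0" by (rule c10z) (simp_all add: k x m0)
        ultimately have "q1 = 0" by simp
        with r11 k x m0 m1 npos show False by (simp add: n_def)
      next
        case False
        with a0 a1 a2 b0 b1 b2 x have m: "m0 = 0" "m1 = 0" by auto
        have k2: "(cmod k2)\<^sup>2 = n" using r22 m x by (simp add: n_def)
        hence "k2 \<noteq> 0" using npos by auto
        with c20 c21 x m have k: "k0 = 0" "k1 = 0" by auto
        from r00 k x m have "(cmod q0)\<^sup>2 * n / p = n" using qdiff[of q0] by (simp add: n_def)
        hence "q0 \<noteq> 0" using npos by auto
        moreover have "q1 * cnj q0 = 0" by (rule c10z) (simp_all add: k x m)
        ultimately have "q1 = 0" by simp
        with r11 k x m npos show False by (simp add: n_def)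
      qed
      thus ?thesis ..
    next
      case x: False
      show ?thesis
      proof (cases "k2 = 0")
        case False
        hence m0: "m0 = 0" and k0: "k0 = 0" using a2 c20 by auto
        have x1: "x1 = 0"
        proof (rule ccontr)
          assume "x1 \<noteq> 0"
          with b0 k0 have "q0 = 0" by simp
          with a0 k0 pc have "x0 = 0" by simp
          with a1 m0 pc have "x1 = 0" by simp
          thus False using \<open>x1 \<noteq> 0\<close> by simp
        qed
        with b2 False have "m1 = 0" by simp
        with b1 x1 pc have "x0 = 0" by simp
        with x x1 show ?thesis by simp
      next
        case k2: True
        hence x1: "x1 = 0" using b2 pc by simp
        hence x0: "x0 \<noteq> 0" using x by simp
        have "k1 * cnj m1 = - (p * x0)" using b1 x1 by (simp add: add_eq_0_iff2)
        hence km: "k1 * cnj m1 \<noteq> 0" using x0 pc by simp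
        hence m1: "m1 \<noteq> 0" by auto
        have k0: "k0 = 0" using b0 x1 m1 by simp
        have m0: "m0 = 0" using c21 k2 x1 m1 by simp
        have q1: "q1 = 0" using a1 m0 x1 x0 by simp
        have q0: "q0 * cnj x0 = - (p * x0)" using a0 k0 by (simp add: add_eq_0_iff2)
        have nq0: "cmod q0 = p"
        proof -
          have "cmod q0 * cmod x0 = p * cmod x0"
            using arg_cong[OF q0, of cmod] p by (simp add: norm_mult)
          thus ?thesis using x0 by simp
        qed
        have m1n: "(cmod m1)\<^sup>2 = n" using r22 k2 x1 by (simp add: n_def)
        have x0n: "p * (cmod x0)\<^sup>2 = n\<^sup>2"
          using r00 k0 m0 nq0 p by (simp add: n_def power2_eq_square algebra_simps)
        define T where "T = n / (p * x0)"
        have T1: "p * x0 * T = n" using x0 pc by (simp add: T_def)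
        have "p * x0 * cnj x0 = complex_of_real (p * (cmod x0)\<^sup>2)"
          by (simp add: nsq mult.assoc)
        hence pxx: "p * x0 * cnj x0 = complex_of_real n * complex_of_real n"
          unfolding x0n by (simp add: power2_eq_square)
        have "q0 * T\<^sup>2 * (p * x0 * cnj x0) = - (p * x0 * T) * (p * x0 * T)"
        proof -
          have "q0 * T\<^sup>2 * (p * x0 * cnj x0) = (q0 * cnj x0) * (T\<^sup>2 * (p * x0))" by (simp add: algebra_simps)
          also have "\<dots> = - (p * x0 * T) * (p * x0 * T)" by (simp add: q0 power2_eq_square algebra_simps)
          finally show ?thesis .
        qed
        hence A: "q0 * T\<^sup>2 * (p * x0 * cnj x0) = - (complex_of_real n * n)" by (simp only: T1 mult_minus_left)
        hence "(q0 * T\<^sup>2 + 1) * (p * x0 * cnj x0) = 0"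
          by (simp only: distrib_right A pxx mult_1 add.left_inverse)
        hence 1: "q0 * T\<^sup>2 = -1" using pc x0 by (simp add: eq_neg_iff_add_eq_0)
        have 2: "1 + x0 * T = 1 / p"
        proof -
          have "p * (1 + x0 * T) = p + p * x0 * T" by (simp add: algebra_simps)
          also have "\<dots> = 1" unfolding T1 by (simp add: n_def)
          finally show ?thesis using pc by (simp add: eq_divide_eq mult.commute)
        qed
        have "cnj m1 * (m1 + k1 * T) = m1 * cnj m1 + (k1 * cnj m1) * T" by (simp add: algebra_simps)
        also have "\<dots> = 0" using T1 m1n by (simp add: nsq(1) \<open>k1 * cnj m1 = - (p * x0)\<close>)
        finally have 3: "m1 + k1 * T = 0" using m1 by simp
        show ?thesis using q1 x1 k0 k2 m0 1 2 3 by blast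
      qed
    qed
  qed
qed

text \<open>The coefficient equations for a common root at \<open>(0,1)\<close> when \<open>m2 \<noteq> 0\<close>. Then \<open>m0 = 0\<close>, the cubic part is
\<open>z1 z2 (k1 z1 + k2 z2)\<close>, and the two components of \<open>J\<close> are \<open>z1 (x0 z1 + x1 z2)\<close> and
\<open>z1 (y0 z1 + y1 z2)\<close>.\<close>
locale line_system =
  fixes q0 q1 x0 x1 y0 y1 m1 m2 k1 k2 w :: complex and p r :: real
  assumes p: "p > 0" and det: "p * r - (cmod w)\<^sup>2 > 0" and q: "q0 \<noteq> 0 \<or> q1 \<noteq> 0"
   and m2: "m2 \<noteq> 0"
   and e1: "q0*cnj x0 + (p*x0+w*y0) = 0"
   and e2: "q0*cnj y0 + q1*cnj x0 + (p*x1+w*y1) = 0"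
   and e3: "q0*cnj x1 + (cnj w*x0+r*y0) = 0"
   and e4: "q0*cnj y1 + q1*cnj x1 + k1*cnj m1 + (cnj w*x1+r*y1) + (p*x0+w*y0) = 0"
   and e5: "q1*cnj y1 + k2*cnj m1 + (p*x1+w*y1) = 0"
   and e6: "q1*cnj y0 = 0"
   and e7: "k1*cnj m2 + (cnj w*x0+r*y0) = 0"
   and e8: "k2*cnj m2 + (cnj w*x1+r*y1) = 0"
   and f00: "q0*cnj q0*(r/(p*r-(cmod w)\<^sup>2)) + (cnj x0*(p*x0+w*y0)+cnj y0*(cnj w*x0+r*y0)-q0*cnj q0) = 1-p"
   and f10: "q1*cnj q0*(r/(p*r-(cmod w)\<^sup>2)) + q0*cnj q0*(-w/(p*r-(cmod w)\<^sup>2))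
        + (cnj x0*(p*x1+w*y1)+cnj y0*(cnj w*x1+r*y1)-q1*cnj q0) = -w"
   and f20: "q1*cnj q0*(-w/(p*r-(cmod w)\<^sup>2)) = 0"
   and f11: "q1*cnj q1*(r/(p*r-(cmod w)\<^sup>2)) + q1*cnj q0*(-cnj w/(p*r-(cmod w)\<^sup>2)) + q0*cnj q1*(-w/(p*r-(cmod w)\<^sup>2))
        + q0*cnj q0*(p/(p*r-(cmod w)\<^sup>2)) + k1*cnj k1
        + (cnj x1*(p*x1+w*y1)+cnj y1*(cnj w*x1+r*y1)-q1*cnj q1)
        + (cnj x0*(p*x0+w*y0)+cnj y0*(cnj w*x0+r*y0)-q0*cnj q0) + m1*cnj m1 = (1-r)+2*(1-p)"
   and f21: "q1*cnj q1*(-w/(p*r-(cmod w)\<^sup>2)) + q1*cnj q0*(p/(p*r-(cmod w)\<^sup>2)) + k2*cnj k1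
        + (cnj x0*(p*x1+w*y1)+cnj y0*(cnj w*x1+r*y1)-q1*cnj q0) + m2*cnj m1 = -2*w"
   and f22: "q1*cnj q1*(p/(p*r-(cmod w)\<^sup>2)) + k2*cnj k2
        + (cnj x1*(p*x1+w*y1)+cnj y1*(cnj w*x1+r*y1)-q1*cnj q1) + m2*cnj m2 + m1*cnj m1 = 2*(1-r)+(1-p)"
   and f32: "m2*cnj m1 = -w"
   and f33: "m2*cnj m2 = 1-r"
begin

lemma r: "r > 0"
proof -
  have "p * r > 0" using det zero_le_power2[of "cmod w"] by linarith
  thus ?thesis using p by (simp add: zero_less_mult_iff)
qed

lemma f33r: "(cmod m2)\<^sup>2 = 1 - r"
proof -
  have "complex_of_real ((cmod m2)\<^sup>2) = complex_of_real (1-r)" using f33 by (simp add: nsq)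
  thus ?thesis by (simp only: of_real_eq_iff)
qed

text \<open>If \<open>q\<close> had two different roots, the equation without diagonal terms \<open>f20\<close> would give \<open>q0 = 0\<close> or \<open>w = 0\<close>;
in both cases all unknowns vanish one after the other until \<open>r = 1\<close>, against \<open>m2 \<noteq> 0\<close>.\<close>
lemma q1_zero_contradiction: assumes "q1 \<noteq> 0" shows False
proof -
  have pc: "complex_of_real p \<noteq> 0" "complex_of_real r \<noteq> 0" using p r by simp_all
  have Dc: "complex_of_real p*r - (complex_of_real (cmod w))\<^sup>2 \<noteq> 0"
    using det by (metis less_irrefl of_real_eq_0_iff of_real_diff of_real_mult of_real_power)
  have y0: "y0 = 0" using e6 assms by simp
  have "q0 = 0 \<or> w = 0" using f20 assms Dc by auto
  thus False
  proof
    assume q0: "q0 = 0"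
    have k1: "k1 = 0" using e3 e7 q0 m2 by simp
    have x0: "x0 = 0" using e1 q0 y0 pc by simp
    have g11: "p*x1+w*y1 = 0" using e2 q0 x0 by simp
    have "q1 * cnj x1 + (cnj w*x1+r*y1) = 0" using e4 q0 k1 x0 y0 by simp
    have o: "w = 0" using f10 q0 x0 y0 by simp
    have x1: "x1 = 0" using g11 o pc by simp
    have "r*y1 = 0" using e4 q0 k1 x0 y0 x1 o by simp
    hence y1: "y1 = 0" using pc by simp
    have k2: "k2 = 0" using e8 o x1 y1 m2 by simp
    have m1: "m1 = 0" using f32 o m2 by simp
    have "p = 1" using f00 q0 x0 y0 o by simp
    hence "m2 * cnj m2 = 0" using f11 f33 q0 k1 x0 y0 x1 y1 o m1 pc by simp
    thus False using m2 by simp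
  next
    assume o: "w = 0"
    show False
    proof (cases "q0 = 0")
      case q0: True
      have k1: "k1 = 0" using e3 e7 q0 m2 by simp
      have x0: "x0 = 0" using e1 q0 y0 pc by simp
      have x1: "x1 = 0" using e2 q0 x0 y0 o pc by simp
      have "r*y1 = 0" using e4 q0 k1 x0 y0 x1 o by simp
      hence y1: "y1 = 0" using pc by simp
      have m1: "m1 = 0" using f32 o m2 by simp
      have "p = 1" using f00 q0 x0 y0 o by simp
      hence "m2 * cnj m2 = 0" using f11 f33 q0 k1 x0 y0 x1 y1 o m1 pc by simp
      thus False using m2 by simp
    next
      case q0: False
      have m1: "m1 = 0" using f32 o m2 by simp
      have k1: "k1 = 0" using e7 o y0 m2 by simp
      have x1: "x1 = 0" using e3 o y0 q0 by simp
      have y1: "y1 = 0"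
      proof -
        have "q1 * cnj y1 = 0" using e5 m1 x1 o by simp
        thus ?thesis using assms by simp
      qed
      have x0: "x0 = 0" using e2 y0 x1 o assms by simp
      have k2: "k2 = 0" using e8 o x1 y1 m2 by simp
      have "q1*cnj q0*(r/(p*r)) = q1*cnj q0" using f10 o x0 y0 by simp
      have "q1*cnj q0*(p/(p*r)) - q1*cnj q0 = 0" using f21 o x0 y0 m1 k1 k2 by simp
      hence "r = 1" using q0 assms pc by (simp add: field_simps)
      thus False using f33 m2 by simp
    qed
  qed
qed

end

text \<open>The remaining case \<open>q = q0 z1\<^sup>2\<close>. The linear equations say that the matrix with rows \<open>(x0, x1)\<close> and
\<open>(y0, y1)\<close> is \<open>t\<close> times the identity plus the matrix \<open>cnj k_i m_j / cnj q0\<close> of rank one.\<close>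
locale square_line_system = line_system +
  assumes q1: "q1 = 0"
begin

lemma q0: "q0 \<noteq> 0" using q q1 by simp

lemma eqs:
  "q0*cnj x1 = k1*cnj m2" "q0*cnj y0 = k2*cnj m1" "q0*cnj y1 - q0*cnj x0 = k2*cnj m2 - k1*cnj m1"
  using e3 e7 e2 e5 e4 e8 e1 q1 by algebra+

definition t where "t = x0 - cnj k1 * m1 / cnj q0"

lemma x0: "cnj q0 * x0 = cnj q0 * t + cnj k1 * m1" using q0 by (simp add: t_def field_simps)
lemma x1: "cnj q0 * x1 = cnj k1 * m2" using arg_cong[OF eqs(1), of cnj] by simp
lemma y0: "cnj q0 * y0 = cnj k2 * m1" using arg_cong[OF eqs(2), of cnj] by simp
lemma y1: "cnj q0 * y1 = cnj q0 * t + cnj k2 * m2"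
proof -
  have "cnj q0*y1 - cnj q0* x0 = cnj k2 * m2 - cnj k1 * m1" using arg_cong[OF eqs(3), of cnj] by simp
  thus ?thesis using x0 by algebra
qed
lemma cx0: "q0 * cnj x0 = q0 * cnj t + k1 * cnj m1" using arg_cong[OF x0, of cnj] by simp

lemma g: "p*x0+w*y0 = -(q0 * cnj t + k1 * cnj m1)" "p*x1+w*y1 = -k2*cnj m1"
  "cnj w*x0+r*y0 = -k1*cnj m2" "cnj w*x1+r*y1 = -k2*cnj m2"
  using e1 cx0 e5 e7 e8 q1 by algebra+

definition D where "D = p*r - (cmod w)\<^sup>2"
lemma D: "D > 0" using det by (simp add: D_def)
lemma Dc: "complex_of_real p*r - (complex_of_real (cmod w))\<^sup>2 = D" by (simp add: D_def)
text \<open>Differences of equations in which \<open>J\<close> cancels. They compare the inverse of \<open>\<Gamma>\<close> with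
the matrix \<open>k_i cnj k_j\<close>.\<close>
lemma E10: "q0*cnj q0*(-w/D) = k2 * cnj k1"
  using f10 f21 f32 q1 unfolding D_def[symmetric] by algebra

lemma E11: "q0*cnj q0*(p/D) - q0*cnj q0*(r/D) = k2*cnj k2 - k1*cnj k1"
proof -
  have "q0*cnj q0*(r/D) + (cnj x0*(p*x0+w*y0)+cnj y0*(cnj w*x0+r*y0)-q0*cnj q0) = 1-p"
    using f00 unfolding D_def[symmetric] .
  moreover have "q0*cnj q0*(p/D) + k1*cnj k1 + (cnj x1*(p*x1+w*y1)+cnj y1*(cnj w*x1+r*y1))
        + (cnj x0*(p*x0+w*y0)+cnj y0*(cnj w*x0+r*y0)-q0*cnj q0) + m1*cnj m1 = (1-r)+2*(1-p)"
    using f11 q1 unfolding D_def[symmetric] by simp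
  moreover have "k2*cnj k2 + (cnj x1*(p*x1+w*y1)+cnj y1*(cnj w*x1+r*y1)) + m2*cnj m2 + m1*cnj m1 = 2*(1-r)+(1-p)"
    using f22 q1 by simp
  ultimately show ?thesis using f33 by (simp add: algebra_simps) algebra
qed

lemma m2pos: "(cmod m2)\<^sup>2 > 0" using m2 by simp

text \<open>For \<open>k = 0\<close> the identities give \<open>(cmod q0)\<^sup>2 (1 - r) = - r (1 - r)\<close> with \<open>0 < r < 1\<close>.\<close>
lemma k_nonzero: "k1 \<noteq> 0 \<or> k2 \<noteq> 0"
proof (rule ccontr)
  assume "\<not> ?thesis"
  hence k: "k1 = 0" "k2 = 0" by auto
  have x: "x0 = t" "x1 = 0" "y0 = 0" "y1 = t" using x0 x1 y0 y1 q0 k by simp_all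
  have t: "t = 0" using g(4) x k r by simp
  have w: "w = 0" using E10 k q0 D by simp
  have m1: "m1 = 0" using f32 w m2 by simp
  have pr: "p > 0" "r > 0" "r < 1" using p r f33r m2pos by simp_all
  have 1: "(cmod m2)\<^sup>2 = 2*(1-r)+(1-p)"
  proof -
    have "complex_of_real ((cmod m2)\<^sup>2) = complex_of_real (2*(1-r)+(1-p))"
      using f22 k x t w m1 q1 by (simp add: nsq)
    thus ?thesis by (simp only: of_real_eq_iff)
  qed
  have 2: "(cmod q0)\<^sup>2 / p - (cmod q0)\<^sup>2 = 1 - p"
  proof -
    have "complex_of_real ((cmod q0)\<^sup>2 / p - (cmod q0)\<^sup>2) = complex_of_real (1-p)"
      using f00 k x t w m1 q1 pr by (simp add: nsq)
    thus ?thesis by (simp only: of_real_eq_iff)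
  qed
  have 3: "(cmod q0)\<^sup>2 / r - (cmod q0)\<^sup>2 = (1-r)+2*(1 - p)"
  proof -
    have "complex_of_real ((cmod q0)\<^sup>2 / r - (cmod q0)\<^sup>2) = complex_of_real ((1-r)+2*(1 - p))"
      using f11 k x t w m1 q1 pr by (simp add: nsq)
    thus ?thesis by (simp only: of_real_eq_iff)
  qed
  have "(cmod q0)\<^sup>2 / r - (cmod q0)\<^sup>2 = -(1 - r)" using 1 f33r 3 by simp
  hence "(cmod q0)\<^sup>2 * (1 - r) = - (r * (1 - r))" using pr by (simp add: field_simps)
  moreover have "(cmod q0)\<^sup>2 * (1 - r) \<ge> 0" using pr by simp
  moreover have "r * (1 - r) > 0" using pr by simp
  ultimately show False by linarith
qed

definition B where "B = (cmod k1)\<^sup>2 + (cmod k2)\<^sup>2"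
lemma B: "B > 0" using k_nonzero unfolding B_def by (metis add_nonneg_pos add_pos_nonneg zero_le_power2 zero_less_norm_iff zero_less_power)
lemma Bc: "complex_of_real B = k1*cnj k1 + k2*cnj k2" by (simp add: B_def nsq)

text \<open>With these numbers \<open>\<Gamma>\<inverse>\<close> is a positive multiple of \<open>\<epsilon>\<close> times the identity plus the matrix of rank one
built from \<open>k\<close>, whose nonzero eigenvalue is \<open>B\<close>.\<close>
definition \<mu> where "\<mu> = D / (cmod q0)\<^sup>2"
definition \<epsilon> where "\<epsilon> = (cmod q0)\<^sup>2 * r / D - (cmod k1)\<^sup>2"

lemma mu: "\<mu> > 0" using D q0 by (simp add: \<mu>_def)
lemma muD: "\<mu> * (cmod q0)\<^sup>2 = D" using q0 by (simp add: \<mu>_def)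

lemma r_eq: "r = \<mu> * (\<epsilon> + (cmod k1)\<^sup>2)" using D q0 by (simp add: \<mu>_def \<epsilon>_def)
lemma p_eq: "p = \<mu> * (\<epsilon> + (cmod k2)\<^sup>2)"
proof -
  have "complex_of_real ((cmod q0)\<^sup>2*(p/D) - (cmod q0)\<^sup>2*(r/D)) = complex_of_real ((cmod k2)\<^sup>2 - (cmod k1)\<^sup>2)"
    using E11 by (simp add: nsq)
  hence "(cmod q0)\<^sup>2*(p/D) - (cmod q0)\<^sup>2*(r/D) = (cmod k2)\<^sup>2 - (cmod k1)\<^sup>2"
    by (simp only: of_real_eq_iff)
  hence "\<epsilon> + (cmod k2)\<^sup>2 = (cmod q0)\<^sup>2*(p/D)" by (simp add: \<epsilon>_def)
  thus ?thesis using D q0 by (simp add: \<mu>_def)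
qed
lemma w_eq: "w = - \<mu> * k2 * cnj k1"
proof -
  have "w * (q0 * cnj q0) = - D * (k2 * cnj k1)" unfolding E10[symmetric] using D by simp
  also have "\<dots> = - \<mu> * k2 * cnj k1 * (q0 * cnj q0)"
    unfolding muD[symmetric] by (simp add: nsq(1))
  finally have "w * (q0 * cnj q0) = - \<mu> * k2 * cnj k1 * (q0 * cnj q0)" .
  moreover have "q0 * cnj q0 \<noteq> 0" using q0 by simp
  ultimately show ?thesis using mult_right_cancel by blast
qed
lemma D_eq: "D = \<mu>\<^sup>2 * (\<epsilon> * (\<epsilon> + B))"
proof -
  have "(cmod w)\<^sup>2 = \<mu>\<^sup>2 * ((cmod k1)\<^sup>2 * (cmod k2)\<^sup>2)"
  proof -
    have "cmod w = \<mu> * (cmod k2 * cmod k1)"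
      using arg_cong[OF w_eq, of cmod] mu by (simp add: norm_mult)
    thus ?thesis by algebra
  qed
  moreover have "p * r = \<mu> * (\<epsilon> + (cmod k2)\<^sup>2) * (\<mu> * (\<epsilon> + (cmod k1)\<^sup>2))"
    by (rule arg_cong2[OF p_eq r_eq, of "(*)"])
  ultimately have "D = \<mu> * (\<epsilon> + (cmod k2)\<^sup>2) * (\<mu> * (\<epsilon> + (cmod k1)\<^sup>2)) - \<mu>\<^sup>2 * ((cmod k1)\<^sup>2 * (cmod k2)\<^sup>2)"
    unfolding D_def by (simp only:)
  thus ?thesis unfolding B_def by algebra
qed
text \<open>The eigenvalues of the adjugate of \<open>\<Gamma>\<close> are \<open>\<mu> \<epsilon>\<close> and \<open>\<mu> (\<epsilon> + B)\<close>; their sum and their product are positive.\<close>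
lemma eps: "\<epsilon> > 0"
proof (rule ccontr)
  assume neg: "\<not> \<epsilon> > 0"
  have "p + r = \<mu> * (2 * \<epsilon> + B)"
    using arg_cong2[OF p_eq r_eq, of "(+)"] unfolding B_def by algebra
  hence "\<mu> * (2 * \<epsilon> + B) > 0" using p r by linarith
  hence 1: "2 * \<epsilon> + B > 0" using mu by (rule zero_less_mult_pos)
  have "\<mu>\<^sup>2 * (\<epsilon> * (\<epsilon> + B)) > 0" using D unfolding D_eq .
  hence "\<epsilon> * (\<epsilon> + B) > 0" by (rule zero_less_mult_pos) (use mu in simp)
  hence "\<epsilon> < 0 \<and> \<epsilon> + B < 0" using neg unfolding zero_less_mult_iff by linarith
  thus False using 1 by linarith
qed
lemma q0_eq: "(cmod q0)\<^sup>2 = \<mu> * (\<epsilon> * (\<epsilon> + B))"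
proof -
  have "\<mu> * (cmod q0)\<^sup>2 = \<mu> * (\<mu> * (\<epsilon> * (\<epsilon> + B)))" unfolding muD D_eq by (simp add: power2_eq_square)
  thus ?thesis using mu by simp
qed

end

text \<open>The same situation with \<open>t\<close>, \<open>\<mu>\<close>, \<open>\<epsilon>\<close> and \<open>B\<close> as independent parameters subject to the relations found so
far, so that \<open>p\<close>, \<open>r\<close> and \<open>w\<close> can be eliminated.\<close>
locale square_line_params = line_system q0 q1 x0 x1 y0 y1 m1 m2 k1 k2 w p r
  for q0 q1 x0 x1 y0 y1 m1 m2 k1 k2 w :: complex and p r :: real +
  fixes t :: complex and \<mu> \<epsilon> B :: real
  assumes q1: "q1 = 0"
  and x0: "cnj q0 * x0 = cnj q0 * t + cnj k1 * m1"
  and x1: "cnj q0 * x1 = cnj k1 * m2"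
  and y0: "cnj q0 * y0 = cnj k2 * m1"
  and y1: "cnj q0 * y1 = cnj q0 * t + cnj k2 * m2"
  and g: "p*x0+w*y0 = -(q0 * cnj t + k1 * cnj m1)" "p*x1+w*y1 = -k2*cnj m1"
  "cnj w*x0+r*y0 = -k1*cnj m2" "cnj w*x1+r*y1 = -k2*cnj m2"
  and B_def: "B = (cmod k1)\<^sup>2 + (cmod k2)\<^sup>2" and B: "B > 0" and mu: "\<mu> > 0" and eps: "\<epsilon> > 0"
  and p_eq: "p = \<mu> * (\<epsilon> + (cmod k2)\<^sup>2)" and r_eq: "r = \<mu> * (\<epsilon> + (cmod k1)\<^sup>2)"
  and w_eq: "w = - \<mu> * k2 * cnj k1"
  and q0_eq: "(cmod q0)\<^sup>2 = \<mu> * (\<epsilon> * (\<epsilon> + B))"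
begin

lemma q0: "q0 \<noteq> 0" using q q1 by simp
lemma Bc: "complex_of_real B = k1*cnj k1 + k2*cnj k2" by (simp add: B_def nsq)
lemma pc_eq: "complex_of_real p = \<mu> * (\<epsilon> + k2 * cnj k2)" by (subst p_eq) (simp add: nsq)
lemma rc_eq: "complex_of_real r = \<mu> * (\<epsilon> + k1 * cnj k1)" by (subst r_eq) (simp add: nsq)
lemma wc_eq: "cnj w = - \<mu> * k1 * cnj k2" by (subst w_eq) simp

text \<open>The four entries of the product of \<open>\<Gamma>\<close> with the matrix of \<open>J\<close>, rewritten with the help of the identity
that \<open>cnj k\<close> is an eigenvector of \<open>\<Gamma>\<close> with eigenvalue \<open>\<mu> \<epsilon>\<close>.\<close>
lemma H10: "p * (cnj q0 * t) + \<mu> * \<epsilon> * cnj k1 * m1 + cnj q0 * (q0 * cnj t + k1 * cnj m1) = 0"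
proof -
  have "\<mu> * \<epsilon> * cnj k1 = p * cnj k1 + w * cnj k2" unfolding pc_eq unfolding w_eq unfolding of_real_mult of_real_add of_real_minus by algebra
  hence "p * (cnj q0 * t) + \<mu> * \<epsilon> * cnj k1 * m1 = p * (cnj q0 * x0) + w * (cnj q0 * y0)"
    unfolding x0 y0 by (simp only:) (simp add: algebra_simps)
  also have "\<dots> = cnj q0 * (p * x0 + w * y0)" by (simp add: algebra_simps)
  finally show ?thesis unfolding g(1) by (simp add: algebra_simps)
qed
lemma H11: "w * (cnj q0 * t) + \<mu> * \<epsilon> * cnj k1 * m2 + cnj q0 * (k2 * cnj m1) = 0"
proof -
  have "\<mu> * \<epsilon> * cnj k1 = p * cnj k1 + w * cnj k2" unfolding pc_eq unfolding w_eq unfolding of_real_mult of_real_add of_real_minus by algebra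
  hence "w * (cnj q0 * t) + \<mu> * \<epsilon> * cnj k1 * m2 = p * (cnj q0 * x1) + w * (cnj q0 * y1)"
    unfolding x1 y1 by (simp only:) (simp add: algebra_simps)
  also have "\<dots> = cnj q0 * (p * x1 + w * y1)" by (simp add: algebra_simps)
  finally show ?thesis unfolding g(2) by (simp add: algebra_simps)
qed
lemma H20: "cnj w * (cnj q0 * t) + \<mu> * \<epsilon> * cnj k2 * m1 + cnj q0 * (k1 * cnj m2) = 0"
proof -
  have "\<mu> * \<epsilon> * cnj k2 = cnj w * cnj k1 + r * cnj k2" unfolding rc_eq wc_eq unfolding of_real_mult of_real_add of_real_minus by algebra
  hence "cnj w * (cnj q0 * t) + \<mu> * \<epsilon> * cnj k2 * m1 = cnj w * (cnj q0 * x0) + r * (cnj q0 * y0)"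
    unfolding x0 y0 by (simp only:) (simp add: algebra_simps)
  also have "\<dots> = cnj q0 * (cnj w * x0 + r * y0)" by (simp add: algebra_simps)
  finally show ?thesis unfolding g(3) by (simp add: algebra_simps)
qed
lemma H21: "r * (cnj q0 * t) + \<mu> * \<epsilon> * cnj k2 * m2 + cnj q0 * (k2 * cnj m2) = 0"
proof -
  have "\<mu> * \<epsilon> * cnj k2 = cnj w * cnj k1 + r * cnj k2" unfolding rc_eq wc_eq unfolding of_real_mult of_real_add of_real_minus by algebra
  hence "r * (cnj q0 * t) + \<mu> * \<epsilon> * cnj k2 * m2 = cnj w * (cnj q0 * x1) + r * (cnj q0 * y1)"
    unfolding x1 y1 by (simp only:) (simp add: algebra_simps)
  also have "\<dots> = cnj q0 * (cnj w * x1 + r * y1)" by (simp add: algebra_simps)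
  finally show ?thesis unfolding g(4) by (simp add: algebra_simps)
qed

text \<open>Combinations of the four entries with the vector \<open>k\<close> and a vector orthogonal to it, chosen so that \<open>m\<close> drops
out here and enters only through \<open>m2 k1 - m1 k2\<close> in the next two lemmas.\<close>
lemma T1: "t * (\<mu> * (\<epsilon> + B) * B) = - q0 * cnj t * (k2 * cnj k2)"
proof -
  have "cnj q0 * (t * (\<mu> * (\<epsilon> + B) * B) + q0 * cnj t * (k2 * cnj k2)) =
     cnj k2 * k2 * (p * (cnj q0 * t) + \<mu> * \<epsilon> * cnj k1 * m1 + cnj q0 * (q0 * cnj t + k1 * cnj m1))
   - cnj k2 * k1 * (w * (cnj q0 * t) + \<mu> * \<epsilon> * cnj k1 * m2 + cnj q0 * (k2 * cnj m1))
   - cnj k1 * k2 * (cnj w * (cnj q0 * t) + \<mu> * \<epsilon> * cnj k2 * m1 + cnj q0 * (k1 * cnj m2))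
   + cnj k1 * k1 * (r * (cnj q0 * t) + \<mu> * \<epsilon> * cnj k2 * m2 + cnj q0 * (k2 * cnj m2))"
    unfolding pc_eq rc_eq wc_eq unfolding w_eq unfolding of_real_mult of_real_add of_real_minus unfolding Bc by algebra
  also have "\<dots> = 0" unfolding H10 H11 H20 H21 by simp
  finally show ?thesis using q0 by (simp add: eq_neg_iff_add_eq_0)
qed
lemma T2: "(\<mu> * \<epsilon>) * B * (m2 * k1 - m1 * k2) = cnj q0 * q0 * cnj t * k1 * k2"
proof -
  have "(\<mu> * \<epsilon>) * B * (m2 * k1 - m1 * k2) - cnj q0 * q0 * cnj t * k1 * k2 =
    - k1 * k2 * (p * (cnj q0 * t) + \<mu> * \<epsilon> * cnj k1 * m1 + cnj q0 * (q0 * cnj t + k1 * cnj m1))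
   + k1 * k1 * (w * (cnj q0 * t) + \<mu> * \<epsilon> * cnj k1 * m2 + cnj q0 * (k2 * cnj m1))
   - k2 * k2 * (cnj w * (cnj q0 * t) + \<mu> * \<epsilon> * cnj k2 * m1 + cnj q0 * (k1 * cnj m2))
   + k2 * k1 * (r * (cnj q0 * t) + \<mu> * \<epsilon> * cnj k2 * m2 + cnj q0 * (k2 * cnj m2))"
    unfolding pc_eq rc_eq wc_eq unfolding w_eq unfolding of_real_mult of_real_add of_real_minus unfolding Bc by algebra
  also have "\<dots> = 0" unfolding H10 H11 H20 H21 by simp
  finally show ?thesis by simp
qed
lemma T3: "B * (m2 * k1 - m1 * k2) = cnj q0 * t * k1 * k2"
proof -
  have "cnj q0 * (B * (cnj m2 * cnj k1 - cnj m1 * cnj k2) - q0 * cnj t * cnj k1 * cnj k2) =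
    - cnj k2 * cnj k1 * (p * (cnj q0 * t) + \<mu> * \<epsilon> * cnj k1 * m1 + cnj q0 * (q0 * cnj t + k1 * cnj m1))
   - cnj k2 * cnj k2 * (w * (cnj q0 * t) + \<mu> * \<epsilon> * cnj k1 * m2 + cnj q0 * (k2 * cnj m1))
   + cnj k1 * cnj k1 * (cnj w * (cnj q0 * t) + \<mu> * \<epsilon> * cnj k2 * m1 + cnj q0 * (k1 * cnj m2))
   + cnj k1 * cnj k2 * (r * (cnj q0 * t) + \<mu> * \<epsilon> * cnj k2 * m2 + cnj q0 * (k2 * cnj m2))"
    unfolding pc_eq rc_eq wc_eq unfolding w_eq unfolding of_real_mult of_real_add of_real_minus unfolding Bc by algebra
  also have "\<dots> = 0" unfolding H10 H11 H20 H21 by simp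
  finally have "B * (cnj m2 * cnj k1 - cnj m1 * cnj k2) = q0 * cnj t * cnj k1 * cnj k2" using q0 by simp
  from arg_cong[OF this, of cnj] show ?thesis by simp
qed

text \<open>For \<open>t \<noteq> 0\<close> and \<open>k1 \<noteq> 0\<close> comparing the two expressions for \<open>m2 k1 - m1 k2\<close> gives
\<open>q0 cnj t = \<mu> \<epsilon> t\<close>, and then \<open>T1\<close> equates a positive with a nonpositive multiple of \<open>t\<close>.\<close>
lemma t_k1: assumes "t \<noteq> 0" shows "k1 = 0" "m1 = 0"
proof -
  have gam: "\<mu> * (\<epsilon> + B) * B > 0" "\<mu> * \<epsilon> > 0" using mu eps B by simp_all
  have "complex_of_real (\<mu> * (\<epsilon> + B) * B) \<noteq> 0" using gam(1) by (simp only: of_real_eq_0_iff)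
  hence "t * (\<mu> * (\<epsilon> + B) * B) \<noteq> 0" using assms by simp
  hence k2: "k2 \<noteq> 0" using T1 by auto
  show k1: "k1 = 0"
  proof (rule ccontr)
    assume "k1 \<noteq> 0"
    have "cnj q0 * (k1 * k2) * (q0 * cnj t) = cnj q0 * (k1 * k2) * (\<mu> * \<epsilon> * t)" using T2 T3 unfolding of_real_mult of_real_add of_real_minus by algebra
    hence "q0 * cnj t = \<mu> * \<epsilon> * t" using q0 k2 \<open>k1 \<noteq> 0\<close> by simp
    hence "t * (\<mu> * (\<epsilon> + B) * B) = t * (- (\<mu> * \<epsilon>) * (k2 * cnj k2))" using T1 unfolding of_real_mult of_real_add of_real_minus by algebra
    hence "t * complex_of_real (\<mu> * (\<epsilon> + B) * B) = t * complex_of_real (- (\<mu> * \<epsilon>) * (cmod k2)\<^sup>2)"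
      by (simp only: nsq(1) of_real_mult)
    hence "complex_of_real (\<mu> * (\<epsilon> + B) * B) = complex_of_real (- (\<mu> * \<epsilon>) * (cmod k2)\<^sup>2)"
      using assms mult_left_cancel by blast
    hence "\<mu> * (\<epsilon> + B) * B = - (\<mu> * \<epsilon>) * (cmod k2)\<^sup>2" by (simp only: of_real_eq_iff)
    moreover have "(\<mu> * \<epsilon>) * (cmod k2)\<^sup>2 \<ge> 0" using gam by simp
    ultimately show False using gam by simp
  qed
  show "m1 = 0" using T3 k1 k2 B by simp
qed

end

lemma nsq_left: "cnj z * (a * z) = a * complex_of_real ((cmod z)\<^sup>2)"
  using nsq(2)[of z] by (metis mult.left_commute)

context square_line_params begin

text \<open>The line \<open>z1 = T\<close> lies in the zero set of \<open>1 + q\<close> and of all three components: where \<open>q = -1\<close>, the first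
two components vanish precisely if \<open>z + J(z) = \<Gamma>\<inverse> z\<close>.\<close>
definition vanishes_on :: "complex \<Rightarrow> bool" where
  "vanishes_on = (\<lambda>T::complex. q0*T\<^sup>2 = -1 \<and> (\<forall>v::complex. T + T*(x0*T+x1* v) = (complex_of_real r*T - w* v)/complex_of_real (p*r-(cmod w)\<^sup>2) \<and>
     v + T*(y0*T+y1* v) = (-cnj w*T + complex_of_real p* v)/complex_of_real (p*r-(cmod w)\<^sup>2) \<and> v * (m1*T+m2* v) + T* v * (k1*T+k2* v) = 0))"

lemma r1: "r < 1" using f33r m2 by (metis diff_gt_0_iff_gt zero_less_norm_iff zero_less_power)

text \<open>Here \<open>k1 = m1 = w = 0\<close>, and the diagonal equations give \<open>p = r (2 - r)\<close> and the value of
\<open>cnj t k2 cnj m2\<close>. The line is found from \<open>1 + t T = 1 / p\<close>; the remaining conditions follow by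
multiplying them by \<open>p t cnj t = (1 - p)\<^sup>2\<close>.\<close>
lemma ex_T_nonzero: assumes t: "t \<noteq> 0" shows "\<exists>T. vanishes_on T"
proof -
  note k1 = t_k1(1)[OF t] and m1 = t_k1(2)[OF t]
  have w: "w = 0" using w_eq k1 by simp
  have x: "x0 = t" "x1 = 0" "y0 = 0" using x0 x1 y0 k1 m1 q0 by simp_all
  have gt: "p * t = - q0 * cnj t" using g(1) x k1 w by simp
  have gy: "r * y1 = - k2 * cnj m2" using g(4) x w by simp
  have nq: "cmod q0 = p"
  proof -
    have "p * cmod t = cmod q0 * cmod t" using arg_cong[OF gt, of cmod] p by (simp add: norm_mult)
    thus ?thesis using t by simp
  qed
  have Bk: "B = (cmod k2)\<^sup>2" using B_def k1 by simp
  have pe: "p = \<mu> * (\<epsilon> + B)" and re: "r = \<mu> * \<epsilon>" using p_eq r_eq k1 Bk by simp_all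
  have "p\<^sup>2 = p * \<epsilon>" using q0_eq pe unfolding nq by algebra
  hence eps_p: "\<epsilon> = p" using p by (simp add: power2_eq_square)
  have BB: "r * B = p * (p - r)" using pe re eps_p by algebra
  have tt: "p * (cmod t)\<^sup>2 = (1 - p)\<^sup>2"
  proof -
    have "complex_of_real ((cmod q0)\<^sup>2 * (r / (p * r)) + p * (cmod t)\<^sup>2 - (cmod q0)\<^sup>2) = complex_of_real (1 - p)"
      using f00 x w r by (simp add: nsq nsq_left add_diff_eq)
    hence "(cmod q0)\<^sup>2 * (r / (p * r)) + p * (cmod t)\<^sup>2 - (cmod q0)\<^sup>2 = 1 - p" by (simp only: of_real_eq_iff)
    moreover have "(cmod q0)\<^sup>2 * (r / (p * r)) = p" using nq p r by (simp add: power2_eq_square)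
    ultimately show ?thesis using nq by algebra
  qed
  have ry: "r\<^sup>2 * (cmod y1)\<^sup>2 = B * (1 - r)"
  proof -
    have "r * cmod y1 = cmod k2 * cmod m2" using arg_cong[OF gy, of cmod] r by (simp add: norm_mult)
    thus ?thesis using Bk f33r by algebra
  qed
  have "B + r * (cmod y1)\<^sup>2 + (1 - r) = 2 * (1 - r) + (1 - p)"
  proof -
    have "complex_of_real ((cmod k2)\<^sup>2 + r * (cmod y1)\<^sup>2 + (cmod m2)\<^sup>2) = complex_of_real (2 * (1 - r) + (1 - p))"
      using f22 x w m1 q1 by (simp add: nsq nsq_left)
    hence "(cmod k2)\<^sup>2 + r * (cmod y1)\<^sup>2 + (cmod m2)\<^sup>2 = 2 * (1 - r) + (1 - p)" by (simp only: of_real_eq_iff)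
    thus ?thesis using Bk f33r by simp
  qed
  hence "r * (B + r * (cmod y1)\<^sup>2 + (1 - r)) = r * (2 * (1 - r) + (1 - p))" by simp
  hence "B = r * (2 - r - p)" using ry by algebra
  hence "(p - r * (2 - r)) * (p + r) = 0" using BB by algebra
  hence pr: "p = r * (2 - r)" using p r by simp
  have p1: "1 - p = (1 - r)\<^sup>2" using pr by (simp add: power2_eq_square algebra_simps)
  have r1': "1 - r > 0" using r1 by simp
  define Z where "Z = cnj t * k2 * cnj m2"
  have "cnj q0 * (t * (r * y1)) = cnj q0 * r * t * t + r * t * cnj k2 * m2" using y1 by algebra
  moreover have gtc: "cnj q0 * t = - p * cnj t" using arg_cong[OF gt, of cnj] by simp
  ultimately have Z1: "p * Z = - r * p * (t * cnj t) + r * cnj Z"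
    unfolding gy Z_def by simp algebra
  have Z2: "p * cnj Z = - r * p * (t * cnj t) + r * Z" using arg_cong[OF Z1, of cnj] by (simp add: mult.commute)
  have "(complex_of_real (p + r)) * (Z - cnj Z) = 0" using Z1 Z2 unfolding of_real_add by algebra
  hence "cnj Z = Z" using p r by (metis add_pos_pos eq_iff_diff_eq_0 mult_eq_0_iff of_real_eq_0_iff order_less_irrefl)
  hence "complex_of_real (p - r) * Z = complex_of_real (- r * (p * (cmod t)\<^sup>2))"
    using Z1 unfolding nsq by (simp add: algebra_simps)
  hence Z3: "complex_of_real (p - r) * Z = complex_of_real (- r * (1 - p)\<^sup>2)" unfolding tt .
  have pr': "p - r = r * (1 - r)" using pr by algebra
  have "- r * (1 - p)\<^sup>2 = r * (1 - r) * (- ((1 - r) ^ 3))" unfolding p1 by algebra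
  hence "complex_of_real (r * (1 - r)) * Z = complex_of_real (r * (1 - r)) * complex_of_real (- ((1 - r) ^ 3))"
    using Z3 unfolding pr' of_real_mult[symmetric] by (simp only:)
  moreover have "complex_of_real (r * (1 - r)) \<noteq> 0" using r r1' by simp
  ultimately have Z: "Z = complex_of_real (- ((1 - r) ^ 3))" using mult_left_cancel by blast
  define T where "T = (1 - p) / (p * t)"
  have pc: "complex_of_real p \<noteq> 0" "complex_of_real r \<noteq> 0" "complex_of_real (1 - r) \<noteq> 0" using p r r1' by simp_all
  have tT: "p * (t * T) = 1 - p" using t pc by (simp add: T_def)
  have ttc: "p * (t * cnj t) = complex_of_real ((1 - p)\<^sup>2)" unfolding tt[symmetric] by (simp add: nsq)
  have A: "q0 * T\<^sup>2 * (p * (t * cnj t)) = - complex_of_real ((1 - p)\<^sup>2)"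
  proof -
    have "q0 * T\<^sup>2 * (p * (t * cnj t)) = (q0 * cnj t) * (p * (t * T)) * T" by (simp add: power2_eq_square)
    also have "\<dots> = - (p * (t * T)) * (p * (t * T))" using gt by algebra
    also have "\<dots> = - complex_of_real ((1 - p)\<^sup>2)" unfolding tT by (simp add: power2_eq_square algebra_simps)
    finally show ?thesis .
  qed
  have p1n: "complex_of_real ((1 - p)\<^sup>2) \<noteq> 0" unfolding p1 using pc by simp
  have c1: "q0 * T\<^sup>2 = -1"
    using A p1n unfolding ttc by (metis minus_equation_iff mult_minus1 mult_right_cancel)
  have c2: "1 + t * T = 1 / p"
  proof -
    have "p * (1 + t * T) = 1" using tT by (simp add: algebra_simps)
    thus ?thesis using pc by (simp add: eq_divide_eq mult.commute)
  qed
  have kT: "k2 * cnj m2 * T = - complex_of_real (1 - r)"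
  proof -
    have "(k2 * cnj m2 * T) * (p * (t * cnj t)) = Z * (p * (t * T))" by (simp add: Z_def)
    also have "\<dots> = - complex_of_real (1 - r) * complex_of_real ((1 - p)\<^sup>2)"
      unfolding tT Z p1 of_real_mult[symmetric] of_real_minus[symmetric] of_real_eq_iff by algebra
    finally show ?thesis unfolding ttc using p1n mult_right_cancel by blast
  qed
  have c3: "1 + T * y1 = 1 / r"
  proof -
    have "r * (1 + T * y1) = r + (r * y1) * T" by (simp add: algebra_simps)
    also have "\<dots> = 1" unfolding gy using kT by simp
    finally show ?thesis using pc by (simp add: eq_divide_eq mult.commute)
  qed
  have "cnj m2 * (m2 + k2 * T) = m2 * cnj m2 + k2 * cnj m2 * T" by (simp add: algebra_simps)
  also have "\<dots> = 0" unfolding kT f33 by simp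
  finally have c4: "m2 + k2 * T = 0" using m2 by simp
  have "vanishes_on T" unfolding vanishes_on_def
  proof (intro conjI allI c1)
    fix v :: complex
    have "T + T*(x0*T+x1* v) = T * (1 + t * T)" using x by (simp add: algebra_simps)
    thus "T + T*(x0*T+x1* v) = (r*T - w* v)/(p*r-(cmod w)\<^sup>2)" unfolding c2 using w pc by simp
    have "v + T*(y0*T+y1* v) = v * (1 + T * y1)" using x by (simp add: algebra_simps)
    thus "v + T*(y0*T+y1* v) = (-cnj w*T + p* v)/(p*r-(cmod w)\<^sup>2)" unfolding c3 using w pc by simp
    have "v * (m1*T+m2* v) + T* v * (k1*T+k2* v) = v * v * (m2 + k2 * T)" using m1 k1 by (simp add: algebra_simps)
    thus "v * (m1*T+m2* v) + T* v * (k1*T+k2* v) = 0" unfolding c4 by simp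
  qed
  thus ?thesis ..
qed

lemma D_eq: "p * r - (cmod w)\<^sup>2 = \<mu> * (cmod q0)\<^sup>2"
proof -
  have "cmod w = \<mu> * (cmod k2 * cmod k1)"
    using arg_cong[OF w_eq, of cmod] mu by (simp add: norm_mult)
  moreover have "p * r = \<mu> * (\<epsilon> + (cmod k2)\<^sup>2) * (\<mu> * (\<epsilon> + (cmod k1)\<^sup>2))"
    by (rule arg_cong2[OF p_eq r_eq, of "(*)"])
  ultimately have "p * r - (cmod w)\<^sup>2 = \<mu> * (\<epsilon> + (cmod k2)\<^sup>2) * (\<mu> * (\<epsilon> + (cmod k1)\<^sup>2)) - (\<mu> * (cmod k2 * cmod k1))\<^sup>2"
    by (simp only:)
  thus ?thesis unfolding q0_eq B_def by algebra
qed

text \<open>Here \<open>m = \<eta> k\<close>. The equations reduce to real ones in \<open>|k1|\<^sup>2, |k2|\<^sup>2, h = |\<eta>|\<^sup>2, |q0|, \<mu>, \<epsilon>\<close>, which force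
\<open>\<epsilon> = |q0|\<^sup>2\<close> and \<open>h |q0| = 1\<close>; hence \<open>q0 \<eta>\<^sup>2 = -1\<close>, and the line is \<open>z1 = -\<eta>\<close>, on which \<open>m + c\<close> has the
factor \<open>\<eta> + z1\<close>.\<close>
lemma ex_T_zero: assumes t: "t = 0" shows "\<exists>T. vanishes_on T"
proof -
  have "complex_of_real B \<noteq> 0" using B by simp
  hence mk: "m2 * k1 = m1 * k2" using T3 t by simp
  have k2: "k2 \<noteq> 0"
  proof
    assume "k2 = 0"
    hence "k1 = 0" using mk m2 by simp
    thus False using B B_def \<open>k2 = 0\<close> by simp
  qed
  define \<eta> where "\<eta> = m2 / k2"
  have m2e: "m2 = \<eta> * k2" using k2 by (simp add: \<eta>_def)
  have m1e: "m1 = \<eta> * k1" using mk k2 by (simp add: \<eta>_def field_simps)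
  have eta: "\<eta> \<noteq> 0" using m2e m2 by auto
  define K1 where "K1 = (cmod k1)\<^sup>2"
  define K2 where "K2 = (cmod k2)\<^sup>2"
  define h where "h = (cmod \<eta>)\<^sup>2"
  define nq where "nq = cmod q0"
  have pos: "K1 \<ge> 0" "K2 > 0" "h > 0" "nq > 0" using k2 eta q0 by (simp_all add: K1_def K2_def h_def nq_def)
  have BK: "B = K1 + K2" unfolding B_def K1_def K2_def ..
  have pK: "p = \<mu> * (\<epsilon> + K2)" and rK: "r = \<mu> * (\<epsilon> + K1)" using p_eq r_eq unfolding K1_def K2_def .
  have lsq: "nq\<^sup>2 = \<mu> * (\<epsilon> * (\<epsilon> + B))" unfolding nq_def by (rule q0_eq)
  have gq: "\<mu> * \<epsilon> * \<eta> = - cnj q0 * cnj \<eta>"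
  proof -
    have "(\<mu> * \<epsilon> * \<eta>) * (k2 * cnj k2) = (- cnj q0 * cnj \<eta>) * (k2 * cnj k2)"
      using H21 t unfolding m2e by (simp add: algebra_simps eq_neg_iff_add_eq_0)
    thus ?thesis using k2 mult_right_cancel[of "k2 * cnj k2"] by (metis complex_cnj_zero_iff mult_eq_0_iff)
  qed
  have l: "nq = \<mu> * \<epsilon>"
  proof -
    have "\<mu> * \<epsilon> * cmod \<eta> = nq * cmod \<eta>"
      using arg_cong[OF gq, of cmod] mu eps by (simp add: norm_mult nq_def)
    thus ?thesis using eta by simp
  qed
  have leB: "nq = \<epsilon> + B"
  proof -
    have "nq * nq = nq * (\<epsilon> + B)" using lsq l by algebra
    thus ?thesis using pos by simp
  qed
  have hK2: "h * K2 = 1 - r" using f33r unfolding m2e h_def K2_def norm_mult by algebra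
  have hmu: "h = \<mu>" if "K1 \<noteq> 0"
  proof -
    have k1: "k1 \<noteq> 0" using that K1_def by auto
    have "m2 * cnj m1 = \<mu> * k2 * cnj k1" using f32 w_eq by simp
    hence "(\<eta> * cnj \<eta>) * (k2 * cnj k1) = \<mu> * (k2 * cnj k1)" unfolding m2e m1e by (simp add: algebra_simps)
    hence "\<eta> * cnj \<eta> = \<mu>" using k1 k2 by simp
    thus ?thesis unfolding nsq h_def by (simp only: of_real_eq_iff)
  qed
  have cx: "q0 * cnj x0 = k1 * cnj m1" "q0 * cnj x1 = k1 * cnj m2" "q0 * cnj y0 = k2 * cnj m1" "q0 * cnj y1 = k2 * cnj m2"
    using arg_cong[OF x0, of cnj] arg_cong[OF x1, of cnj] arg_cong[OF y0, of cnj] arg_cong[OF y1, of cnj] t by simp_all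
  have gqc: "\<mu> * \<epsilon> * cnj \<eta> = - q0 * \<eta>" using arg_cong[OF gq, of cnj] by simp
  \<comment> \<open>\<open>q0\<close> times the Gram form of \<open>J\<close> is known; \<open>q0\<close> is removed by \<open>q0 \<eta> = - \<mu> \<epsilon> cnj \<eta>\<close>\<close>
  have J: "cnj x0*(p*x0+w*y0)+cnj y0*(cnj w*x0+r*y0) = h * K1 * B / nq"
     "cnj x0*(p*x1+w*y1)+cnj y0*(cnj w*x1+r*y1) = h * (k2 * cnj k1) * B / nq"
     "cnj x1*(p*x1+w*y1)+cnj y1*(cnj w*x1+r*y1) = h * K2 * B / nq"
  proof -
    have key: "Q = h * S * B / nq" if "q0 * Q = - (cnj \<eta> * cnj \<eta>) * S * B" for Q S :: complex
    proof -
      have "nq * (q0 * Q) = - (\<mu> * \<epsilon> * cnj \<eta>) * cnj \<eta> * S * B" unfolding that l by (simp add: algebra_simps)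
      also have "\<dots> = q0 * (h * S * B)" unfolding gqc h_def nsq(1)[symmetric] by (simp add: algebra_simps)
      finally have "nq * Q = h * S * B" using q0 by simp
      thus ?thesis using pos by (simp add: eq_divide_eq mult.commute)
    qed
    have dist: "q0 * (cnj X * X' + cnj Y * Y') = (q0 * cnj X) * X' + (q0 * cnj Y) * Y'" for X X' Y Y'
      by (simp add: algebra_simps)
    have "q0 * (cnj x0*(p*x0+w*y0)+cnj y0*(cnj w*x0+r*y0)) = - (k1 * cnj m1) * (k1 * cnj m1) - (k2 * cnj m1) * (k1 * cnj m2)"
      unfolding dist g cx t by (simp add: algebra_simps)
    also have "\<dots> = - (cnj \<eta> * cnj \<eta>) * (k1 * cnj k1) * B" unfolding m1e m2e Bc by (simp add: algebra_simps)
    finally show "cnj x0*(p*x0+w*y0)+cnj y0*(cnj w*x0+r*y0) = h * K1 * B / nq"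
      using key unfolding K1_def by (simp only: of_real_mult of_real_divide nsq(1)[symmetric])
    have "q0 * (cnj x0*(p*x1+w*y1)+cnj y0*(cnj w*x1+r*y1)) = - (k1 * cnj m1) * (k2 * cnj m1) - (k2 * cnj m1) * (k2 * cnj m2)"
      unfolding dist g cx t by (simp add: algebra_simps)
    also have "\<dots> = - (cnj \<eta> * cnj \<eta>) * (k2 * cnj k1) * B" unfolding m1e m2e Bc by (simp add: algebra_simps)
    finally show "cnj x0*(p*x1+w*y1)+cnj y0*(cnj w*x1+r*y1) = h * (k2 * cnj k1) * B / nq" by (rule key)
    have "q0 * (cnj x1*(p*x1+w*y1)+cnj y1*(cnj w*x1+r*y1)) = - (k1 * cnj m2) * (k2 * cnj m1) - (k2 * cnj m2) * (k2 * cnj m2)"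
      unfolding dist g cx t by (simp add: algebra_simps)
    also have "\<dots> = - (cnj \<eta> * cnj \<eta>) * (k2 * cnj k2) * B" unfolding m1e m2e Bc by (simp add: algebra_simps)
    finally show "cnj x1*(p*x1+w*y1)+cnj y1*(cnj w*x1+r*y1) = h * K2 * B / nq"
      using key unfolding K2_def by (simp only: of_real_mult of_real_divide nsq(1)[symmetric])
  qed
  have Dq: "nq\<^sup>2 * (r / (p * r - (cmod w)\<^sup>2)) = \<epsilon> + K1"
  proof -
    have "nq\<^sup>2 * (r / (\<mu> * nq\<^sup>2)) = r / \<mu>" using mu pos by simp
    also have "\<dots> = \<epsilon> + K1" using rK mu by simp
    finally show ?thesis unfolding D_eq nq_def .
  qed
  have F1: "\<epsilon> + K1 + h * K1 * B / nq - nq\<^sup>2 = 1 - p"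
  proof -
    have "complex_of_real (nq\<^sup>2 * (r / (p * r - (cmod w)\<^sup>2)) + h * K1 * B / nq - nq\<^sup>2) = complex_of_real (1 - p)"
      using f00 unfolding J nsq nq_def by (simp add: add_diff_eq)
    thus ?thesis unfolding Dq by (simp only: of_real_eq_iff)
  qed
  have F2: "K2 + h * K2 * B / nq + h * K1 = (1 - r) + (1 - p)"
  proof -
    have "(cmod m2)\<^sup>2 + (cmod m1)\<^sup>2 = (1 - r) + h * K1"
      using f33r unfolding m1e h_def K1_def norm_mult by algebra
    moreover have "complex_of_real (K2 + h * K2 * B / nq + ((cmod m2)\<^sup>2 + (cmod m1)\<^sup>2)) = complex_of_real (2 * (1 - r) + (1 - p))"
      using f22 q1 unfolding J nsq K2_def by (simp add: add.assoc)
    hence "K2 + h * K2 * B / nq + ((cmod m2)\<^sup>2 + (cmod m1)\<^sup>2) = 2 * (1 - r) + (1 - p)"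
      by (simp only: of_real_eq_iff)
    ultimately show ?thesis by algebra
  qed
  define c where "c = 1 + h * B / nq - h"
  have F2': "K2 * c + h * K1 = 1 - p" using F2 hK2 unfolding c_def by (simp add: algebra_simps)
  have F1': "K1 * c + h * K1 + \<epsilon> - nq\<^sup>2 = 1 - p" using F1 unfolding c_def by (simp add: algebra_simps)
  have c_eps: "c = 0 \<and> \<epsilon> = nq\<^sup>2"
  proof (cases "K1 = 0")
    case True
    have "\<epsilon> - nq\<^sup>2 = 1 - p" using F1' True by simp
    moreover have "\<epsilon> * p = nq\<^sup>2" using lsq pK BK True by algebra
    ultimately have "(\<epsilon> - 1) * (\<epsilon> - nq\<^sup>2) = 0" by algebra
    moreover have "\<epsilon> \<noteq> 1"
    proof
      assume e: "\<epsilon> = 1"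
      hence "\<mu> = 1 + B" using l leB by simp
      hence "r > 1" using rK True e B by simp
      thus False using r1 by simp
    qed
    ultimately have e: "\<epsilon> = nq\<^sup>2" by simp
    hence "p = 1" using \<open>\<epsilon> - nq\<^sup>2 = 1 - p\<close> by simp
    hence "K2 * c = 0" using F2' True by simp
    thus ?thesis using e pos by simp
  next
    case False
    hence k: "k1 \<noteq> 0" using K1_def by auto
    have w: "w = - h * (k2 * cnj k1)" using w_eq hmu[OF False] by simp
    have "complex_of_real (nq\<^sup>2) * (- w / complex_of_real (p * r - (cmod w)\<^sup>2)) = k2 * cnj k1"
      unfolding D_eq nq_def using w_eq q0 mu by simp
    hence "k2 * cnj k1 + h * (k2 * cnj k1) * B / nq = - w"
      using f10 q1 unfolding J nsq nq_def by simp
    hence "(k2 * cnj k1) * (1 + h * B / nq) = (k2 * cnj k1) * h" unfolding w by (simp add: algebra_simps)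
    hence "complex_of_real (1 + h * B / nq) = complex_of_real h" using k k2 by simp
    hence "1 + h * B / nq = h" by (simp only: of_real_eq_iff)
    hence c: "c = 0" by (simp add: c_def)
    thus ?thesis using F1' F2' by simp
  qed
  hence c0: "1 + h * B / nq = h" and el: "\<epsilon> = nq\<^sup>2" by (simp_all add: c_def)
  have "h * B = h * (1 - nq) * nq" using leB el by algebra
  hence "h * B / nq = h * (1 - nq)" using pos by simp
  hence hl: "h * nq = 1" using c0 by (simp add: algebra_simps)
  define T where "T = - \<eta>"
  have qe: "q0 * \<eta>\<^sup>2 = -1"
  proof -
    have "q0 * \<eta>\<^sup>2 = - (\<mu> * \<epsilon> * cnj \<eta>) * \<eta>" unfolding gqc by (simp add: power2_eq_square)
    also have "\<dots> = - complex_of_real (nq * h)" unfolding l h_def of_real_mult nsq[symmetric] by simp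
    finally show ?thesis using hl by (simp add: mult.commute)
  qed
  have c1: "q0 * T\<^sup>2 = -1" using qe by (simp add: T_def)
  have cq: "T * \<eta> / cnj q0 = 1 / complex_of_real (nq\<^sup>2)"
  proof -
    have "T * \<eta> * q0 = 1" using qe by (simp add: T_def power2_eq_square algebra_simps)
    hence "T * \<eta> = 1 / q0" using q0 by (simp add: eq_divide_eq)
    thus ?thesis unfolding nq_def nsq(1)[symmetric] by simp
  qed
  have mul: "\<mu> \<noteq> 0" "nq \<noteq> 0" using mu pos by simp_all
  have "vanishes_on T" unfolding vanishes_on_def
  proof (intro conjI allI c1)
    fix v :: complex
    define Y where "Y = k1*T + k2 * v"
    have a: "x0*T+x1 * v = cnj k1 * \<eta> * Y / cnj q0" "y0*T+y1 * v = cnj k2 * \<eta> * Y / cnj q0"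
    proof -
      have "cnj q0 * (x0*T+x1 * v) = cnj k1 * \<eta> * Y" "cnj q0 * (y0*T+y1 * v) = cnj k2 * \<eta> * Y"
        using x0 x1 y0 y1 t unfolding m1e m2e Y_def by algebra+
      thus "x0*T+x1 * v = cnj k1 * \<eta> * Y / cnj q0" "y0*T+y1 * v = cnj k2 * \<eta> * Y / cnj q0"
        using q0 by (simp_all add: eq_divide_eq mult.commute)
    qed
    have "T + T*(x0*T+x1 * v) = T + (T * \<eta> / cnj q0) * (cnj k1 * Y)" unfolding a by simp
    also have "\<dots> = (\<epsilon> * T + cnj k1 * Y) / complex_of_real (nq\<^sup>2)" unfolding cq el using mul by (simp add: field_simps)
    also have "\<dots> = (r*T - w * v)/(p*r-(cmod w)\<^sup>2)"
    proof -
      have "r*T - w * v = \<mu> * (\<epsilon> * T + cnj k1 * Y)" unfolding rK w_eq K1_def Y_def complex_norm_square of_real_mult of_real_add by (simp add: complex_norm_square[of k1, simplified] algebra_simps)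
      thus ?thesis unfolding D_eq nq_def using mul by simp
    qed
    finally show "T + T*(x0*T+x1 * v) = (r*T - w * v)/(p*r-(cmod w)\<^sup>2)" .
    have "v + T*(y0*T+y1 * v) = v + (T * \<eta> / cnj q0) * (cnj k2 * Y)" unfolding a by simp
    also have "\<dots> = (\<epsilon> * v + cnj k2 * Y) / complex_of_real (nq\<^sup>2)" unfolding cq el using mul by (simp add: field_simps)
    also have "\<dots> = (-cnj w*T + p * v)/(p*r-(cmod w)\<^sup>2)"
    proof -
      have "-cnj w*T + p * v = \<mu> * (\<epsilon> * v + cnj k2 * Y)" unfolding pK wc_eq K2_def Y_def complex_norm_square of_real_mult of_real_add by (simp add: complex_norm_square[of k2, simplified] algebra_simps)
      thus ?thesis unfolding D_eq nq_def using mul by simp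
    qed
    finally show "v + T*(y0*T+y1 * v) = (-cnj w*T + p * v)/(p*r-(cmod w)\<^sup>2)" .
    show "v * (m1*T+m2 * v) + T * v * (k1*T+k2 * v) = 0" unfolding m1e m2e T_def by (simp add: algebra_simps)
  qed
  thus ?thesis ..
qed

end

lemma (in square_line_system) ex_vanishes: "\<exists>T. q0*T\<^sup>2 = -1 \<and> (\<forall>v::complex. T + T*(x0*T+x1* v) = (complex_of_real r*T - w* v)/complex_of_real (p*r-(cmod w)\<^sup>2) \<and>
     v + T*(y0*T+y1* v) = (-cnj w*T + complex_of_real p* v)/complex_of_real (p*r-(cmod w)\<^sup>2) \<and> v * (m1*T+m2* v) + T* v * (k1*T+k2* v) = 0)"
proof -
  interpret square_line_params q0 q1 x0 x1 y0 y1 m1 m2 k1 k2 w p r t \<mu> \<epsilon> B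
    by unfold_locales (fact q1 x0 x1 y0 y1 g B_def B mu eps p_eq r_eq w_eq q0_eq)+
  show ?thesis using ex_T_zero ex_T_nonzero unfolding vanishes_on_def by blast
qed

text \<open>The root \<open>(0,1)\<close> of \<open>q\<close> is also a root of the cubic part \<open>c\<close>.\<close>
locale shared_root_system = rank3_system q0 q1 x0 x1 x2 y0 y1 y2 m0 m1 m2 c0 c1 c2 c3 w p r
  for q0 q1 x0 x1 x2 y0 y1 y2 m0 m1 m2 c0 c1 c2 c3 w :: complex and p r :: real +
  assumes c3: "c3 = 0"
begin

lemma xy2: "x2 = 0" "y2 = 0"
proof -
  have "u1 * (p*x2+w*y2) + (cnj w*x2+r*y2) = 0" for u1
    using I[of 0 1 u1 1] c3 by (simp add: qf_def cf_def)
  from this[of 1] this[of 0] have 1: "p*x2+w*y2 = 0" "cnj w*x2+r*y2 = 0" by simp_all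
  have "complex_of_real (p * r - (cmod w)\<^sup>2) = p * r - w * cnj w" by (simp add: nsq(1))
  hence "complex_of_real (p * r - (cmod w)\<^sup>2) * x2 = r * (p*x2+w*y2) - w * (cnj w*x2+r*y2)"
     "complex_of_real (p * r - (cmod w)\<^sup>2) * y2 = p * (cnj w*x2+r*y2) - cnj w * (p*x2+w*y2)"
    by (simp_all add: algebra_simps)
  moreover have "complex_of_real (p * r - (cmod w)\<^sup>2) \<noteq> 0" using det by (simp only: of_real_eq_0_iff)
  ultimately show "x2 = 0" "y2 = 0" unfolding 1 by simp_all
qed

lemma I_coeffs:
  "q0*cnj x0 + c0*cnj m0 + (p*x0+w*y0) = 0"
  "q0*cnj y0 + q1*cnj x0 + c1*cnj m0 + (p*x1+w*y1) = 0"
  "q1*cnj y0 + c2*cnj m0 = 0"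
  "q0*cnj x1 + c0*cnj m1 + (cnj w*x0+r*y0) = 0"
  "q0*cnj y1 + q1*cnj x1 + c1*cnj m1 + (cnj w*x1+r*y1) + (p*x0+w*y0) = 0"
  "q1*cnj y1 + c2*cnj m1 + (p*x1+w*y1) = 0"
  "c0*cnj m2 = 0"
  "c1*cnj m2 + (cnj w*x0+r*y0) = 0"
  "c2*cnj m2 + (cnj w*x1+r*y1) = 0"
proof -
  have "((q0*cnj x0 + c0*cnj m0 + (p*x0+w*y0)) + (q0*cnj x1 + c0*cnj m1 + (cnj w*x0+r*y0))*t + (c0*cnj m2)*t\<^sup>2 + 0*t^3)
    + ((q0*cnj y0 + q1*cnj x0 + c1*cnj m0 + (p*x1+w*y1)) + (q0*cnj y1 + q1*cnj x1 + c1*cnj m1 + (cnj w*x1+r*y1) + (p*x0+w*y0))*t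
        + (c1*cnj m2 + (cnj w*x0+r*y0))*t\<^sup>2 + 0*t^3) * s
    + ((q1*cnj y0 + c2*cnj m0) + (q1*cnj y1 + c2*cnj m1 + (p*x1+w*y1))*t + (c2*cnj m2 + (cnj w*x1+r*y1))*t\<^sup>2 + 0*t^3) * s\<^sup>2
    + (0 + 0*t+0*t\<^sup>2+0*t^3)* s^3 = 0" for s t
    by (rule trans[OF _ I[of 1 s 1 t]]) (simp only: power_one mult_1_left mult_1_right mult_zero_left add_0_right add_0_left qf_def cf_def xy2 c3 complex_cnj_zero, algebra)
  note C = bicubic_zero[OF this]
  show "q0*cnj x0 + c0*cnj m0 + (p*x0+w*y0) = 0"
  "q0*cnj y0 + q1*cnj x0 + c1*cnj m0 + (p*x1+w*y1) = 0"
  "q1*cnj y0 + c2*cnj m0 = 0"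
  "q0*cnj x1 + c0*cnj m1 + (cnj w*x0+r*y0) = 0"
  "q0*cnj y1 + q1*cnj x1 + c1*cnj m1 + (cnj w*x1+r*y1) + (p*x0+w*y0) = 0"
  "q1*cnj y1 + c2*cnj m1 + (p*x1+w*y1) = 0"
  "c0*cnj m2 = 0"
  "c1*cnj m2 + (cnj w*x0+r*y0) = 0"
  "c2*cnj m2 + (cnj w*x1+r*y1) = 0" by (fact C)+
qed

lemma II_coeffs:
  fixes D Th00 Th10 Th11 :: complex
  defines "D \<equiv> complex_of_real (p*r-(cmod w)\<^sup>2)"
  defines "Th00 \<equiv> cnj x0*(p*x0+w*y0)+cnj y0*(cnj w*x0+r*y0)-q0*cnj q0"
    and "Th10 \<equiv> cnj x0*(p*x1+w*y1)+cnj y0*(cnj w*x1+r*y1)-q1*cnj q0"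
    and "Th11 \<equiv> cnj x1*(p*x1+w*y1)+cnj y1*(cnj w*x1+r*y1)-q1*cnj q1"
  shows "q0*cnj q0*(r/D) + c0*cnj c0 + Th00 + m0*cnj m0 = 1-p"
   "q1*cnj q0*(r/D) + q0*cnj q0*(-w/D) + c1*cnj c0 + Th10 + m1*cnj m0 = -w"
   "q1*cnj q0*(-w/D) + c2*cnj c0 + m2*cnj m0 = 0"
   "q1*cnj q1*(r/D) + q1*cnj q0*(-cnj w/D) + q0*cnj q1*(-w/D) + q0*cnj q0*(p/D) + c1*cnj c1
        + Th11 + Th00 + m1*cnj m1 + m0*cnj m0 = (1-r)+2*(1-p)"
   "q1*cnj q1*(-w/D) + q1*cnj q0*(p/D) + c2*cnj c1 + Th10 + m2*cnj m1 + m1*cnj m0 = -2*w"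
   "m2*cnj m0 = 0"
   "q1*cnj q1*(p/D) + c2*cnj c2 + Th11 + m2*cnj m2 + m1*cnj m1 = 2*(1-r)+(1-p)"
   "m2*cnj m1 = -w"
   "m2*cnj m2 = 1-r"
proof -
  define g11 where "g11 = r/D"
  define g10 where "g10 = -w/D"
  define g01 where "g01 = -cnj w/D"
  define g22 where "g22 = p/D"
  have g: "(complex_of_real r*z1*u1 - w*z2*u1 - cnj w*z1*u2 + complex_of_real p*z2*u2) / D = g11*z1*u1+g10*z2*u1+g01*z1*u2+g22*z2*u2" for z1 z2 u1 u2 :: complex
    by (simp add: g11_def g10_def g01_def g22_def add_divide_distrib diff_divide_distrib)
  define Th01 where "Th01 = cnj x1*(p*x0+w*y0)+cnj y1*(cnj w*x0+r*y0)-q0*cnj q1"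
  have "((q0*cnj q0*g11 + c0*cnj c0 + Th00 + m0*cnj m0 - (1-p))
      + (q0*cnj q1*g11 + q0*cnj q0*g01 + c0*cnj c1 + Th01 + m0*cnj m1 + cnj w) * t
      + (q0*cnj q1*g01 + c0*cnj c2 + m0*cnj m2)*t\<^sup>2 + 0*t^3)
    + ((q1*cnj q0*g11 + q0*cnj q0*g10 + c1*cnj c0 + Th10 + m1*cnj m0 + w)
      + (q1*cnj q1*g11 + q1*cnj q0*g01 + q0*cnj q1*g10 + q0*cnj q0*g22 + c1*cnj c1
        + Th11 + Th00 + m1*cnj m1 + m0*cnj m0 - ((1-r)+2*(1-p))) * t
      + (q1*cnj q1*g01 + q0*cnj q1*g22 + c1*cnj c2 + Th01 + m1*cnj m2 + m0*cnj m1 + 2*cnj w) * t\<^sup>2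
      + (m0*cnj m2)*t^3)* s
    + ((q1*cnj q0*g10 + c2*cnj c0 + m2*cnj m0)
      + (q1*cnj q1*g10 + q1*cnj q0*g22 + c2*cnj c1 + Th10 + m2*cnj m1 + m1*cnj m0 + 2*w)*t
      + (q1*cnj q1*g22 + c2*cnj c2 + Th11 + m2*cnj m2 + m1*cnj m1 - (2*(1-r)+(1-p)))*t\<^sup>2
      + (m1*cnj m2 + cnj w)*t^3)* s\<^sup>2
    + (0 + (m2*cnj m0)*t + (m2*cnj m1 + w)*t\<^sup>2 + (m2*cnj m2 - (1-r))*t^3)* s^3 = 0" for s t
    by (rule trans[OF _ II[of 1 s 1 t, folded D_def, unfolded g]])
       (simp only: power_one mult_1_left mult_1_right mult_zero_left add_0_right add_0_left qf_def cf_def xy2 c3 complex_cnj_zero Th00_def Th01_def Th10_def Th11_def of_real_diff of_real_1 of_real_add of_real_mult of_real_numeral, algebra)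
  note C = bicubic_zero[OF this, unfolded g11_def g10_def g01_def g22_def]
  show "q0*cnj q0*(r/D) + c0*cnj c0 + Th00 + m0*cnj m0 = 1-p" using C(1) by simp
  show "q1*cnj q0*(r/D) + q0*cnj q0*(-w/D) + c1*cnj c0 + Th10 + m1*cnj m0 = -w" using C(5) by (simp add: eq_neg_iff_add_eq_0)
  show "q1*cnj q0*(-w/D) + c2*cnj c0 + m2*cnj m0 = 0" using C(9) .
  show "q1*cnj q1*(r/D) + q1*cnj q0*(-cnj w/D) + q0*cnj q1*(-w/D) + q0*cnj q0*(p/D) + c1*cnj c1
        + Th11 + Th00 + m1*cnj m1 + m0*cnj m0 = (1-r)+2*(1-p)" using C(6) by (simp only: right_minus_eq)
  show "q1*cnj q1*(-w/D) + q1*cnj q0*(p/D) + c2*cnj c1 + Th10 + m2*cnj m1 + m1*cnj m0 = -2*w" using C(10) by (simp add: eq_neg_iff_add_eq_0)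
  show "m2*cnj m0 = 0" using C(14) .
  show "q1*cnj q1*(p/D) + c2*cnj c2 + Th11 + m2*cnj m2 + m1*cnj m1 = 2*(1-r)+(1-p)" using C(11) by (simp only: right_minus_eq)
  show "m2*cnj m1 = -w" using C(15) by (simp add: eq_neg_iff_add_eq_0)
  show "m2*cnj m2 = 1-r" using C(16) by (simp only: right_minus_eq)
qed

text \<open>The first alternative describes the map \<open>z (1 + q)\<close> up to a unitary matrix. In the second one all
components vanish on the line \<open>z1 = T\<close>, where \<open>q = -1\<close>. The case distinction is by \<open>m2\<close>, since
\<open>(cmod m2)\<^sup>2 = 1 - r\<close>.\<close>
lemma common_factor:
  "(p = 1 \<and> r = 1 \<and> w = 0 \<and> x0 = 0 \<and> x1 = 0 \<and> y0 = 0 \<and> y1 = 0 \<and> m0 = 0 \<and> m1 = 0 \<and> m2 = 0 \<and> c0 = 0 \<and> c1 = 0 \<and> c2 = 0) \<or>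
   (q1 = 0 \<and> (\<exists>T. q0 * T\<^sup>2 = -1 \<and> (\<forall>v::complex.
      T + qf x0 x1 x2 T v = (complex_of_real r*T - w* v) / complex_of_real (p*r-(cmod w)\<^sup>2) \<and>
      v + qf y0 y1 y2 T v = (-cnj w*T + complex_of_real p* v) / complex_of_real (p*r-(cmod w)\<^sup>2) \<and>
      qf m0 m1 m2 T v + cf c0 c1 c2 c3 T v = 0)))"
proof (cases "m2 = 0")
  case False
  have m0: "m0 = 0" using II_coeffs(6) False by simp
  have c0: "c0 = 0" using I_coeffs(7) False by simp
  have ls: "line_system q0 q1 x0 x1 y0 y1 m1 m2 c1 c2 w p r"
    unfolding line_system_def of_real_divide
    using p det q False I_coeffs[unfolded m0 c0 complex_cnj_zero mult_zero_left mult_zero_right add_0_right add_0_left]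
      II_coeffs[unfolded m0 c0 complex_cnj_zero mult_zero_left mult_zero_right add_0_right add_0_left]
    by (intro conjI) assumption+
  show ?thesis
  proof (cases "q1 = 0")
    case True
    interpret line_system q0 q1 x0 x1 y0 y1 m1 m2 c1 c2 w p r by (rule ls)
    interpret square_line_system q0 q1 x0 x1 y0 y1 m1 m2 c1 c2 w p r
      by unfold_locales (rule True)
    obtain T where T: "q0*T\<^sup>2 = -1" and V: "\<And>v::complex. T + T*(x0*T+x1* v) = (complex_of_real r*T - w* v)/complex_of_real (p*r-(cmod w)\<^sup>2) \<and>
     v + T*(y0*T+y1* v) = (-cnj w*T + complex_of_real p* v)/complex_of_real (p*r-(cmod w)\<^sup>2) \<and> v * (m1*T+m2* v) + T* v * (c1*T+c2* v) = 0"
      using ex_vanishes by blast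
    have "T + qf x0 x1 x2 T v = T + T*(x0*T+x1* v)" "v + qf y0 y1 y2 T v = v + T*(y0*T+y1* v)"
      "qf m0 m1 m2 T v + cf c0 c1 c2 c3 T v = v * (m1*T+m2* v) + T* v * (c1*T+c2* v)" for v
      by (simp_all add: qf_def cf_def xy2 m0 c0 c3 power2_eq_square algebra_simps)
    with V T True show ?thesis by (intro disjI2) auto
  next
    case False
    with ls show ?thesis by (metis line_system.q1_zero_contradiction)
  qed
next
  case True
  have r: "r = 1"
  proof -
    have "complex_of_real r = complex_of_real 1" using II_coeffs(9) True by simp
    thus ?thesis by (simp only: of_real_eq_iff)
  qed
  have w: "w = 0" using II_coeffs(8) True by simp
  have pc: "complex_of_real p \<noteq> 0" using p by simp
  have y: "y0 = 0" "y1 = 0" using I_coeffs(8,9) True w r by simp_all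
  have sa: "(p=1 \<and> x0=0 \<and> x1=0 \<and> m0=0 \<and> m1=0 \<and> c0=0 \<and> c1=0 \<and> c2=0) \<or>
    (q1=0 \<and> x1=0 \<and> c0=0 \<and> c2=0 \<and> m0=0 \<and> (\<exists>T. q0*T\<^sup>2=-1 \<and> 1+x0*T=1/p \<and> m1+c1*T=0))"
  proof (rule degenerate_shared_root[OF p q])
    show "q0*cnj x0 + c0*cnj m0 + p*x0=0" using I_coeffs(1) w by simp
    show "q1*cnj x0 + c1*cnj m0+p*x1=0" using I_coeffs(2) w y by simp
    show "c2*cnj m0=0" using I_coeffs(3) y by simp
    show "q0*cnj x1+c0*cnj m1=0" using I_coeffs(4) w y by simp
    show "q1*cnj x1+c1*cnj m1+p*x0=0" using I_coeffs(5) w y by simp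
    show "c2*cnj m1+p*x1=0" using I_coeffs(6) w y by simp
    have "complex_of_real ((cmod q0)\<^sup>2/p+(cmod c0)\<^sup>2+p*(cmod x0)\<^sup>2-(cmod q0)\<^sup>2+(cmod m0)\<^sup>2) = complex_of_real (1-p)"
      using II_coeffs(1) w y r pc by (simp add: nsq nsq_left add_diff_eq)
    thus "(cmod q0)\<^sup>2/p+(cmod c0)\<^sup>2+p*(cmod x0)\<^sup>2-(cmod q0)\<^sup>2+(cmod m0)\<^sup>2=1-p" by (simp only: of_real_eq_iff)
    show "q1*cnj q0/p+c1*cnj c0+p*x1*cnj x0 - q1*cnj q0+m1*cnj m0=0"
      using II_coeffs(2) w y r pc by (simp add: algebra_simps)
    show "c2*cnj c0=0" using II_coeffs(3) w True by simp
    have "complex_of_real ((cmod q1)\<^sup>2/p+(cmod q0)\<^sup>2+(cmod c1)\<^sup>2+p*(cmod x1)\<^sup>2-(cmod q1)\<^sup>2+p*(cmod x0)\<^sup>2-(cmod q0)\<^sup>2+(cmod m1)\<^sup>2+(cmod m0)\<^sup>2) = complex_of_real (2*(1-p))"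
      using II_coeffs(4) w y r pc by (simp add: nsq nsq_left diff_eq_eq eq_diff_eq add_ac) (simp add: algebra_simps)
    hence "(cmod q1)\<^sup>2/p+(cmod q0)\<^sup>2+(cmod c1)\<^sup>2+p*(cmod x1)\<^sup>2-(cmod q1)\<^sup>2+p*(cmod x0)\<^sup>2-(cmod q0)\<^sup>2+(cmod m1)\<^sup>2+(cmod m0)\<^sup>2 = 2*(1-p)" by (simp only: of_real_eq_iff)
    thus "(cmod q1)\<^sup>2/p+(cmod c1)\<^sup>2+p*(cmod x1)\<^sup>2-(cmod q1)\<^sup>2+p*(cmod x0)\<^sup>2+(cmod m1)\<^sup>2+(cmod m0)\<^sup>2=2*(1-p)" by linarith
    show "c2*cnj c1+p*x1*cnj x0+m1*cnj m0=0"
      using II_coeffs(5) w y r pc True by (simp add: algebra_simps)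
    have "complex_of_real ((cmod c2)\<^sup>2+p*(cmod x1)\<^sup>2+(cmod m1)\<^sup>2) = complex_of_real (1-p)"
      using II_coeffs(7) w y r pc True by (simp add: nsq nsq_left diff_eq_eq eq_diff_eq add_ac)
    thus "(cmod c2)\<^sup>2+p*(cmod x1)\<^sup>2+(cmod m1)\<^sup>2=1-p" by (simp only: of_real_eq_iff)
  qed
  thus ?thesis
  proof
    assume "p=1 \<and> x0=0 \<and> x1=0 \<and> m0=0 \<and> m1=0 \<and> c0=0 \<and> c1=0 \<and> c2=0"
    thus ?thesis using True r w y by simp
  next
    assume A: "q1=0 \<and> x1=0 \<and> c0=0 \<and> c2=0 \<and> m0=0 \<and> (\<exists>T. q0*T\<^sup>2=-1 \<and> 1+x0*T=1/p \<and> m1+c1*T=0)"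
    then obtain T where T: "q0*T\<^sup>2=-1" "1+x0*T=1/p" "m1+c1*T=0" by blast
    have "T + qf x0 x1 x2 T v = T * (1+x0*T)" "v + qf y0 y1 y2 T v = v"
      "qf m0 m1 m2 T v + cf c0 c1 c2 c3 T v = T * v * (m1+c1*T)" for v
      using A by (simp_all add: qf_def cf_def xy2 c3 y True power2_eq_square algebra_simps)
    hence "T + qf x0 x1 x2 T v = (complex_of_real r*T - w* v) / complex_of_real (p*r-(cmod w)\<^sup>2) \<and>
      v + qf y0 y1 y2 T v = (-cnj w*T + complex_of_real p* v) / complex_of_real (p*r-(cmod w)\<^sup>2) \<and>
      qf m0 m1 m2 T v + cf c0 c1 c2 c3 T v = 0" for v using T pc by (simp add: r w)
    thus ?thesis using T(1) A by blast
  qed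
qed

end

section \<open>Quadratic and cubic part without a common root\<close>

text \<open>Used to divide an identity of polynomial functions by a variable.\<close>
lemma isCont_zero_limit:
  fixes f :: "complex \<Rightarrow> complex"
  assumes "\<And>s. s \<noteq> 0 \<Longrightarrow> f s = 0" "isCont f 0" shows "f 0 = 0"
proof -
  have "f \<midarrow>0\<rightarrow> f 0" using assms(2) by (simp add: isCont_def)
  moreover have "f \<midarrow>0\<rightarrow> 0"
    by (rule tendsto_eventually) (simp add: eventually_at_filter assms(1))
  ultimately show ?thesis by (rule LIM_unique)
qed

text \<open>A form without common factor with \<open>q\<close> may be cancelled: if \<open>q\<close> divides \<open>c\<close> times a cubic form, then it
divides that cubic form. If \<open>q1 \<noteq> 0\<close>, the two roots of \<open>q\<close> are tested; if \<open>q1 = 0\<close>, the root is double and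
one factor \<open>z1\<close> is divided out first.\<close>
lemma cubic_divisible:
  assumes q: "q0 \<noteq> 0 \<or> q1 \<noteq> 0"
    and nr: "\<And>z1 z2. qf q0 q1 0 z1 z2 = 0 \<Longrightarrow> cf c0 c1 c2 c3 z1 z2 = 0 \<Longrightarrow> z1 = 0 \<and> z2 = 0"
    and eq: "\<And>z1 z2. qf q0 q1 0 z1 z2 * F z1 z2 + cf c0 c1 c2 c3 z1 z2 * cf Y0 Y1 Y2 Y3 z1 z2 = 0"
    and cont: "isCont (\<lambda>s. F s 1) 0"
  obtains l1 l2 where "Y0 = q0 * l1" "Y1 = q0 * l2 + q1 * l1" "Y2 = q1 * l2" "Y3 = 0"
proof -
  have c3: "c3 \<noteq> 0" using nr[of 0 1] by (auto simp: qf_def cf_def)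
  have Y3: "Y3 = 0" using eq[of 0 1] c3 by (simp add: qf_def cf_def)
  show ?thesis
  proof (cases "q1 = 0")
    case True
    hence q0: "q0 \<noteq> 0" using q by simp
    have "(\<lambda>s. s * q0 * F s 1 + cf c0 c1 c2 c3 s 1 * (Y2 + Y1 * s + Y0 * s\<^sup>2)) 0 = 0"
    proof (rule isCont_zero_limit)
      fix s :: complex assume s: "s \<noteq> 0"
      have "s * (s * q0 * F s 1 + cf c0 c1 c2 c3 s 1 * (Y2 + Y1 * s + Y0 * s\<^sup>2)) = 0"
        by (rule trans[OF _ eq[of s 1]]) (simp add: qf_def cf_def True Y3 power2_eq_square power3_eq_cube algebra_simps)
      thus "s * q0 * F s 1 + cf c0 c1 c2 c3 s 1 * (Y2 + Y1 * s + Y0 * s\<^sup>2) = 0" using s by simp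
    next
      show "isCont (\<lambda>s. s * q0 * F s 1 + cf c0 c1 c2 c3 s 1 * (Y2 + Y1 * s + Y0 * s\<^sup>2)) 0"
        unfolding cf_def by (intro continuous_intros cont)
    qed
    hence "Y2 = 0" using c3 by (simp add: cf_def)
    thus ?thesis using that[of "Y0 / q0" "Y1 / q0"] q0 True Y3 by simp
  next
    case False
    have "cf c0 c1 c2 c3 q1 (-q0) \<noteq> 0" using nr[of q1 "-q0"] False by (auto simp: qf_def power2_eq_square)
    moreover have "qf q0 q1 0 q1 (-q0) = 0" by (simp add: qf_def power2_eq_square)
    ultimately have "cf Y0 Y1 Y2 Y3 q1 (-q0) = 0" using eq[of q1 "-q0"] by simp
    hence "q1 * (Y0 * q1\<^sup>2 - Y1 * q1 * q0 + Y2 * q0\<^sup>2) = 0"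
      by (simp add: cf_def Y3 power2_eq_square power3_eq_cube algebra_simps)
    hence "Y0 * q1\<^sup>2 - Y1 * q1 * q0 + Y2 * q0\<^sup>2 = 0" using False by (simp only: mult_eq_0_iff simp_thms)
    hence E: "Y0 * q1\<^sup>2 = Y1 * q1 * q0 - Y2 * q0\<^sup>2" by algebra
    define l2 where "l2 = Y2 / q1"
    define l1 where "l1 = (Y1 - q0 * l2) / q1"
    have 1: "Y2 = q1 * l2" "Y1 = q0 * l2 + q1 * l1" using False by (simp_all add: l1_def l2_def)
    have "Y0 * q1\<^sup>2 = (q0 * l1) * q1\<^sup>2" unfolding E 1 by (simp add: power2_eq_square algebra_simps)
    hence "Y0 = q0 * l1" using False by simp
    thus ?thesis using that 1 Y3 by blast
  qed
qed

text \<open>Multiplying by \<open>z2\<close> reduces the claim to cubic forms.\<close>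
lemma quadratic_divisible:
  assumes q: "q0 \<noteq> 0 \<or> q1 \<noteq> 0"
    and nr: "\<And>z1 z2. qf q0 q1 0 z1 z2 = 0 \<Longrightarrow> cf c0 c1 c2 c3 z1 z2 = 0 \<Longrightarrow> z1 = 0 \<and> z2 = 0"
    and eq: "\<And>z1 z2. qf q0 q1 0 z1 z2 * F z1 z2 + cf c0 c1 c2 c3 z1 z2 * qf Y0 Y1 Y2 z1 z2 = 0"
    and cont: "isCont (\<lambda>s. F s 1) 0"
  obtains l where "Y0 = q0 * l" "Y1 = q1 * l" "Y2 = 0"
proof -
  have "qf q0 q1 0 z1 z2 * (z2 * F z1 z2) + cf c0 c1 c2 c3 z1 z2 * cf 0 Y0 Y1 Y2 z1 z2
      = z2 * (qf q0 q1 0 z1 z2 * F z1 z2 + cf c0 c1 c2 c3 z1 z2 * qf Y0 Y1 Y2 z1 z2)" for z1 z2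
    by (simp add: qf_def cf_def[of 0] power2_eq_square power3_eq_cube algebra_simps)
  hence "qf q0 q1 0 z1 z2 * (z2 * F z1 z2) + cf c0 c1 c2 c3 z1 z2 * cf 0 Y0 Y1 Y2 z1 z2 = 0" for z1 z2
    unfolding eq by simp
  from cubic_divisible[OF q nr this] cont obtain l1 l2 where l: "0 = q0 * l1" "Y0 = q0 * l2 + q1 * l1" "Y1 = q1 * l2" "Y2 = 0"
    by auto
  show ?thesis
  proof (cases "l1 = 0")
    case True
    thus ?thesis using l that[of l2] by simp
  next
    case False
    \<comment> \<open>then \<open>q\<close> is a multiple of \<open>z1 z2\<close>, and its root \<open>(1,0)\<close> is excluded as a root of the cubic form\<close>
    hence q0: "q0 = 0" using l by simp
    have "cf c0 c1 c2 c3 1 0 \<noteq> 0" using nr[of 1 0] q0 by (auto simp: qf_def)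
    hence "qf Y0 Y1 Y2 1 0 = 0" using eq[of 1 0] q0 by (simp add: qf_def)
    thus ?thesis using that[of l2] l q0 by (simp add: qf_def)
  qed
qed

lemma cubic_cancel:
  fixes q0 q1 :: complex
  assumes q: "q0 \<noteq> 0 \<or> q1 \<noteq> 0" and "\<And>z1 z2. qf q0 q1 0 z1 z2 * cf k0 k1 k2 k3 z1 z2 = 0"
  shows "k0 = 0" "k1 = 0" "k2 = 0" "k3 = 0"
proof -
  have "poly ([:q0,q1:] * [:k0,k1,k2,k3:]) s = 0" for s
    by (rule trans[OF _ assms(2)[of 1 s]]) (simp add: qf_def cf_def power2_eq_square power3_eq_cube algebra_simps)
  hence "[:q0,q1:] * [:k0,k1,k2,k3:] = 0" using poly_all_0_iff_0 by blast
  hence "[:q0,q1:] = 0 \<or> [:k0,k1,k2,k3:] = 0" by (simp only: mult_eq_0_iff)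
  hence "[:k0,k1,k2,k3:] = 0" using q by auto
  thus "k0 = 0" "k1 = 0" "k2 = 0" "k3 = 0" by simp_all
qed

lemma quadratic_cancel:
  fixes q0 q1 :: complex
  assumes q: "q0 \<noteq> 0" and "\<And>z1 z2. qf q0 q1 0 z1 z2 * (qf 0 (-cnj q1) (cnj q0) z1 z2 * qf k0 k1 k2 z1 z2) = 0"
  shows "k0 = 0" "k1 = 0" "k2 = 0"
proof -
  have "poly ([:q0,q1:] * ([:0,-cnj q1, cnj q0:] * [:k0,k1,k2:])) s = 0" for s
    by (rule trans[OF _ assms(2)[of 1 s]]) (simp add: qf_def power2_eq_square algebra_simps)
  hence "[:q0,q1:] * ([:0,-cnj q1, cnj q0:] * [:k0,k1,k2:]) = 0" using poly_all_0_iff_0 by blast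
  hence "[:q0,q1:] = 0 \<or> [:0,-cnj q1, cnj q0:] = 0 \<or> [:k0,k1,k2:] = 0" by (simp only: mult_eq_0_iff)
  hence "[:k0,k1,k2:] = 0" using q by auto
  thus "k0 = 0" "k1 = 0" "k2 = 0" by simp_all
qed

text \<open>Put \<open>u = (-z2, z1)\<close>, so that \<open>z1 u1 + z2 u2 = 0\<close>. Identity \<open>II\<close> becomes \<open>q\<close> times a form plus \<open>c\<close> times
\<open>cnj c(-z2, z1)\<close>, so \<open>q\<close> divides the latter; this gives \<open>c = qt Y\<close> with \<open>qt(z) = cnj q(-z2, z1)\<close>, where \<open>cnj\<close> conjugates the coefficients, and a
linear form \<open>Y = b1 z1 + b2 z2\<close>. Identity \<open>I\<close> gives \<open>m = \<rho> qt\<close> in the same way, and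
then \<open>J\<close> is a linear form \<open>j\<close> times \<open>z\<close> minus \<open>\<rho> q\<close> times \<open>cnj b\<close>.\<close>
lemma (in rank3_system) coprime_form:
  assumes nr: "\<And>z1 z2. qf q0 q1 0 z1 z2 = 0 \<Longrightarrow> cf c0 c1 c2 c3 z1 z2 = 0 \<Longrightarrow> z1 = 0 \<and> z2 = 0"
  obtains b1 b2 \<rho> j1 j2 :: complex and D :: real
  where "c0 = 0" "c1 = - cnj q1 * b1" "c2 = cnj q0 * b1 - cnj q1 * b2" "c3 = cnj q0 * b2" "c3 \<noteq> 0"
    "m0 = 0" "m1 = - \<rho> * cnj q1" "m2 = \<rho> * cnj q0"
    "x0 = j1 - \<rho> * cnj b1 * q0" "x1 = j2 - \<rho> * cnj b1 * q1" "x2 = 0"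
    "y0 = - \<rho> * cnj b2 * q0" "y1 = j1 - \<rho> * cnj b2 * q1" "y2 = j2"
    "D = p * r - (cmod w)\<^sup>2" "w = D * b2 * cnj b1" "p / D + (cmod b2)\<^sup>2 = r / D + (cmod b1)\<^sup>2"
proof -
  define D where "D = p * r - (cmod w)\<^sup>2"
  have Dpos: "D > 0" using det by (simp add: D_def)
  define cD where "cD = complex_of_real D"
  have cD: "cD \<noteq> 0" using Dpos by (simp add: cD_def)
  define h where "h = (\<lambda>z1 z2. qf (-cnj w/cD) ((p-r)/cD) (w/cD) z1 z2)"
  have h: "(complex_of_real r*z1*(-z2) - w*z2*(-z2) - cnj w*z1*z1 + complex_of_real p*z2*z1) / cD = h z1 z2" for z1 z2
    by (simp add: h_def qf_def add_divide_distrib diff_divide_distrib power2_eq_square algebra_simps)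
  have conj_c: "cf (cnj c0) (cnj c1) (cnj c2) (cnj c3) (-z2) z1 = cf (cnj c3) (-cnj c2) (cnj c1) (-cnj c0) z1 z2" for z1 z2
    by (simp add: cf_def power2_eq_square power3_eq_cube algebra_simps)
  have conj_q: "qf (cnj q0) (cnj q1) 0 (-z2) z1 = qf 0 (-cnj q1) (cnj q0) z1 z2" for z1 z2
    by (simp add: qf_def power2_eq_square algebra_simps)
  have conj_m: "qf (cnj a) (cnj b) (cnj c) (-z2) z1 = qf (cnj c) (-cnj b) (cnj a) z1 z2" for z1 z2 a b c
    by (simp add: qf_def power2_eq_square algebra_simps)
  have II': "qf q0 q1 0 z1 z2 * (qf 0 (-cnj q1) (cnj q0) z1 z2 * h z1 z2)
     + cf c0 c1 c2 c3 z1 z2 * cf (cnj c3) (-cnj c2) (cnj c1) (-cnj c0) z1 z2 = 0" for z1 z2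
    using II[of z1 z2 "-z2" z1] unfolding D_def[symmetric] cD_def[symmetric] h conj_c conj_q
    by (simp add: algebra_simps)
  have contII: "isCont (\<lambda>s. qf 0 (-cnj q1) (cnj q0) s 1 * h s 1) 0"
    unfolding h_def qf_def by (intro continuous_intros)
  obtain l1 l2 where l: "cnj c3 = q0 * l1" "- cnj c2 = q0 * l2 + q1 * l1" "cnj c1 = q1 * l2" "- cnj c0 = 0"
    by (rule cubic_divisible[OF q nr II' contII])
  define b1 where "b1 = - cnj l2"
  define b2 where "b2 = cnj l1"
  have c0: "c0 = 0" using l(4) by simp
  have c1: "c1 = - cnj q1 * b1" using arg_cong[OF l(3), of cnj] by (simp add: b1_def)
  have "- c2 = cnj q0 * cnj l2 + cnj q1 * cnj l1" using arg_cong[OF l(2), of cnj] by simp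
  hence c2: "c2 = cnj q0 * b1 - cnj q1 * b2" unfolding b1_def b2_def by algebra
  have c3: "c3 = cnj q0 * b2" using arg_cong[OF l(1), of cnj] by (simp add: b2_def)
  have c3nz: "c3 \<noteq> 0" using nr[of 0 1] by (auto simp: qf_def cf_def)
  have q0: "q0 \<noteq> 0" using c3nz c3 by auto
  have I': "qf q0 q1 0 z1 z2 * cf (cnj x2) (cnj y2 - cnj x1) (cnj x0 - cnj y1) (cnj y0) z1 z2
     + cf c0 c1 c2 c3 z1 z2 * qf (cnj m2) (-cnj m1) (cnj m0) z1 z2 = 0" for z1 z2
  proof -
    have "z1 * qf (cnj x2) (-cnj x1) (cnj x0) z1 z2 + z2 * qf (cnj y2) (-cnj y1) (cnj y0) z1 z2
        = cf (cnj x2) (cnj y2 - cnj x1) (cnj x0 - cnj y1) (cnj y0) z1 z2"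
      by (simp add: qf_def cf_def power2_eq_square power3_eq_cube algebra_simps)
    thus ?thesis using I[of z1 z2 "-z2" z1] unfolding conj_m by (simp add: algebra_simps)
  qed
  have contI: "isCont (\<lambda>s. cf (cnj x2) (cnj y2 - cnj x1) (cnj x0 - cnj y1) (cnj y0) s 1) 0"
    unfolding cf_def by (intro continuous_intros)
  obtain rc where rc: "cnj m2 = q0 * rc" "- cnj m1 = q1 * rc" "cnj m0 = 0"
    by (rule quadratic_divisible[OF q nr I' contI])
  define \<rho> where "\<rho> = cnj rc"
  have "- m1 = cnj q1 * \<rho>" using arg_cong[OF rc(2), of cnj] by (simp add: \<rho>_def)
  hence m1: "m1 = - \<rho> * cnj q1" by algebra
  have m: "m0 = 0" "m1 = - \<rho> * cnj q1" "m2 = \<rho> * cnj q0"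
    using rc(3) m1 arg_cong[OF rc(1), of cnj] by (simp_all add: \<rho>_def)
  have "qf q0 q1 0 z1 z2 * cf (cnj x2 + rc * c0) (cnj y2 - cnj x1 + rc * c1) (cnj x0 - cnj y1 + rc * c2) (cnj y0 + rc * c3) z1 z2 = 0" for z1 z2
    by (rule trans[OF _ I'[of z1 z2]]) (simp only: rc qf_def cf_def, algebra)
  note J = cubic_cancel[OF q this]
  have x2: "x2 = 0" using J(1) c0 by simp
  have J2: "y2 - x1 = \<rho> * q1 * cnj b1"
    using arg_cong[OF J(2), of cnj] by (simp add: \<rho>_def c1 algebra_simps)
  have J3: "x0 - y1 = - \<rho> * (q0 * cnj b1 - q1 * cnj b2)"
    using arg_cong[OF J(3), of cnj] by (simp add: \<rho>_def c2 algebra_simps)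
  have J4: "y0 = - \<rho> * cnj b2 * q0"
    using arg_cong[OF J(4), of cnj] by (simp add: \<rho>_def c3 eq_neg_iff_add_eq_0 algebra_simps)
  define j1 where "j1 = y1 + \<rho> * cnj b2 * q1"
  have x0: "x0 = j1 - \<rho> * cnj b1 * q0" using J3 unfolding j1_def by algebra
  have x1: "x1 = y2 - \<rho> * cnj b1 * q1" using J2 by algebra
  have y1: "y1 = j1 - \<rho> * cnj b2 * q1" by (simp add: j1_def)
  have "qf q0 q1 0 z1 z2 * (qf 0 (-cnj q1) (cnj q0) z1 z2 *
       qf (-cnj w/cD + b1 * cnj b2) ((p-r)/cD - b1 * cnj b1 + b2 * cnj b2) (w/cD - b2 * cnj b1) z1 z2) = 0" for z1 z2
    apply (rule trans[OF _ II'[of z1 z2]])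
    apply (simp only: l)
    apply (simp only: h_def c0 c1 c2 c3 b1_def b2_def complex_cnj_minus complex_cnj_cnj qf_def cf_def)
    apply algebra
    done
  note G = quadratic_cancel[OF q0 this]
  have w: "w = D * b2 * cnj b1" using G(3) cD by (simp add: cD_def field_simps)
  have "complex_of_real ((p - r) / D - (cmod b1)\<^sup>2 + (cmod b2)\<^sup>2) = complex_of_real 0"
    using G(2) by (simp add: nsq cD_def)
  hence "(p - r) / D - (cmod b1)\<^sup>2 + (cmod b2)\<^sup>2 = 0" by (simp only: of_real_eq_iff)
  hence e: "p / D + (cmod b2)\<^sup>2 = r / D + (cmod b1)\<^sup>2" by (simp add: diff_divide_distrib)
  show thesis by (rule that[OF c0 c1 c2 c3 c3nz m x0 x1 x2 J4 y1 refl D_def w e])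
qed

text \<open>The normal form for coprime \<open>q\<close> and \<open>c\<close>. The matrix \<open>\<Gamma>\<close> is \<open>gs\<close> times the identity plus \<open>D\<close> times the
matrix of rank one of the form \<open>Y\<close>; its eigenvalues are \<open>gb\<close> at the vector \<open>cnj b = (cnj b1, cnj b2)\<close> and \<open>gs\<close> at the
orthogonal vector.\<close>
locale coprime_system = rank3_system q0 q1 x0 x1 x2 y0 y1 y2 m0 m1 m2 c0 c1 c2 c3 w p r
  for q0 q1 x0 x1 x2 y0 y1 y2 m0 m1 m2 c0 c1 c2 c3 w :: complex and p r :: real +
  fixes b1 b2 \<rho> j1 j2 :: complex and D B gs gb :: real
  assumes nr: "\<And>z1 z2. qf q0 q1 0 z1 z2 = 0 \<Longrightarrow> cf c0 c1 c2 c3 z1 z2 = 0 \<Longrightarrow> z1 = 0 \<and> z2 = 0"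
    and c: "c0 = 0" "c1 = - cnj q1 * b1" "c2 = cnj q0 * b1 - cnj q1 * b2" "c3 = cnj q0 * b2" "c3 \<noteq> 0"
    and m: "m0 = 0" "m1 = - \<rho> * cnj q1" "m2 = \<rho> * cnj q0"
    and x: "x0 = j1 - \<rho> * cnj b1 * q0" "x1 = j2 - \<rho> * cnj b1 * q1" "x2 = 0"
    and y: "y0 = - \<rho> * cnj b2 * q0" "y1 = j1 - \<rho> * cnj b2 * q1" "y2 = j2"
    and D: "D = p * r - (cmod w)\<^sup>2" and w: "w = D * b2 * cnj b1"
    and B_def: "B = (cmod b1)\<^sup>2 + (cmod b2)\<^sup>2"
    and pe: "p = gs + D * (cmod b1)\<^sup>2" and re: "r = gs + D * (cmod b2)\<^sup>2" and gbs: "gb = gs + D * B"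
begin

lemma Dpos: "D > 0" using det D by simp
lemma b2: "b2 \<noteq> 0" using c by auto
lemma q0: "q0 \<noteq> 0" using c by auto
lemma Bpos: "B > 0" using b2 by (simp add: B_def add_nonneg_pos)
lemma Bc: "complex_of_real B = b1 * cnj b1 + b2 * cnj b2" by (simp add: B_def nsq)
lemma gg: "gs * gb = D"
proof -
  have "cmod w = D * (cmod b2 * cmod b1)" using arg_cong[OF w, of cmod] Dpos by (simp add: norm_mult)
  thus ?thesis using pe re D gbs B_def by algebra
qed
lemma pos: "gs > 0" "gb > 0"
proof -
  have "gs + gb = p + r" using gbs pe re B_def by algebra
  moreover have "r > 0"
  proof -
    have "p * r > 0" using det zero_le_power2[of "cmod w"] by linarith
    thus ?thesis using p by (simp add: zero_less_mult_iff)
  qed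
  ultimately have "gs + gb > 0" using p by simp
  moreover have "gs * gb > 0" using gg Dpos by simp
  ultimately show "gs > 0" "gb > 0" by (auto simp: zero_less_mult_iff)
qed
lemma pc: "complex_of_real p = gs + D * (b1 * cnj b1)" using arg_cong[OF pe, of complex_of_real] by (simp add: complex_norm_square[of b1, simplified])
lemma rc: "complex_of_real r = gs + D * (b2 * cnj b2)" using arg_cong[OF re, of complex_of_real] by (simp add: complex_norm_square[of b2, simplified])
lemma gbc: "complex_of_real gb = gs + D * (b1 * cnj b1 + b2 * cnj b2)" using arg_cong[OF gbs, of complex_of_real] Bc by simp
lemma wc: "cnj w = D * b1 * cnj b2" using w by simp

definition qz :: "complex \<Rightarrow> complex \<Rightarrow> complex" where "qz z1 z2 = z1 * (q0 * z1 + q1 * z2)"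
definition qb :: "complex \<Rightarrow> complex \<Rightarrow> complex" where "qb u1 u2 = u1 * (cnj q0 * u1 + cnj q1 * u2)"
definition Y :: "complex \<Rightarrow> complex \<Rightarrow> complex" where "Y z1 z2 = b1 * z1 + b2 * z2"
definition Yb :: "complex \<Rightarrow> complex \<Rightarrow> complex" where "Yb u1 u2 = cnj b1 * u1 + cnj b2 * u2"
definition j :: "complex \<Rightarrow> complex \<Rightarrow> complex" where "j z1 z2 = j1 * z1 + j2 * z2"
definition jb :: "complex \<Rightarrow> complex \<Rightarrow> complex" where "jb u1 u2 = cnj j1 * u1 + cnj j2 * u2"
text \<open>The Hermitian form with \<open>qt cnj qt = q cnj q + \<langle>z,u\<rangle> Dd\<close>, by which the product of the two forms
\<open>qt\<close> is expressed through \<open>q\<close>. Its trace is zero.\<close>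
definition Dd :: "complex \<Rightarrow> complex \<Rightarrow> complex \<Rightarrow> complex \<Rightarrow> complex" where
  "Dd z1 z2 u1 u2 = q0 * cnj q0 * (z2*u2 - z1*u1) - q0 * cnj q1 * z1 * u2 - cnj q0 * q1 * z2 * u1"
definition G :: "complex \<Rightarrow> complex \<Rightarrow> complex \<Rightarrow> complex \<Rightarrow> complex" where
  "G z1 z2 u1 u2 = complex_of_real gs * (z1*u1 + z2*u2) + D * (Y z1 z2 * Yb u1 u2)"

text \<open>What is left of identity \<open>I\<close> after division by \<open>z1 u1 + z2 u2\<close>; it is linear in \<open>u\<close>.\<close>
definition N1 :: "complex \<Rightarrow> complex \<Rightarrow> complex \<Rightarrow> complex \<Rightarrow> complex" where
  "N1 z1 z2 u1 u2 = cnj \<rho> * Y z1 z2 * Dd z1 z2 u1 u2 + qz z1 z2 * (jb u1 u2 - \<rho> * gb * Yb u1 u2) + j z1 z2 * G z1 z2 u1 u2"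

lemma G_eq: "u1 * (complex_of_real p * z1 + w * z2) + u2 * (cnj w * z1 + complex_of_real r * z2) = G z1 z2 u1 u2"
  unfolding pc rc wc unfolding w G_def Y_def Yb_def by algebra

lemma qtilde: "(z2 * (cnj q0 * z2 - cnj q1 * z1)) * (u2 * (q0 * u2 - q1 * u1)) = qz z1 z2 * qb u1 u2 + (z1*u1+z2*u2) * Dd z1 z2 u1 u2"
  unfolding qz_def qb_def Dd_def by algebra

lemma cf_c: "cf c0 c1 c2 c3 z1 z2 = (z2 * (cnj q0 * z2 - cnj q1 * z1)) * Y z1 z2"
  unfolding cf_def c Y_def by algebra

lemma N1_zero': "(z1*u1+z2*u2) * N1 z1 z2 u1 u2 = 0"
proof -
  have a: "z1 * qf (cnj x0) (cnj x1) (cnj x2) u1 u2 + z2 * qf (cnj y0) (cnj y1) (cnj y2) u1 u2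
     = - cnj \<rho> * Y z1 z2 * qb u1 u2 + (z1*u1+z2*u2) * jb u1 u2"
    by (simp add: qf_def x y Y_def qb_def jb_def power2_eq_square algebra_simps)
  have b: "qf (cnj m0) (cnj m1) (cnj m2) u1 u2 = cnj \<rho> * (u2 * (q0 * u2 - q1 * u1))"
    by (simp add: qf_def m power2_eq_square algebra_simps)
  have q: "qf q0 q1 0 z1 z2 = qz z1 z2" by (simp add: qf_def qz_def power2_eq_square algebra_simps)
  have d: "qf x0 x1 x2 z1 z2 = z1 * j z1 z2 - \<rho> * cnj b1 * qz z1 z2" "qf y0 y1 y2 z1 z2 = z2 * j z1 z2 - \<rho> * cnj b2 * qz z1 z2"
    by (simp_all add: qf_def x y j_def qz_def power2_eq_square algebra_simps)
  have "u1 * (p * qf x0 x1 x2 z1 z2 + w * qf y0 y1 y2 z1 z2) + u2 * (cnj w * qf x0 x1 x2 z1 z2 + r * qf y0 y1 y2 z1 z2)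
     = j z1 z2 * (u1 * (complex_of_real p * z1 + w * z2) + u2 * (cnj w * z1 + complex_of_real r * z2)) - \<rho> * qz z1 z2 * (u1 * (p * cnj b1 + w * cnj b2) + u2 * (cnj w * cnj b1 + r * cnj b2))"
    unfolding d by (simp add: algebra_simps)
  also have "u1 * (p * cnj b1 + w * cnj b2) + u2 * (cnj w * cnj b1 + r * cnj b2) = gb * Yb u1 u2"
    unfolding pc rc wc unfolding w gbc Yb_def by algebra
  finally have e: "u1 * (p * qf x0 x1 x2 z1 z2 + w * qf y0 y1 y2 z1 z2) + u2 * (cnj w * qf x0 x1 x2 z1 z2 + r * qf y0 y1 y2 z1 z2)
     = j z1 z2 * G z1 z2 u1 u2 - \<rho> * qz z1 z2 * (gb * Yb u1 u2)" unfolding G_eq .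
  have "(z1*u1+z2*u2) * N1 z1 z2 u1 u2 = qz z1 z2 * (- cnj \<rho> * Y z1 z2 * qb u1 u2 + (z1*u1+z2*u2) * jb u1 u2)
    + cnj \<rho> * Y z1 z2 * (qz z1 z2 * qb u1 u2 + (z1*u1+z2*u2) * Dd z1 z2 u1 u2)
    + (z1*u1+z2*u2) * (j z1 z2 * G z1 z2 u1 u2 - \<rho> * qz z1 z2 * (gb * Yb u1 u2))"
    unfolding N1_def by (simp add: algebra_simps)
  also have "\<dots> = 0"
    unfolding qtilde[symmetric]
    by (rule trans[OF _ I[of z1 z2 u1 u2, unfolded a b q cf_c e]]) (simp add: algebra_simps)
  finally show ?thesis .
qed

text \<open>Where \<open>z1 u1 + z2 u2\<close> vanishes, linearity in \<open>u\<close> is used: both \<open>u + cnj z\<close> and \<open>cnj z\<close> are outside of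
that exceptional set.\<close>
lemma N1_zero: "N1 z1 z2 u1 u2 = 0"
proof (cases "z1*u1+z2*u2 = 0")
  case False thus ?thesis using N1_zero'[of z1 u1 z2 u2] by simp
next
  case True
  show ?thesis
  proof (cases "z1 = 0 \<and> z2 = 0")
    case True thus ?thesis by (simp add: N1_def Y_def qz_def j_def)
  next
    case F: False
    have n: "z1 * cnj z1 + z2 * cnj z2 = complex_of_real ((cmod z1)\<^sup>2 + (cmod z2)\<^sup>2)" by (simp add: nsq)
    have "(cmod z1)\<^sup>2 + (cmod z2)\<^sup>2 \<noteq> 0" using F by (simp add: sum_power2_eq_zero_iff)
    hence nz: "z1 * cnj z1 + z2 * cnj z2 \<noteq> 0" unfolding n of_real_eq_0_iff .
    have "z1 * (u1 + cnj z1) + z2 * (u2 + cnj z2) = z1 * cnj z1 + z2 * cnj z2" using True by algebra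
    hence "N1 z1 z2 (u1 + cnj z1) (u2 + cnj z2) = 0" using N1_zero'[of z1 "u1 + cnj z1" z2 "u2 + cnj z2"] nz by simp
    moreover have "N1 z1 z2 (cnj z1) (cnj z2) = 0" using N1_zero'[of z1 "cnj z1" z2 "cnj z2"] nz by simp
    moreover have "N1 z1 z2 (u1 + cnj z1) (u2 + cnj z2) = N1 z1 z2 u1 u2 + N1 z1 z2 (cnj z1) (cnj z2)"
      unfolding N1_def Dd_def jb_def Yb_def G_def by (simp add: algebra_simps)
    ultimately show ?thesis by simp
  qed
qed

lemma Y_vals: "Y (cnj b1) (cnj b2) = B" "Y (-b2) b1 = 0" "Yb b1 b2 = B" "Yb (-cnj b2) (cnj b1) = 0"
  by (simp_all add: Y_def Yb_def Bc)

text \<open>The vector \<open>(-b2, b1)\<close> is a root of \<open>Y\<close> and therefore of \<open>c\<close>.\<close>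
lemma qz_f: "qz (-b2) b1 \<noteq> 0"
proof
  assume "qz (-b2) b1 = 0"
  hence "qf q0 q1 0 (-b2) b1 = 0" by (simp add: qf_def qz_def power2_eq_square algebra_simps)
  moreover have "cf c0 c1 c2 c3 (-b2) b1 = 0" unfolding cf_c Y_vals by simp
  ultimately show False using nr[of "-b2" b1] b2 by simp
qed

text \<open>The values of \<open>j\<close> and of \<open>Dd\<close> in the orthogonal basis \<open>cnj b\<close>, \<open>(-b2, b1)\<close> follow by inserting basis
vectors into \<open>N1 = 0\<close>.\<close>
lemma jb_b: "jb b1 b2 = \<rho> * gb * B"
proof -
  have "N1 (-b2) b1 b1 b2 = qz (-b2) b1 * (jb b1 b2 - \<rho> * gb * B)"
    unfolding N1_def Y_vals G_def by simp
  thus ?thesis using N1_zero qz_f by simp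
qed

lemma j_b: "j (cnj b1) (cnj b2) = cnj \<rho> * gb * B"
  using arg_cong[OF jb_b, of cnj] by (simp add: jb_def j_def)

lemma j_N: "Y z1 z2 * (cnj \<rho> * Dd z1 z2 b1 b2 + gb * j z1 z2) = 0"
proof -
  have "G z1 z2 b1 b2 = gb * Y z1 z2" unfolding G_def Y_vals gbs by (simp add: Y_def algebra_simps)
  hence "N1 z1 z2 b1 b2 = Y z1 z2 * (cnj \<rho> * Dd z1 z2 b1 b2 + gb * j z1 z2)"
    unfolding N1_def jb_b Y_vals by (simp add: algebra_simps)
  thus ?thesis using N1_zero by simp
qed

lemma Bcz: "complex_of_real B \<noteq> 0" using Bpos by simp

lemma D_b: "cnj \<rho> * Dd (cnj b1) (cnj b2) b1 b2 + gb * j (cnj b1) (cnj b2) = 0"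
  using j_N[of "cnj b1" "cnj b2"] Bcz unfolding Y_vals by (simp only: mult_eq_0_iff simp_thms)

lemma D_f: "cnj \<rho> * Dd (-b2) b1 b1 b2 + gb * j (-b2) b1 = 0"
proof -
  have "Y (cnj b1 + (-b2)) (cnj b2 + b1) = B" using Y_vals(1,2) by (simp add: Y_def algebra_simps)
  hence "cnj \<rho> * Dd (cnj b1 + (-b2)) (cnj b2 + b1) b1 b2 + gb * j (cnj b1 + (-b2)) (cnj b2 + b1) = 0"
    using j_N[of "cnj b1 + (-b2)" "cnj b2 + b1"] Bcz by (simp only: mult_eq_0_iff simp_thms)
  moreover have "cnj \<rho> * Dd (cnj b1 + (-b2)) (cnj b2 + b1) b1 b2 + gb * j (cnj b1 + (-b2)) (cnj b2 + b1)
     = (cnj \<rho> * Dd (cnj b1) (cnj b2) b1 b2 + gb * j (cnj b1) (cnj b2)) + (cnj \<rho> * Dd (-b2) b1 b1 b2 + gb * j (-b2) b1)"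
    unfolding Dd_def j_def by (simp add: algebra_simps)
  ultimately show ?thesis unfolding D_b by simp
qed

lemma N_f: "cnj \<rho> * Y z1 z2 * Dd z1 z2 (-cnj b2) (cnj b1) + qz z1 z2 * jb (-cnj b2) (cnj b1)
    + j z1 z2 * (gs * (z1 * (-cnj b2) + z2 * cnj b1)) = 0"
  using N1_zero[of z1 z2 "-cnj b2" "cnj b1"] unfolding N1_def Y_vals G_def by simp

lemma trace: "Dd (cnj b1) (cnj b2) b1 b2 + Dd (-b2) b1 (-cnj b2) (cnj b1) = 0"
  unfolding Dd_def by (simp add: algebra_simps)

lemma cnj_Dd: "cnj (Dd (-b2) b1 b1 b2) = Dd (cnj b1) (cnj b2) (-cnj b2) (cnj b1)"
  unfolding Dd_def by (simp add: algebra_simps)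

lemma D_bb: "Dd (cnj b1) (cnj b2) b1 b2 * B = (cmod (qz (-b2) b1))\<^sup>2 - (cmod (qz (cnj b1) (cnj b2)))\<^sup>2"
proof -
  have 1: "cnj (qz (cnj b1) (cnj b2)) = qb b1 b2" by (simp add: qz_def qb_def)
  have 2: "b2 * (q0 * b2 - q1 * b1) = qz (-b2) b1" by (simp add: qz_def algebra_simps)
  have 3: "cnj b2 * (cnj q0 * cnj b2 - cnj q1 * cnj b1) = cnj (qz (-b2) b1)" by (simp add: qz_def algebra_simps)
  show ?thesis
    using qtilde[of "cnj b2" "cnj b1" b2 b1] unfolding 2 3 1[symmetric] nsq Bc by (simp add: algebra_simps)
qed

text \<open>If \<open>\<rho> \<noteq> 0\<close>, the diagonal entry of \<open>Dd\<close> at \<open>cnj b\<close> is \<open>- gb\<^sup>2 B\<close>. If the off-diagonal entry \<open>e\<close> vanishes, the other diagonal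
entry is \<open>- gb gs B\<close>, and the trace is negative instead of zero. If it does not vanish, the absolute
values of \<open>q\<close> at the two basis vectors are \<open>gb B\<close> and \<open>gs B\<close>, which contradicts the relation between
\<open>Dd\<close> and \<open>q\<close>.\<close>
lemma rho_zero: "\<rho> = 0"
proof (rule ccontr)
  assume rho: "\<rho> \<noteq> 0"
  have Dbb: "Dd (cnj b1) (cnj b2) b1 b2 = - complex_of_real (gb * gb * B)"
  proof -
    have "cnj \<rho> * (Dd (cnj b1) (cnj b2) b1 b2 + gb * gb * B) = 0" using D_b unfolding j_b by (simp add: algebra_simps)
    thus ?thesis using rho by (simp add: eq_neg_iff_add_eq_0)
  qed
  define e where "e = Dd (-b2) b1 b1 b2"
  have jf: "gb * j (-b2) b1 = - cnj \<rho> * e" using D_f unfolding e_def by (simp add: add_eq_0_iff2)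
  have jbf: "jb (-cnj b2) (cnj b1) = cnj (j (-b2) b1)" by (simp add: jb_def j_def)
  have gc: "complex_of_real gb \<noteq> 0" "complex_of_real gs \<noteq> 0" using pos by simp_all
  show False
  proof (cases "e = 0")
    case True
    hence jf0: "j (-b2) b1 = 0" using jf gc by simp
    have "cnj \<rho> * B * (Dd (cnj b1) (cnj b2) (-cnj b2) (cnj b1) + Dd (-b2) b1 (-cnj b2) (cnj b1))
       + j (cnj b1) (cnj b2) * gs * B = 0"
    proof -
      have 1: "Y (cnj b1 + (-b2)) (cnj b2 + b1) = B" using Y_vals(1,2) by (simp add: Y_def algebra_simps)
      have 2: "j (cnj b1 + (-b2)) (cnj b2 + b1) = j (cnj b1) (cnj b2)" using jf0 by (simp add: j_def algebra_simps)
      have 3: "Dd (cnj b1 + (-b2)) (cnj b2 + b1) (-cnj b2) (cnj b1) = Dd (cnj b1) (cnj b2) (-cnj b2) (cnj b1) + Dd (-b2) b1 (-cnj b2) (cnj b1)"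
        unfolding Dd_def by (simp add: algebra_simps)
      have 4: "(cnj b1 + (-b2)) * (-cnj b2) + (cnj b2 + b1) * cnj b1 = B" unfolding Bc by (simp add: algebra_simps)
      show ?thesis using N_f[of "cnj b1 + (-b2)" "cnj b2 + b1"] unfolding 1 2 3 4 jbf jf0 by (simp add: algebra_simps)
    qed
    hence "cnj \<rho> * B * (Dd (-b2) b1 (-cnj b2) (cnj b1) + gb * gs * B) = 0"
      unfolding cnj_Dd[symmetric] e_def[symmetric] True j_b by (simp add: algebra_simps)
    hence F: "Dd (-b2) b1 (-cnj b2) (cnj b1) = - complex_of_real (gb * gs * B)"
      using rho Bcz by (simp add: eq_neg_iff_add_eq_0)
    have "complex_of_real (gb * gb * B) + complex_of_real (gb * gs * B) = 0" using trace unfolding Dbb F by algebra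
    hence "complex_of_real (gb * gb * B + gb * gs * B) = complex_of_real 0" by simp
    hence "gb * gb * B + gb * gs * B = 0" by (simp only: of_real_eq_iff)
    moreover have "gb * gb * B + gb * gs * B > 0" using pos Bpos by (simp add: add_pos_pos)
    ultimately show False by simp
  next
    case False
    have jf1: "j (-b2) b1 \<noteq> 0" using jf False rho gc by auto
    have nf: "cmod (qz (-b2) b1) = gs * B"
    proof -
      have 4: "(-b2) * (-cnj b2) + b1 * cnj b1 = B" unfolding Bc by (simp add: algebra_simps)
      have "qz (-b2) b1 * cnj (j (-b2) b1) = - (j (-b2) b1 * (gs * B))"
        using N_f[of "-b2" b1] unfolding Y_vals 4 jbf by (simp add: add_eq_0_iff2)
      from arg_cong[OF this, of cmod] have "cmod (qz (-b2) b1) * cmod (j (-b2) b1) = cmod (j (-b2) b1) * (gs * B)"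
        using pos Bpos by (simp add: norm_mult)
      thus ?thesis using jf1 by simp
    qed
    have nb: "cmod (qz (cnj b1) (cnj b2)) = gb * B"
    proof -
      have 4: "cnj b1 * (-cnj b2) + cnj b2 * cnj b1 = 0" by simp
      have E: "cnj \<rho> * B * cnj e + qz (cnj b1) (cnj b2) * cnj (j (-b2) b1) = 0"
        using N_f[of "cnj b1" "cnj b2"] unfolding Y_vals 4 jbf e_def cnj_Dd by simp
      have jfc: "gb * cnj (j (-b2) b1) = - \<rho> * cnj e" using arg_cong[OF jf, of cnj] by simp
      have "qz (cnj b1) (cnj b2) * (\<rho> * cnj e) = - (qz (cnj b1) (cnj b2) * (gb * cnj (j (-b2) b1)))" unfolding jfc by simp
      also have "\<dots> = gb * (cnj \<rho> * B * cnj e)" using E by algebra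
      finally have "qz (cnj b1) (cnj b2) * (\<rho> * cnj e) = gb * (cnj \<rho> * B * cnj e)" .
      from arg_cong[OF this, of cmod] have "cmod (qz (cnj b1) (cnj b2)) * (cmod \<rho> * cmod e) = gb * (cmod \<rho> * B * cmod e)"
        using pos Bpos by (simp add: norm_mult)
      thus ?thesis using rho False by simp
    qed
    have "complex_of_real (- (gb * gb * B) * B) = complex_of_real ((gs * B)\<^sup>2 - (gb * B)\<^sup>2)"
      using D_bb unfolding Dbb nf nb by simp
    hence "- (gb * gb * B) * B = (gs * B)\<^sup>2 - (gb * B)\<^sup>2" by (simp only: of_real_eq_iff)
    hence "gs * B = 0" by (simp add: power2_eq_square algebra_simps)
    thus False using pos Bpos by simp
  qed
qed

text \<open>With \<open>\<rho> = 0\<close> also \<open>j = 0\<close>, so that \<open>J\<close> and \<open>m\<close> vanish. Identity \<open>II\<close> is tested at the vectors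
\<open>\<tau> cnj b + (-b2, b1)\<close>: pairing with the root vector of \<open>Y\<close> shows that \<open>q\<close> takes the same value for all
\<open>\<tau>\<close>, so \<open>q\<close> vanishes at \<open>cnj b\<close>. The diagonal entries at \<open>cnj b\<close> and for \<open>\<tau> = 1\<close> and \<open>\<tau> = -1\<close> then give
two equations for \<open>gs\<close> and \<open>gb\<close> whose only positive solution is \<open>gs = gb = 1\<close>, against \<open>gb = gs + D B\<close>.\<close>
lemma contradiction: False
proof -
  have gc: "complex_of_real gb \<noteq> 0" "complex_of_real gs \<noteq> 0" using pos by simp_all
  have jb0: "j (cnj b1) (cnj b2) = 0" using j_b rho_zero by simp
  have jf0: "j (-b2) b1 = 0" using D_f rho_zero gc by simp
  have "B * j1 = b1 * j (cnj b1) (cnj b2) - cnj b2 * j (-b2) b1"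
    "B * j2 = b2 * j (cnj b1) (cnj b2) + cnj b1 * j (-b2) b1"
    unfolding Bc j_def by (simp_all add: algebra_simps)
  hence j0: "j1 = 0" "j2 = 0" using jb0 jf0 Bcz by simp_all
  have xy0: "x0 = 0" "x1 = 0" "y0 = 0" "y1 = 0" "y2 = 0" "m1 = 0" "m2 = 0"
    using x y m j0 rho_zero by simp_all
  have gsgb: "complex_of_real gs * gb = D" using gg by (metis of_real_mult)
  have gD: "complex_of_real gb = gs + D * B" using gbs by simp
  \<comment> \<open>without quadratic parts identity \<open>II\<close> is divisible by \<open>z1 u1 + z2 u2\<close>; this is \<open>gs\<close> times the quotient\<close>
  have N2: "(1 - gs) * (qz z1 z2 * qb u1 u2) + gs * (Dd z1 z2 u1 u2 * (Y z1 z2 * Yb u1 u2))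
      + gs * ((z1*u1+z2*u2) * (G z1 z2 u1 u2 - (z1*u1+z2*u2))) = 0" if s: "z1*u1+z2*u2 \<noteq> 0" for z1 z2 u1 u2
  proof -
    define s where "s = z1*u1+z2*u2"
    have D0: "complex_of_real D \<noteq> 0" using Dpos by simp
    have 1: "complex_of_real r*z1*u1 - w*z2*u1 - cnj w*z1*u2 + complex_of_real p*z2*u2 = gb * s - D * (Y z1 z2 * Yb u1 u2)"
      unfolding pc rc wc gbc Y_def Yb_def s_def unfolding w by algebra
    have 2: "qf q0 q1 0 z1 z2 = qz z1 z2" "qf (cnj q0) (cnj q1) 0 u1 u2 = qb u1 u2"
      by (simp_all add: qf_def qz_def qb_def power2_eq_square algebra_simps)
    have 3: "cf (cnj c0) (cnj c1) (cnj c2) (cnj c3) u1 u2 = (u2 * (q0 * u2 - q1 * u1)) * Yb u1 u2"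
      by (simp add: cf_def c Yb_def power2_eq_square power3_eq_cube algebra_simps)
    have 4: "qf (0::complex) 0 0 a b = 0" "G 0 0 0 0 = 0" for a b by (simp_all add: qf_def G_def Y_def)
    have E: "qz z1 z2 * qb u1 u2 * ((gb * s - D * (Y z1 z2 * Yb u1 u2)) / D)
       + z2 * (cnj q0 * z2 - cnj q1 * z1) * Y z1 z2 * (u2 * (q0 * u2 - q1 * u1) * Yb u1 u2)
       + s * (- (qz z1 z2 * qb u1 u2)) + s\<^sup>2 * G z1 z2 u1 u2 - s^3 = 0"
      using II[of z1 z2 u1 u2] unfolding D[symmetric] 1 2 3 cf_c G_eq s_def[symmetric]
      by (simp add: xy0 x m 4)
    have "gs * ((gb * s - D * (Y z1 z2 * Yb u1 u2)) / D) = s - gs * (Y z1 z2 * Yb u1 u2)"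
    proof -
      have "gs * (gb * s - D * (Y z1 z2 * Yb u1 u2)) = D * (s - gs * (Y z1 z2 * Yb u1 u2))"
        unfolding gsgb[symmetric] by (simp add: algebra_simps)
      thus ?thesis using D0 by (simp add: field_simps)
    qed
    hence "qz z1 z2 * qb u1 u2 * (s - gs * (Y z1 z2 * Yb u1 u2))
       + gs * (Y z1 z2 * Yb u1 u2) * ((z2 * (cnj q0 * z2 - cnj q1 * z1)) * (u2 * (q0 * u2 - q1 * u1)))
       + gs * (s * (- (qz z1 z2 * qb u1 u2)) + s\<^sup>2 * G z1 z2 u1 u2 - s^3) = 0"
      using E by algebra
    hence "s * ((1 - gs) * (qz z1 z2 * qb u1 u2) + gs * (Dd z1 z2 u1 u2 * (Y z1 z2 * Yb u1 u2)) + gs * (s * (G z1 z2 u1 u2 - s))) = 0"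
      unfolding qtilde s_def[symmetric] by (simp add: power2_eq_square power3_eq_cube algebra_simps)
    thus ?thesis using s unfolding s_def[symmetric] by simp
  qed
  define qf' where "qf' = qz (-b2) b1"
  have qbf: "qb (-cnj b2) (cnj b1) = cnj qf'" by (simp add: qf'_def qz_def qb_def)
  have sf: "(\<tau> * cnj b1 + (-b2)) * (-cnj b2) + (\<tau> * cnj b2 + b1) * cnj b1 = B" for \<tau>
    unfolding Bc by (simp add: algebra_simps)
  have F1: "(1 - gs) * (qz (\<tau> * cnj b1 + (-b2)) (\<tau> * cnj b2 + b1) * cnj qf') = (1 - gs) * (gs * (B * B))" for \<tau>
  proof -
    have "G (\<tau> * cnj b1 + (-b2)) (\<tau> * cnj b2 + b1) (-cnj b2) (cnj b1) = gs * B"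
      unfolding G_def sf Y_vals by simp
    thus ?thesis using N2[of "\<tau> * cnj b1 + (-b2)" "-cnj b2" "\<tau> * cnj b2 + b1" "cnj b1"] Bcz
      unfolding sf qbf Y_vals by (simp add: algebra_simps)
  qed
  have sb: "cnj b1 * b1 + cnj b2 * b2 = B" unfolding Bc by (simp add: algebra_simps)
  have F2: "(1 - gs) * (qz (cnj b1) (cnj b2) * cnj (qz (cnj b1) (cnj b2))) + gs * (Dd (cnj b1) (cnj b2) b1 b2 * (B * B)) + gs * (B * (gb * B - B)) = 0"
  proof -
    have "G (cnj b1) (cnj b2) b1 b2 = gb * B" unfolding G_def sb Y_vals gbs by (simp add: algebra_simps)
    moreover have "qb b1 b2 = cnj (qz (cnj b1) (cnj b2))" by (simp add: qz_def qb_def)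
    ultimately show ?thesis using N2[of "cnj b1" b1 "cnj b2" b2] Bcz unfolding sb Y_vals by simp
  qed
  have F3: "(1 - gs) * (qz (\<tau> * cnj b1 + (-b2)) (\<tau> * cnj b2 + b1) * cnj (qz (\<tau> * cnj b1 + (-b2)) (\<tau> * cnj b2 + b1)))
     + gs * (Dd (\<tau> * cnj b1 + (-b2)) (\<tau> * cnj b2 + b1) (\<tau> * b1 + (-cnj b2)) (\<tau> * b2 + cnj b1) * (B * B))
     + gs * ((2 * B) * (gs * (2 * B) + D * (B * B) - 2 * B)) = 0" if tau: "\<tau> * \<tau> = 1" "cnj \<tau> = \<tau>" for \<tau>
  proof -
    have s: "(\<tau> * cnj b1 + (-b2)) * (\<tau> * b1 + (-cnj b2)) + (\<tau> * cnj b2 + b1) * (\<tau> * b2 + cnj b1) = 2 * complex_of_real B"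
      using tau(1) unfolding Bc by algebra
    have Y: "Y (\<tau> * cnj b1 + (-b2)) (\<tau> * cnj b2 + b1) = \<tau> * B" "Yb (\<tau> * b1 + (-cnj b2)) (\<tau> * b2 + cnj b1) = \<tau> * B"
      unfolding Bc Y_def Yb_def by (simp_all add: algebra_simps)
    have YY: "\<tau> * B * (\<tau> * B) = B * B" for B using tau(1) by algebra
    have "G (\<tau> * cnj b1 + (-b2)) (\<tau> * cnj b2 + b1) (\<tau> * b1 + (-cnj b2)) (\<tau> * b2 + cnj b1) = gs * (2 * B) + D * (B * B)"
      unfolding G_def s Y YY by simp
    moreover have "qb (\<tau> * b1 + (-cnj b2)) (\<tau> * b2 + cnj b1) = cnj (qz (\<tau> * cnj b1 + (-b2)) (\<tau> * cnj b2 + b1))"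
      using tau(2) by (simp add: qz_def qb_def)
    ultimately show ?thesis
      using N2[of "\<tau> * cnj b1 + (-b2)" "\<tau> * b1 + (-cnj b2)" "\<tau> * cnj b2 + b1" "\<tau> * b2 + cnj b1"] Bcz
      unfolding s Y YY by simp
  qed
  have Dpm: "Dd (1 * cnj b1 + (-b2)) (1 * cnj b2 + b1) (1 * b1 + (-cnj b2)) (1 * b2 + cnj b1)
     + Dd ((-1) * cnj b1 + (-b2)) ((-1) * cnj b2 + b1) ((-1) * b1 + (-cnj b2)) ((-1) * b2 + cnj b1) = 0"
    unfolding Dd_def by (simp add: algebra_simps)
  define qp where "qp = qz (1 * cnj b1 + (-b2)) (1 * cnj b2 + b1)"
  define qm where "qm = qz ((-1) * cnj b1 + (-b2)) ((-1) * cnj b2 + b1)"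
  have F4: "(1 - gs) * (qp * cnj qp + qm * cnj qm) + 2 * (gs * ((2 * B) * (gs * (2 * B) + D * (B * B) - 2 * B))) = 0"
    using F3[of 1] F3[of "-1"] Dpm unfolding qp_def[symmetric] qm_def[symmetric] by simp algebra
  have par: "qp + qm = 2 * qf' + 2 * qz (cnj b1) (cnj b2)"
    unfolding qp_def qm_def qf'_def qz_def by (simp add: algebra_simps)
  have F5: "(1 - gs) * ((cmod qp)\<^sup>2 + (cmod qm)\<^sup>2) + 4 * gs * (B * B) * (gs + gb - 2) = 0"
  proof -
    have "complex_of_real ((1 - gs) * ((cmod qp)\<^sup>2 + (cmod qm)\<^sup>2) + 2 * (gs * ((2 * B) * (gs * (2 * B) + D * (B * B) - 2 * B)))) = complex_of_real 0"
      using F4 by (simp add: nsq)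
    hence "(1 - gs) * ((cmod qp)\<^sup>2 + (cmod qm)\<^sup>2) + 2 * (gs * ((2 * B) * (gs * (2 * B) + D * (B * B) - 2 * B))) = 0"
      by (simp only: of_real_eq_iff)
    thus ?thesis unfolding gbs by algebra
  qed
  have gne: "gs \<noteq> 1"
  proof
    assume g1: "gs = 1"
    hence "4 * (B * B) * (gb - 1) = 0" using F5 by simp
    hence "gb = 1" using Bpos by simp
    hence "D * B = 0" using gbs g1 by simp
    thus False using Dpos Bpos by simp
  qed
  hence gne': "1 - complex_of_real gs \<noteq> 0" by (metis eq_iff_diff_eq_0 of_real_1 of_real_eq_iff)
  have F1': "qz (\<tau> * cnj b1 + (-b2)) (\<tau> * cnj b2 + b1) * cnj qf' = gs * (B * B)" for \<tau>
  proof -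
    have "(1 - complex_of_real gs) * (qz (\<tau> * cnj b1 + (-b2)) (\<tau> * cnj b2 + b1) * cnj qf') = (1 - complex_of_real gs) * (gs * (B * B))"
      using F1[of \<tau>] by simp
    thus ?thesis using gne' mult_left_cancel by blast
  qed
  have nf: "(cmod qf')\<^sup>2 = gs * (B * B)"
  proof -
    have "complex_of_real ((cmod qf')\<^sup>2) = complex_of_real (gs * (B * B))"
      using F1'[of 0] by (simp add: qf'_def[symmetric] nsq)
    thus ?thesis by (simp only: of_real_eq_iff)
  qed
  have qf0: "cnj qf' \<noteq> 0" using qz_f qf'_def by simp
  have qpm: "qp = qf'" "qm = qf'"
  proof -
    have "qp * cnj qf' = qf' * cnj qf'" "qm * cnj qf' = qf' * cnj qf'"
      using F1'[of 1] F1'[of "-1"] F1'[of 0] unfolding qp_def[symmetric] qm_def[symmetric] by (simp_all add: qf'_def[symmetric])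
    thus "qp = qf'" "qm = qf'" using qf0 mult_right_cancel by blast+
  qed
  hence qb0: "qz (cnj b1) (cnj b2) = 0" using par by simp
  have F6: "gs * B = 1 - gb"
  proof -
    have 1: "Dd (cnj b1) (cnj b2) b1 b2 * B = complex_of_real (gs * (B * B))"
      using D_bb unfolding qf'_def[symmetric] nf qb0 by simp
    have "gs * B * (Dd (cnj b1) (cnj b2) b1 b2 * B) + gs * (B * (gb * B - B)) = 0" using F2 qb0 by (simp add: mult_ac)
    hence "complex_of_real (gs * B * (gs * (B * B)) + gs * (B * (gb * B - B))) = complex_of_real 0" unfolding 1 by simp
    hence "gs * B * (gs * (B * B)) + gs * (B * (gb * B - B)) = 0" by (simp only: of_real_eq_iff)
    hence "gs * (B * B) * (gs * B + gb - 1) = 0" by algebra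
    thus ?thesis using pos Bpos by simp
  qed
  have "(1 - gs) * (2 * (gs * (B * B))) + 4 * gs * (B * B) * (gs + gb - 2) = 0" using F5 unfolding qpm nf by algebra
  hence "(2 * gs * (B * B)) * (gs + 2 * gb - 3) = 0" by algebra
  hence F7: "gs = 3 - 2 * gb" using pos Bpos by simp
  have "gb - gs = gs * gb * B" using gbs gg by simp
  hence "gs = gb\<^sup>2" using F6 by algebra
  hence "(gb - 1) * (gb + 3) = 0" using F7 by algebra
  hence "gb = 1" using pos by simp
  thus False using gne F7 by simp
qed

end

lemma (in rank3_system) common_root:
  "\<exists>z1 z2. (z1, z2) \<noteq> (0, 0) \<and> qf q0 q1 0 z1 z2 = 0 \<and> cf c0 c1 c2 c3 z1 z2 = 0"
proof (rule ccontr)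
  assume "\<not> ?thesis"
  hence nr: "\<And>z1 z2. qf q0 q1 0 z1 z2 = 0 \<Longrightarrow> cf c0 c1 c2 c3 z1 z2 = 0 \<Longrightarrow> z1 = 0 \<and> z2 = 0" by auto
  from coprime_form[OF nr] obtain b1 b2 \<rho> j1 j2 :: complex and D :: real where c:
    "c0 = 0" "c1 = - cnj q1 * b1" "c2 = cnj q0 * b1 - cnj q1 * b2" "c3 = cnj q0 * b2" "c3 \<noteq> 0"
    "m0 = 0" "m1 = - \<rho> * cnj q1" "m2 = \<rho> * cnj q0"
    "x0 = j1 - \<rho> * cnj b1 * q0" "x1 = j2 - \<rho> * cnj b1 * q1" "x2 = 0"
    "y0 = - \<rho> * cnj b2 * q0" "y1 = j1 - \<rho> * cnj b2 * q1" "y2 = j2"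
    and D: "D = p * r - (cmod w)\<^sup>2" and w: "w = D * b2 * cnj b1" and e: "p / D + (cmod b2)\<^sup>2 = r / D + (cmod b1)\<^sup>2"
    by blast
  have Dp: "D > 0" using det D by simp
  have ee: "r = p - D * (cmod b1)\<^sup>2 + D * (cmod b2)\<^sup>2"
  proof -
    have "D * (p / D + (cmod b2)\<^sup>2) = D * (r / D + (cmod b1)\<^sup>2)" using e by simp
    thus ?thesis using Dp by (simp add: distrib_left)
  qed
  interpret coprime_system q0 q1 x0 x1 x2 y0 y1 y2 m0 m1 m2 c0 c1 c2 c3 w p r b1 b2 \<rho> j1 j2 D
    "(cmod b1)\<^sup>2 + (cmod b2)\<^sup>2" "p - D * (cmod b1)\<^sup>2" "p - D * (cmod b1)\<^sup>2 + D * ((cmod b1)\<^sup>2 + (cmod b2)\<^sup>2)"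
    apply unfold_locales
    apply (erule nr, assumption)+
    apply (fact c D w ee | simp)+
    done
  show False by (rule contradiction)
qed

section \<open>From three components to a common factor\<close>

text \<open>Three components with a triangular linear part whose squared norm on the sphere is \<open>|1 + q|\<^sup>2\<close> with
\<open>q = qa z1\<^sup>2 + qb z1 z2\<close>.\<close>
locale triangular_map =
  fixes f1 f2 f3 :: bipoly and qa qb :: complex
  assumes cub: "cubic0 f1" "cubic0 f2" "cubic0 f3"
    and tri: "cc f2 1 0 = 0" "cc f3 1 0 = 0" "cc f3 0 1 = 0"
    and sph: "\<And>s t. (cmod s)\<^sup>2 + (cmod t)\<^sup>2 = 1 \<Longrightarrow> gram [f1,f2,f3] (s,t) (s,t) = (1 + qf qa qb 0 s t) * cnj (1 + qf qa qb 0 s t)"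
    and q: "qa \<noteq> 0 \<or> qb \<noteq> 0"
begin

definition "a = cc f1 1 0"
definition "b = cc f1 0 1"
definition "e = cc f2 0 1"

lemma linb: "linb f1 u1 u2 = cnj a * u1 + cnj b * u2" "linb f2 u1 u2 = cnj e * u2" "linb f3 u1 u2 = 0"
  "linp f1 u1 u2 = a * u1 + b * u2" "linp f2 u1 u2 = e * u2" "linp f3 u1 u2 = 0"
  using tri by (simp_all add: linb_def linp_def lf_def a_def b_def e_def)

lemma linear_parts_identity: "cubp f1 z1 z2 * (cnj a * u1 + cnj b * u2) + cubp f2 z1 z2 * (cnj e * u2) = qf qa qb 0 z1 z2 * (z1*u1+z2*u2)"
proof -
  have "\<And>f. f \<in> set [f1,f2,f3] \<Longrightarrow> cubic0 f" using cub by auto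
  from polarized_identities(1)[OF this sph, of z1 z2 u1 u2] show ?thesis by (simp add: linb)
qed

text \<open>The first polarized identity determines the cubic parts of \<open>f1\<close> and \<open>f2\<close>: they are \<open>q z\<close> multiplied by the
inverse adjoint of the linear part.\<close>
lemma cubic1: "cnj a * cubp f1 z1 z2 = qf qa qb 0 z1 z2 * z1" using linear_parts_identity[of z1 z2 1 0] by (simp add: mult.commute)
lemma cubic2: "cnj b * cubp f1 z1 z2 + cnj e * cubp f2 z1 z2 = qf qa qb 0 z1 z2 * z2" using linear_parts_identity[of z1 z2 0 1] by (simp add: mult.commute)

text \<open>Cancellation of the nonzero form \<open>q\<close>.\<close>
lemma q_times: assumes "\<And>t. qf qa qb 0 1 t * (k + l * t) = 0" shows "k = 0" "l = 0"
proof -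
  have "poly ([:qa,qb:] * [:k,l:]) t = 0" for t
    by (rule trans[OF _ assms[of t]]) (simp add: qf_def algebra_simps)
  hence "[:qa,qb:] * [:k,l:] = 0" using poly_all_0_iff_0 by blast
  hence "[:qa,qb:] = 0 \<or> [:k,l:] = 0" by (simp only: mult_eq_0_iff)
  thus "k = 0" "l = 0" using q by auto
qed

lemma a: "a \<noteq> 0"
proof
  assume "a = 0"
  hence "qf qa qb 0 1 t * (1 + 0 * t) = 0" for t using cubic1[of 1 t] by simp
  from q_times(1)[OF this] show False by simp
qed
lemma e: "e \<noteq> 0"
proof
  assume e: "e = 0"
  have "qf qa qb 0 1 t * (- cnj b + cnj a * t) = 0" for t
  proof -
    have 1: "cnj a * cubp f1 1 t = qf qa qb 0 1 t" using cubic1[of 1 t] by simp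
    have 2: "cnj b * cubp f1 1 t = qf qa qb 0 1 t * t" using cubic2[of 1 t] e by simp
    have "qf qa qb 0 1 t * (- cnj b + cnj a * t) = cnj a * (qf qa qb 0 1 t * t) - cnj b * qf qa qb 0 1 t" by (simp add: algebra_simps)
    also have "\<dots> = cnj a * (cnj b * cubp f1 1 t) - cnj b * (cnj a * cubp f1 1 t)" by (simp only: 1 2)
    also have "\<dots> = 0" by simp
    finally show ?thesis .
  qed
  from q_times(2)[OF this] show False using a by simp
qed

text \<open>The quadratic parts of \<open>f1\<close> and \<open>f2\<close> are written as the linear part applied to \<open>J\<close>.\<close>
definition "y0 = cc f2 2 0 / e"
definition "y1 = cc f2 1 1 / e"
definition "y2 = cc f2 0 2 / e"
definition "x0 = (cc f1 2 0 - b * y0) / a"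
definition "x1 = (cc f1 1 1 - b * y1) / a"
definition "x2 = (cc f1 0 2 - b * y2) / a"
definition "m0 = cc f3 2 0"
definition "m1 = cc f3 1 1"
definition "m2 = cc f3 0 2"
definition "c0 = cc f3 3 0"
definition "c1 = cc f3 2 1"
definition "c2 = cc f3 1 2"
definition "c3 = cc f3 0 3"

lemma ye: "cc f2 2 0 = e * y0" "cc f2 1 1 = e * y1" "cc f2 0 2 = e * y2"
  using e by (simp_all add: y0_def y1_def y2_def)
lemma xa: "cc f1 2 0 = a * x0 + b * y0" "cc f1 1 1 = a * x1 + b * y1" "cc f1 0 2 = a * x2 + b * y2"
  using a by (simp_all add: x0_def x1_def x2_def)

lemma quadratic_parts: "quadp f1 s t = a * qf x0 x1 x2 s t + b * qf y0 y1 y2 s t" "quadp f2 s t = e * qf y0 y1 y2 s t" "quadp f3 s t = qf m0 m1 m2 s t"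
  "quadb f1 s t = cnj a * qf (cnj x0) (cnj x1) (cnj x2) s t + cnj b * qf (cnj y0) (cnj y1) (cnj y2) s t"
  "quadb f2 s t = cnj e * qf (cnj y0) (cnj y1) (cnj y2) s t" "quadb f3 s t = qf (cnj m0) (cnj m1) (cnj m2) s t"
  unfolding quadp_def quadb_def ye xa by (simp_all add: qf_def m0_def m1_def m2_def algebra_simps)
lemma cubic3: "cubp f3 s t = cf c0 c1 c2 c3 s t" "cubb f3 s t = cf (cnj c0) (cnj c1) (cnj c2) (cnj c3) s t"
  unfolding cubp_def cubb_def c0_def c1_def c2_def c3_def by simp_all

definition "p = (cmod a)\<^sup>2"
definition "r = (cmod b)\<^sup>2 + (cmod e)\<^sup>2"
definition "w = b * cnj a"

lemma pc: "complex_of_real p = a * cnj a" by (simp add: p_def nsq)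
lemma rc: "complex_of_real r = b * cnj b + e * cnj e" by (simp add: r_def nsq)
lemma wc: "cnj w = cnj b * a" by (simp add: w_def)
lemma det: "p * r - (cmod w)\<^sup>2 = (cmod a)\<^sup>2 * (cmod e)\<^sup>2"
  by (simp add: p_def r_def w_def norm_mult power_mult_distrib algebra_simps)
lemma detc: "complex_of_real (p * r - (cmod w)\<^sup>2) = (a * cnj a) * (e * cnj e)"
  unfolding det by (simp add: nsq)

lemma cubic1_conjugate: "a * cubb f1 u1 u2 = qf (cnj qa) (cnj qb) 0 u1 u2 * u1"
  using arg_cong[OF cubic1[of "cnj u1" "cnj u2"], of cnj] unfolding conjugate_forms(3)[symmetric] complex_cnj_mult complex_cnj_cnj
  by (simp add: conjugate_forms(3)[symmetric] qf_def)
lemma cubic2_conjugate: "b * cubb f1 u1 u2 + e * cubb f2 u1 u2 = qf (cnj qa) (cnj qb) 0 u1 u2 * u2"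
  using arg_cong[OF cubic2[of "cnj u1" "cnj u2"], of cnj]
  by (simp add: conjugate_forms(3)[symmetric] qf_def)

lemma system: "rank3_system qa qb x0 x1 x2 y0 y1 y2 m0 m1 m2 c0 c1 c2 c3 w p r"
proof
  have cs: "\<And>f. f \<in> set [f1,f2,f3] \<Longrightarrow> cubic0 f" using cub by auto
  show "0 < p" using a by (simp add: p_def)
  show "0 < p * r - (cmod w)\<^sup>2" unfolding det using a e by simp
  show "qa \<noteq> 0 \<or> qb \<noteq> 0" by (rule q)
  fix z1 z2 u1 u2 :: complex
  define X where "X = qf x0 x1 x2 z1 z2" define Y where "Y = qf y0 y1 y2 z1 z2"
  define Xb where "Xb = qf (cnj x0) (cnj x1) (cnj x2) u1 u2" define Yb where "Yb = qf (cnj y0) (cnj y1) (cnj y2) u1 u2"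
  define K1 where "K1 = cubp f1 z1 z2" define K2 where "K2 = cubp f2 z1 z2"
  define L1 where "L1 = cubb f1 u1 u2" define L2 where "L2 = cubb f2 u1 u2"
  define Q where "Q = qf qa qb 0 z1 z2" define Qb where "Qb = qf (cnj qa) (cnj qb) 0 u1 u2"
  define M where "M = qf m0 m1 m2 z1 z2" define Mb where "Mb = qf (cnj m0) (cnj m1) (cnj m2) u1 u2"
  define K3 where "K3 = cf c0 c1 c2 c3 z1 z2" define L3 where "L3 = cf (cnj c0) (cnj c1) (cnj c2) (cnj c3) u1 u2"
  have K: "cnj a * K1 = Q * z1" "cnj b * K1 + cnj e * K2 = Q * z2" using cubic1 cubic2 unfolding K1_def K2_def Q_def by auto
  have L: "a * L1 = Qb * u1" "b * L1 + e * L2 = Qb * u2" using cubic1_conjugate cubic2_conjugate unfolding L1_def L2_def Qb_def by auto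
  have I: "K1 * (cnj a * Xb + cnj b * Yb) + (K2 * (cnj e * Yb) + K3 * Mb) + (z1*u1+z2*u2) * ((a * X + b * Y) * (cnj a * u1 + cnj b * u2) + (e * Y) * (cnj e * u2)) = 0"
    using polarized_identities(2)[OF cs sph, of z1 z2 u1 u2]
    by (simp add: linb quadratic_parts cubic3 X_def Y_def Xb_def Yb_def K1_def K2_def K3_def Mb_def)
  have "Q * (z1 * Xb + z2 * Yb) + K3 * Mb + (z1*u1+z2*u2) * (u1 * (a * cnj a * X + b * cnj a * Y) + u2 * (cnj b * a * X + (b * cnj b + e * cnj e) * Y)) = 0"
  proof -
    have "Q * (z1 * Xb + z2 * Yb) = K1 * (cnj a * Xb + cnj b * Yb) + K2 * (cnj e * Yb)" using K by algebra
    thus ?thesis using I by algebra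
  qed
  thus "qf qa qb 0 z1 z2 * (z1 * qf (cnj x0) (cnj x1) (cnj x2) u1 u2 + z2 * qf (cnj y0) (cnj y1) (cnj y2) u1 u2)
     + cf c0 c1 c2 c3 z1 z2 * qf (cnj m0) (cnj m1) (cnj m2) u1 u2
     + (z1*u1+z2*u2) * (u1 * (complex_of_real p * qf x0 x1 x2 z1 z2 + w * qf y0 y1 y2 z1 z2) + u2 * (cnj w * qf x0 x1 x2 z1 z2 + complex_of_real r * qf y0 y1 y2 z1 z2)) = 0"
    unfolding pc rc wc w_def[symmetric] unfolding w_def X_def Y_def Xb_def Yb_def Q_def K3_def Mb_def .
  have II: "K1 * L1 + (K2 * L2 + K3 * L3) + (z1*u1+z2*u2) * ((a * X + b * Y) * (cnj a * Xb + cnj b * Yb) + (e * Y * (cnj e * Yb) + M * Mb) - Q * Qb)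
     + (z1*u1+z2*u2)\<^sup>2 * ((a * z1 + b * z2) * (cnj a * u1 + cnj b * u2) + e * z2 * (cnj e * u2)) - (z1*u1+z2*u2)^3 = 0"
    using polarized_identities(3)[OF cs sph, of z1 z2 u1 u2]
    by (simp add: linb quadratic_parts cubic3 X_def Y_def Xb_def Yb_def K1_def K2_def K3_def Mb_def M_def L1_def L2_def L3_def Q_def Qb_def)
  define Dc where "Dc = (a * cnj a) * (e * cnj e)"
  have D0: "Dc \<noteq> 0" using a e by (simp add: Dc_def)
  have "Dc * (K1 * L1 + K2 * L2) = Q * Qb * ((b * cnj b + e * cnj e) * z1*u1 - b * cnj a*z2*u1 - cnj b * a*z1*u2 + a * cnj a*z2*u2)"
  proof -
    have "Dc * (K1 * L1 + K2 * L2) = (cnj a * K1) * (a * L1) * (e * cnj e) + (a * cnj a) * ((cnj e * K2) * (e * L2))"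
      unfolding Dc_def by algebra
    also have "cnj e * K2 = Q * z2 - cnj b * K1" using K(2) by algebra
    also have "e * L2 = Qb * u2 - b * L1" using L(2) by algebra
    also have "(a * cnj a) * ((Q * z2 - cnj b * K1) * (Qb * u2 - b * L1)) =
      (a * (Q * z2)) * (cnj a * (Qb * u2)) - a * (Q * z2) * b * cnj a * L1 - cnj b * (cnj a * K1) * a * (Qb * u2) + (cnj b * b) * ((cnj a * K1) * (a * L1))"
      by algebra
    also have "a * (Q * z2) * b * cnj a * L1 = (Q * z2) * b * cnj a * (a * L1)" by algebra
    finally show ?thesis unfolding K(1) L(1) by algebra
  qed
  hence KL: "K1 * L1 + K2 * L2 = Q * Qb * (((b * cnj b + e * cnj e) * z1*u1 - b * cnj a*z2*u1 - cnj b * a*z1*u2 + a * cnj a*z2*u2) / Dc)"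
    using D0 by (simp add: field_simps)
  have "Q * Qb * (((b * cnj b + e * cnj e) * z1*u1 - b * cnj a*z2*u1 - cnj b * a*z1*u2 + a * cnj a*z2*u2) / Dc) + K3 * L3
     + (z1*u1+z2*u2) * (Xb * (a * cnj a * X + b * cnj a * Y) + Yb * (cnj b * a * X + (b * cnj b + e * cnj e) * Y) + M * Mb - Q * Qb)
     + (z1*u1+z2*u2)\<^sup>2 * (u1 * (a * cnj a * z1 + b * cnj a * z2) + u2 * (cnj b * a * z1 + (b * cnj b + e * cnj e) * z2)) - (z1*u1+z2*u2)^3 = 0"
    unfolding KL[symmetric] using II by algebra
  thus "qf qa qb 0 z1 z2 * qf (cnj qa) (cnj qb) 0 u1 u2 *
        ((complex_of_real r*z1*u1 - w*z2*u1 - cnj w*z1*u2 + complex_of_real p*z2*u2) / complex_of_real (p * r - (cmod w)\<^sup>2))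
     + cf c0 c1 c2 c3 z1 z2 * cf (cnj c0) (cnj c1) (cnj c2) (cnj c3) u1 u2
     + (z1*u1+z2*u2) * (qf (cnj x0) (cnj x1) (cnj x2) u1 u2 * (complex_of_real p * qf x0 x1 x2 z1 z2 + w * qf y0 y1 y2 z1 z2)
         + qf (cnj y0) (cnj y1) (cnj y2) u1 u2 * (cnj w * qf x0 x1 x2 z1 z2 + complex_of_real r * qf y0 y1 y2 z1 z2)
         + qf m0 m1 m2 z1 z2 * qf (cnj m0) (cnj m1) (cnj m2) u1 u2 - qf qa qb 0 z1 z2 * qf (cnj qa) (cnj qb) 0 u1 u2)
     + (z1*u1+z2*u2)\<^sup>2 * (u1*(complex_of_real p*z1 + w*z2) + u2*(cnj w*z1 + complex_of_real r*z2)) - (z1*u1+z2*u2)^3 = 0"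
    unfolding detc pc rc wc Dc_def[symmetric] unfolding w_def X_def Y_def Xb_def Yb_def Q_def Qb_def M_def Mb_def K3_def L3_def .
qed

text \<open>A common root of \<open>q\<close> and of the cubic part of the third component is a root of the cubic parts of the
other two, because these are multiples of \<open>q\<close>.\<close>
lemma common_cubic_root:
  "\<exists>s t. (s, t) \<noteq> (0,0) \<and> qf qa qb 0 s t = 0 \<and> cubp f1 s t = 0 \<and> cubp f2 s t = 0 \<and> cubp f3 s t = 0"
proof -
  interpret rank3_system qa qb x0 x1 x2 y0 y1 y2 m0 m1 m2 c0 c1 c2 c3 w p r by (rule system)
  obtain s t where st: "(s, t) \<noteq> (0,0)" "qf qa qb 0 s t = 0" "cf c0 c1 c2 c3 s t = 0" using common_root by blast
  have "cubp f1 s t = 0" using cubic1[of s t] st(2) a by simp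
  moreover from this have "cubp f2 s t = 0" using cubic2[of s t] st(2) e by simp
  ultimately show ?thesis using st cubic3 by metis
qed

text \<open>The two alternatives for the coefficients are translated back: the components are multiples of
\<open>1 + q\<close>, or they vanish on a line on which \<open>1 + q\<close> vanishes.\<close>
lemma components_share_factor:
  assumes "cubp f3 0 1 = 0"
  shows "(\<exists>k l. \<forall>s t. bieval f1 (s,t) = k * s * (1 + qf qa qb 0 s t) \<and> bieval f2 (s,t) = l * t * (1 + qf qa qb 0 s t) \<and> bieval f3 (s,t) = 0)
    \<or> (qb = 0 \<and> (\<exists>T. qa * T\<^sup>2 = -1 \<and> (\<forall>v. bieval f1 (T,v) = 0 \<and> bieval f2 (T,v) = 0 \<and> bieval f3 (T,v) = 0)))"
proof -
  have c3: "c3 = 0" using assms by (simp add: cubic3 cf_def)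
  interpret rank3_system qa qb x0 x1 x2 y0 y1 y2 m0 m1 m2 c0 c1 c2 c3 w p r by (rule system)
  interpret shared_root_system qa qb x0 x1 x2 y0 y1 y2 m0 m1 m2 c0 c1 c2 c3 w p r by unfold_locales (rule c3)
  have ev: "bieval f1 (s,t) = a * (s + qf x0 x1 x2 s t) + b * (t + qf y0 y1 y2 s t) + cubp f1 s t"
    "bieval f2 (s,t) = e * (t + qf y0 y1 y2 s t) + cubp f2 s t"
    "bieval f3 (s,t) = qf m0 m1 m2 s t + cf c0 c1 c2 c3 s t" for s t
    using cub by (simp_all add: bieval_cubic0 linb quadratic_parts cubic3 algebra_simps)
  have ca: "cnj a \<noteq> 0" "cnj e \<noteq> 0" using a e by simp_all
  from common_factor show ?thesis
  proof
    assume A: "p = 1 \<and> r = 1 \<and> w = 0 \<and> x0 = 0 \<and> x1 = 0 \<and> y0 = 0 \<and> y1 = 0 \<and> m0 = 0 \<and> m1 = 0 \<and> m2 = 0 \<and> c0 = 0 \<and> c1 = 0 \<and> c2 = 0"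
    hence aa: "a * cnj a = 1" and ee: "b * cnj b + e * cnj e = 1" using pc rc by simp_all
    have b: "b = 0" using A w_def a by simp
    have K1: "cubp f1 s t = a * (qf qa qb 0 s t * s)" for s t
      using aa cubic1[of s t] by algebra
    have K2: "cubp f2 s t = e * (qf qa qb 0 s t * t)" for s t
      using ee cubic2[of s t] unfolding b by simp algebra
    have z: "qf 0 0 0 s t = 0" "cf 0 0 0 0 s t = 0" for s t by (simp_all add: qf_def cf_def)
    have "bieval f1 (s,t) = a * s * (1 + qf qa qb 0 s t)" "bieval f2 (s,t) = e * t * (1 + qf qa qb 0 s t)" "bieval f3 (s,t) = 0" for s t
      unfolding ev K1 K2 using A xy2 c3 b z by (simp_all add: algebra_simps)
    thus ?thesis by blast
  next
    assume "qb = 0 \<and> (\<exists>T. qa * T\<^sup>2 = -1 \<and> (\<forall>v::complex.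
      T + qf x0 x1 x2 T v = (complex_of_real r*T - w* v) / complex_of_real (p*r-(cmod w)\<^sup>2) \<and>
      v + qf y0 y1 y2 T v = (-cnj w*T + complex_of_real p* v) / complex_of_real (p*r-(cmod w)\<^sup>2) \<and>
      qf m0 m1 m2 T v + cf c0 c1 c2 c3 T v = 0))"
    then obtain T where qb: "qb = 0" and T: "qa * T\<^sup>2 = -1" and V: "\<And>v. T + qf x0 x1 x2 T v = (complex_of_real r*T - w* v) / complex_of_real (p*r-(cmod w)\<^sup>2) \<and>
      v + qf y0 y1 y2 T v = (-cnj w*T + complex_of_real p* v) / complex_of_real (p*r-(cmod w)\<^sup>2) \<and>
      qf m0 m1 m2 T v + cf c0 c1 c2 c3 T v = 0" by blast
    have "bieval f1 (T,v) = 0 \<and> bieval f2 (T,v) = 0 \<and> bieval f3 (T,v) = 0" for v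
    proof -
      define Dc where "Dc = (a * cnj a) * (e * cnj e)"
      have D0: "Dc \<noteq> 0" using a e by (simp add: Dc_def)
      have qT: "qf qa qb 0 T v = -1" using T qb by (simp add: qf_def)
      have k1: "cnj a * cubp f1 T v = - T" using cubic1[of T v] qT by simp
      have k2: "cnj b * cubp f1 T v + cnj e * cubp f2 T v = - v" using cubic2[of T v] qT by simp
      have vx: "Dc * (T + qf x0 x1 x2 T v) = (b * cnj b + e * cnj e) * T - b * cnj a * v"
        using V[of v] D0 unfolding detc rc w_def[symmetric] Dc_def[symmetric] by (simp add: w_def)
      have vy: "Dc * (v + qf y0 y1 y2 T v) = - (cnj b * a) * T + a * cnj a * v"
        using V[of v] D0 unfolding detc pc wc Dc_def[symmetric] by simp
      have "cnj a * Dc * bieval f1 (T,v) = a * cnj a * (Dc * (T + qf x0 x1 x2 T v)) + b * cnj a * (Dc * (v + qf y0 y1 y2 T v)) + Dc * (cnj a * cubp f1 T v)"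
        unfolding ev by (simp add: algebra_simps)
      also have "\<dots> = 0" unfolding vx vy k1 unfolding Dc_def by algebra
      finally have f1: "bieval f1 (T,v) = 0" using D0 ca by simp
      have "cnj a * cnj e * Dc * bieval f2 (T,v) = cnj a * e * cnj e * (Dc * (v + qf y0 y1 y2 T v)) + Dc * (cnj a * (cnj b * cubp f1 T v + cnj e * cubp f2 T v)) - Dc * cnj b * (cnj a * cubp f1 T v)"
        unfolding ev by (simp add: algebra_simps)
      also have "\<dots> = 0" unfolding vy k1 k2 unfolding Dc_def by algebra
      finally have f2: "bieval f2 (T,v) = 0" using D0 ca by simp
      show ?thesis using f1 f2 ev(3) V[of v] by simp
    qed
    thus ?thesis using T qb by blast
  qed
qed

end

text \<open>The substitution of \<open>(\<alpha> s + \<beta> t, \<gamma> s + \<delta> t)\<close> for \<open>(s, t)\<close>, in coefficients.\<close>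
definition subst_linear :: "complex \<Rightarrow> complex \<Rightarrow> complex \<Rightarrow> complex \<Rightarrow> bipoly \<Rightarrow> bipoly" where
  "subst_linear \<alpha> \<beta> \<gamma> \<delta> p = bp (linp p \<alpha> \<gamma>) (linp p \<beta> \<delta>)
     (quadp p \<alpha> \<gamma>) (2 * cc p 2 0 * \<alpha> * \<beta> + cc p 1 1 * (\<alpha> * \<delta> + \<beta> * \<gamma>) + 2 * cc p 0 2 * \<gamma> * \<delta>) (quadp p \<beta> \<delta>)
     (cubp p \<alpha> \<gamma>)
     (3 * cc p 3 0 * \<alpha>\<^sup>2 * \<beta> + cc p 2 1 * (\<alpha>\<^sup>2 * \<delta> + 2 * \<alpha> * \<beta> * \<gamma>) + cc p 1 2 * (\<beta> * \<gamma>\<^sup>2 + 2 * \<alpha> * \<gamma> * \<delta>) + 3 * cc p 0 3 * \<gamma>\<^sup>2 * \<delta>)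
     (3 * cc p 3 0 * \<alpha> * \<beta>\<^sup>2 + cc p 2 1 * (2 * \<alpha> * \<beta> * \<delta> + \<beta>\<^sup>2 * \<gamma>) + cc p 1 2 * (\<alpha> * \<delta>\<^sup>2 + 2 * \<beta> * \<gamma> * \<delta>) + 3 * cc p 0 3 * \<gamma> * \<delta>\<^sup>2)
     (cubp p \<beta> \<delta>)"

lemma forms_bp:
  "linp (bp a10 a01 a20 a11 a02 a30 a21 a12 a03) = lf a10 a01"
  "quadp (bp a10 a01 a20 a11 a02 a30 a21 a12 a03) = qf a20 a11 a02"
  "cubp (bp a10 a01 a20 a11 a02 a30 a21 a12 a03) = cf a30 a21 a12 a03"
  by (simp_all add: linp_def quadp_def cubp_def cc_bp)

lemma forms_subst_linear:
  "linp (subst_linear \<alpha> \<beta> \<gamma> \<delta> p) s t = linp p (\<alpha> * s + \<beta> * t) (\<gamma> * s + \<delta> * t)"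
  "quadp (subst_linear \<alpha> \<beta> \<gamma> \<delta> p) s t = quadp p (\<alpha> * s + \<beta> * t) (\<gamma> * s + \<delta> * t)"
  "cubp (subst_linear \<alpha> \<beta> \<gamma> \<delta> p) s t = cubp p (\<alpha> * s + \<beta> * t) (\<gamma> * s + \<delta> * t)"
  unfolding subst_linear_def forms_bp
  by (simp_all add: linp_def quadp_def cubp_def lf_def qf_def cf_def power2_eq_square power3_eq_cube algebra_simps)

lemma cubic0_subst_linear: "cubic0 (subst_linear \<alpha> \<beta> \<gamma> \<delta> p)" unfolding subst_linear_def by (rule cubic0_bp)

lemma bieval_subst_linear: "cubic0 p \<Longrightarrow> bieval (subst_linear \<alpha> \<beta> \<gamma> \<delta> p) (s,t) = bieval p (\<alpha> * s + \<beta> * t, \<gamma> * s + \<delta> * t)"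
  by (simp add: bieval_cubic0 cubic0_subst_linear forms_subst_linear)

lemma functional_cubp: "functional (\<lambda>p. cubp p s t)"
  by unfold_locales (simp_all add: cubp_def cf_def algebra_simps)
lemma functional_bieval: "functional (\<lambda>p. bieval p z)"
  by unfold_locales (simp_all add: bieval_add bieval_smult)

lemma cubic0_span: "\<forall>p\<in>S. cubic0 p \<Longrightarrow> p \<in> bipoly.span S \<Longrightarrow> cubic0 p"
  using bipoly.span_minimal[OF _ cubic0_subspace, of S] by auto

text \<open>Two elimination steps, for the coefficient of \<open>z1\<close> and for that of \<open>z2\<close>.\<close>
lemma triangular_form:
  assumes len: "length F = 3" and cub: "\<forall>f\<in>set F. cubic0 f"
  obtains f1 f2 f3 where "gram [f1,f2,f3] = gram F" "bipoly.span {f1,f2,f3} = bipoly.span (set F)"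
    "cc f2 1 0 = 0" "cc f3 1 0 = 0" "cc f3 0 1 = 0" "cubic0 f1" "cubic0 f2" "cubic0 f3"
proof -
  interpret A: functional "\<lambda>p. cc p 1 0" by (rule functional_cc)
  interpret B: functional "\<lambda>p. cc p 0 1" by (rule functional_cc)
  have "F \<noteq> []" using len by auto
  from A.gram_reduce[OF this] obtain f1 Q where Q: "length F = Suc (length Q)" "\<forall>q\<in>set Q. cc q 1 0 = 0" "gram (f1 # Q) = gram F"
    "bipoly.span (set (f1 # Q)) = bipoly.span (set F)" by blast
  have "Q \<noteq> []" using Q(1) len by auto
  from B.gram_reduce[OF this] obtain f2 R where R: "length Q = Suc (length R)" "\<forall>q\<in>set R. cc q 0 1 = 0" "gram (f2 # R) = gram Q"
    "bipoly.span (set (f2 # R)) = bipoly.span (set Q)" by blast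
  obtain f3 where f3: "R = [f3]" using Q(1) R(1) len by (cases R) auto
  have g: "gram [f1,f2,f3] = gram F" using Q(3) R(3) f3 by (auto simp: gram_def fun_eq_iff)
  have s: "bipoly.span {f1,f2,f3} = bipoly.span (set F)"
    using R(4) f3 unfolding Q(4)[symmetric] by (simp add: bipoly.span_insert)
  have "f2 \<in> bipoly.span (set Q)" "f3 \<in> bipoly.span (set Q)" unfolding R(4)[symmetric] f3 by (auto intro: bipoly.span_base)
  hence z: "cc f2 1 0 = 0" "cc f3 1 0 = 0" using A.span_zero[of "set Q"] Q(2) by blast+
  have "f1 \<in> bipoly.span {f1,f2,f3}" "f2 \<in> bipoly.span {f1,f2,f3}" "f3 \<in> bipoly.span {f1,f2,f3}"
    by (auto intro: bipoly.span_base)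
  hence "cubic0 f1" "cubic0 f2" "cubic0 f3" unfolding s using cubic0_span cub by blast+
  thus ?thesis using that g s z R(2) f3 by simp
qed

text \<open>The unitary substitution sends \<open>(0,1)\<close> to the root \<open>(d1, d2)\<close> of \<open>q\<close>, which removes the coefficient of
\<open>z2\<^sup>2\<close>. The formula for \<open>qb\<close> tells later when the root is double.\<close>
lemma rotated_form:
  fixes s1 s2 d1 d2 :: complex
  assumes len: "length F = 3" and cub: "\<forall>f\<in>set F. cubic0 f"
    and sph: "\<And>s t. (cmod s)\<^sup>2 + (cmod t)\<^sup>2 = 1 \<Longrightarrow> gram F (s,t) (s,t) = (1 + qf s1 0 s2 s t) * cnj (1 + qf s1 0 s2 s t)"
    and d: "(cmod d1)\<^sup>2 + (cmod d2)\<^sup>2 = 1" and root: "qf s1 0 s2 d1 d2 = 0" and nz: "s1 \<noteq> 0"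
  obtains f1 f2 f3 qa qb where "triangular_map f1 f2 f3 qa qb"
    "\<And>s t. qf qa qb 0 s t = qf s1 0 s2 (cnj d2 * s + d1 * t) (- cnj d1 * s + d2 * t)"
    "bipoly.span {f1,f2,f3} = bipoly.span (subst_linear (cnj d2) d1 (- cnj d1) d2 ` set F)"
    "qb = 2 * s1 * cnj d2 * d1 - 2 * s2 * cnj d1 * d2"
proof -
  define U where "U = subst_linear (cnj d2) d1 (- cnj d1) d2"
  have "length (map U F) = 3" "\<forall>f\<in>set (map U F). cubic0 f" using len by (auto simp: U_def cubic0_subst_linear)
  then obtain f1 f2 f3 where f: "gram [f1,f2,f3] = gram (map U F)" "bipoly.span {f1,f2,f3} = bipoly.span (set (map U F))"
    "cc f2 1 0 = 0" "cc f3 1 0 = 0" "cc f3 0 1 = 0" "cubic0 f1" "cubic0 f2" "cubic0 f3" by (rule triangular_form)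
  have dc: "d1 * cnj d1 + d2 * cnj d2 = 1" using d by (simp add: nsq flip: of_real_add of_real_power)
  define qa where "qa = qf s1 0 s2 (cnj d2) (- cnj d1)"
  define qb where "qb = 2 * s1 * cnj d2 * d1 - 2 * s2 * cnj d1 * d2"
  have q: "qf qa qb 0 s t = qf s1 0 s2 (cnj d2 * s + d1 * t) (- cnj d1 * s + d2 * t)" for s t
  proof -
    have "qf s1 0 s2 (cnj d2 * s + d1 * t) (- cnj d1 * s + d2 * t) = qf qa qb 0 s t + qf s1 0 s2 d1 d2 * t\<^sup>2"
      by (simp add: qa_def qb_def qf_def power2_eq_square algebra_simps)
    thus ?thesis using root by simp
  qed
  have qnz: "qa \<noteq> 0 \<or> qb \<noteq> 0"
  proof (rule ccontr)
    assume "\<not> ?thesis"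
    hence "qf s1 0 s2 (cnj d2 * d2 + d1 * cnj d1) (- cnj d1 * d2 + d2 * cnj d1) = 0" unfolding q[symmetric] by (simp add: qf_def)
    moreover have "cnj d2 * d2 + d1 * cnj d1 = 1" using dc by (simp add: algebra_simps)
    ultimately show False using nz by (simp add: qf_def)
  qed
  have "triangular_map f1 f2 f3 qa qb"
  proof
    fix s t :: complex assume st: "(cmod s)\<^sup>2 + (cmod t)\<^sup>2 = 1"
    define S where "S = cnj d2 * s + d1 * t" define T where "T = - cnj d1 * s + d2 * t"
    have "S * cnj S + T * cnj T = (d1 * cnj d1 + d2 * cnj d2) * (s * cnj s + t * cnj t)"
      by (simp add: S_def T_def algebra_simps)
    also have "\<dots> = complex_of_real 1" using dc st by (simp add: nsq flip: of_real_add of_real_power)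
    finally have "complex_of_real ((cmod S)\<^sup>2 + (cmod T)\<^sup>2) = complex_of_real 1" by (simp add: nsq)
    hence ST: "(cmod S)\<^sup>2 + (cmod T)\<^sup>2 = 1" by (simp only: of_real_eq_iff)
    have "gram (map U F) (s,t) (s,t) = gram F (S,T) (S,T)"
      unfolding gram_def map_map comp_def
      by (intro arg_cong[of _ _ sum_list] map_cong refl) (use cub in \<open>simp add: U_def bieval_subst_linear S_def T_def\<close>)
    thus "gram [f1,f2,f3] (s,t) (s,t) = (1 + qf qa qb 0 s t) * cnj (1 + qf qa qb 0 s t)"
      unfolding f(1) q S_def[symmetric] T_def[symmetric] using sph[OF ST] by simp
  qed (use f qnz in auto)
  thus ?thesis using that q f(2) unfolding U_def qb_def by simp
qed

text \<open>Two rotations are needed. The first one moves an arbitrary root of \<open>q\<close> to \<open>(0,1)\<close> and yields a root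
common to \<open>q\<close> and to all cubic parts; the second one moves that root to \<open>(0,1)\<close>. The conclusions are then
carried back to the given coordinates. In the second alternative \<open>q\<close> has a double root, which for a
diagonal form means \<open>s2 = 0\<close>.\<close>
lemma three_components_share_factor:
  fixes s1 s2 :: real
  assumes len: "length F = 3" and cub: "\<forall>f\<in>set F. cubic0 f"
    and sph: "\<And>s t. (cmod s)\<^sup>2 + (cmod t)\<^sup>2 = 1 \<Longrightarrow> gram F (s,t) (s,t) = (1 + qf s1 0 s2 s t) * cnj (1 + qf s1 0 s2 s t)"
    and s: "0 \<le> s2" "s2 \<le> s1" "0 < s1"
  shows "(\<forall>f\<in>set F. \<exists>k l. \<forall>s t. bieval f (s,t) = (k * s + l * t) * (1 + qf s1 0 s2 s t)) \<or>
    (s2 = 0 \<and> (\<exists>T. complex_of_real s1 * T\<^sup>2 = -1 \<and> (\<forall>f\<in>set F. \<forall>v. bieval f (T,v) = 0)))"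
proof -
  have s1c: "complex_of_real s1 \<noteq> 0" using s by simp
  \<comment> \<open>a unit vector at which \<open>s1 d1\<^sup>2 + s2 d2\<^sup>2\<close> vanishes\<close>
  define d1 where "d1 = \<i> * sqrt (s2 / (s1 + s2))"
  define d2 where "d2 = complex_of_real (sqrt (s1 / (s1 + s2)))"
  have "(cmod d1)\<^sup>2 + (cmod d2)\<^sup>2 = 1" using s by (simp add: d1_def d2_def norm_mult add_divide_distrib[symmetric])
  moreover have "qf s1 0 s2 d1 d2 = 0"
  proof -
    have "d1\<^sup>2 = - complex_of_real (s2 / (s1 + s2))" "d2\<^sup>2 = complex_of_real (s1 / (s1 + s2))"
      using s by (simp_all add: d1_def d2_def power_mult_distrib flip: of_real_power)
    thus ?thesis by (simp add: qf_def mult.commute)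
  qed
  ultimately obtain f1 f2 f3 qa qb where f: "triangular_map f1 f2 f3 qa qb"
    "\<And>s t. qf qa qb 0 s t = qf s1 0 s2 (cnj d2 * s + d1 * t) (- cnj d1 * s + d2 * t)"
    "bipoly.span {f1,f2,f3} = bipoly.span (subst_linear (cnj d2) d1 (- cnj d1) d2 ` set F)"
    using rotated_form[OF len cub sph _ _ s1c] by metis
  interpret A: triangular_map f1 f2 f3 qa qb by (rule f(1))
  obtain u v where uv: "(u,v) \<noteq> (0,0)" "qf qa qb 0 u v = 0" "cubp f1 u v = 0" "cubp f2 u v = 0" "cubp f3 u v = 0"
    using A.common_cubic_root by blast
  define e1 where "e1 = cnj d2 * u + d1 * v"
  define e2 where "e2 = - cnj d1 * u + d2 * v"
  have dd: "d1 * cnj d1 + d2 * cnj d2 = 1" using \<open>(cmod d1)\<^sup>2 + (cmod d2)\<^sup>2 = 1\<close> by (simp add: nsq flip: of_real_add of_real_power)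
  have inv: "u = d2 * e1 - d1 * e2" "v = cnj d1 * e1 + cnj d2 * e2"
    unfolding e1_def e2_def using dd by algebra+
  have e_nz: "(e1,e2) \<noteq> (0,0)" using uv(1) inv by auto
  have eq0: "qf s1 0 s2 e1 e2 = 0" using uv(2) unfolding f(2) e1_def e2_def .
  have ec: "cubp g e1 e2 = 0" if "g \<in> set F" for g
  proof -
    interpret functional "\<lambda>p. cubp p u v" by (rule functional_cubp)
    have "subst_linear (cnj d2) d1 (- cnj d1) d2 g \<in> bipoly.span {f1,f2,f3}"
      unfolding f(3) using that by (intro bipoly.span_base) auto
    hence "cubp (subst_linear (cnj d2) d1 (- cnj d1) d2 g) u v = 0"
      using span_zero[of "{f1,f2,f3}"] uv by auto
    thus ?thesis unfolding forms_subst_linear e1_def e2_def .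
  qed
  \<comment> \<open>the common root in the given coordinates is scaled to norm one, so that it can be moved by a rotation\<close>
  define n where "n = sqrt ((cmod e1)\<^sup>2 + (cmod e2)\<^sup>2)"
  have n2: "n\<^sup>2 = (cmod e1)\<^sup>2 + (cmod e2)\<^sup>2" by (simp add: n_def)
  have n0: "n \<noteq> 0" using e_nz unfolding n_def by (auto simp: sum_power2_eq_zero_iff)
  define c1 where "c1 = inverse (complex_of_real n) * e1"
  define c2 where "c2 = inverse (complex_of_real n) * e2"
  have "(cmod c1)\<^sup>2 + (cmod c2)\<^sup>2 = inverse (n\<^sup>2) * ((cmod e1)\<^sup>2 + (cmod e2)\<^sup>2)"
    by (simp add: c1_def c2_def norm_mult norm_inverse power_mult_distrib power_inverse distrib_left)
  hence cn: "(cmod c1)\<^sup>2 + (cmod c2)\<^sup>2 = 1" unfolding n2[symmetric] using n0 by simp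
  have cq: "qf s1 0 s2 c1 c2 = 0" unfolding c1_def c2_def homogeneous eq0 by simp
  have cc: "cubp g c1 c2 = 0" if "g \<in> set F" for g unfolding c1_def c2_def homogeneous ec[OF that] by simp
  obtain g1 g2 g3 ra rb where g: "triangular_map g1 g2 g3 ra rb"
    "\<And>s t. qf ra rb 0 s t = qf s1 0 s2 (cnj c2 * s + c1 * t) (- cnj c1 * s + c2 * t)"
    "bipoly.span {g1,g2,g3} = bipoly.span (subst_linear (cnj c2) c1 (- cnj c1) c2 ` set F)"
    "rb = 2 * complex_of_real s1 * cnj c2 * c1 - 2 * complex_of_real s2 * cnj c1 * c2"
    using rotated_form[OF len cub sph cn cq s1c] by metis
  interpret B: triangular_map g1 g2 g3 ra rb by (rule g(1))
  have ccc: "c1 * cnj c1 + c2 * cnj c2 = 1" using cn by (simp add: nsq flip: of_real_add of_real_power)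
  have "cubp g3 0 1 = 0"
  proof -
    interpret functional "\<lambda>p. cubp p 0 1" by (rule functional_cubp)
    have "g3 \<in> bipoly.span (subst_linear (cnj c2) c1 (- cnj c1) c2 ` set F)"
      unfolding g(3)[symmetric] by (auto intro: bipoly.span_base)
    moreover have "cubp h 0 1 = 0" if "h \<in> subst_linear (cnj c2) c1 (- cnj c1) c2 ` set F" for h
      using that cc by (auto simp: forms_subst_linear)
    ultimately show ?thesis using span_zero by blast
  qed
  from B.components_share_factor[OF this] show ?thesis
  proof
    assume "\<exists>k l. \<forall>s t. bieval g1 (s,t) = k * s * (1 + qf ra rb 0 s t) \<and> bieval g2 (s,t) = l * t * (1 + qf ra rb 0 s t) \<and> bieval g3 (s,t) = 0"
    then obtain k l where kl: "\<And>s t. bieval g1 (s,t) = k * s * (1 + qf ra rb 0 s t)" "\<And>s t. bieval g2 (s,t) = l * t * (1 + qf ra rb 0 s t)" "\<And>s t. bieval g3 (s,t) = 0"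
      by blast
    define E where "E = {h. \<exists>k l. \<forall>s t. bieval h (s,t) = (k * s + l * t) * (1 + qf ra rb 0 s t)}"
    have "bipoly.subspace E" unfolding bipoly.subspace_def
    proof (intro conjI ballI allI)
      show "0 \<in> E" unfolding E_def by (auto simp: bieval_zero intro!: exI[of _ 0])
      fix x y assume "x \<in> E" "y \<in> E"
      then obtain k l k' l' where "\<And>s t. bieval x (s,t) = (k * s + l * t) * (1 + qf ra rb 0 s t)" "\<And>s t. bieval y (s,t) = (k' * s + l' * t) * (1 + qf ra rb 0 s t)"
        unfolding E_def by blast
      thus "x + y \<in> E" unfolding E_def mem_Collect_eq by (intro exI[of _ "k + k'"] exI[of _ "l + l'"]) (simp add: bieval_add algebra_simps)
    next
      fix c x assume "x \<in> E"
      then obtain k l where "\<And>s t. bieval x (s,t) = (k * s + l * t) * (1 + qf ra rb 0 s t)" unfolding E_def by blast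
      thus "smult [:c:] x \<in> E" unfolding E_def mem_Collect_eq by (intro exI[of _ "c * k"] exI[of _ "c * l"]) (simp add: bieval_smult algebra_simps)
    qed
    moreover have "bieval g1 (s,t) = (k * s + 0 * t) * (1 + qf ra rb 0 s t)" "bieval g2 (s,t) = (0 * s + l * t) * (1 + qf ra rb 0 s t)"
      "bieval g3 (s,t) = (0 * s + 0 * t) * (1 + qf ra rb 0 s t)" for s t using kl by simp_all
    hence "g1 \<in> E" "g2 \<in> E" "g3 \<in> E" unfolding E_def by blast+
    ultimately have sub: "bipoly.span {g1,g2,g3} \<subseteq> E" by (intro bipoly.span_minimal) auto
    have "\<exists>k l. \<forall>s t. bieval f (s,t) = (k * s + l * t) * (1 + qf s1 0 s2 s t)" if f: "f \<in> set F" for f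
    proof -
      have "subst_linear (cnj c2) c1 (- cnj c1) c2 f \<in> E"
      proof -
        have "subst_linear (cnj c2) c1 (- cnj c1) c2 f \<in> bipoly.span (subst_linear (cnj c2) c1 (- cnj c1) c2 ` set F)"
          using f by (intro bipoly.span_base) auto
        thus ?thesis using sub unfolding g(3) by auto
      qed
      then obtain k l where K: "\<And>s t. bieval (subst_linear (cnj c2) c1 (- cnj c1) c2 f) (s,t) = (k * s + l * t) * (1 + qf ra rb 0 s t)" unfolding E_def by blast
      have "bieval f (s,t) = ((k * c2 + l * cnj c1) * s + (l * cnj c2 - k * c1) * t) * (1 + qf s1 0 s2 s t)" for s t
      proof -
        have 1: "cnj c2 * (c2 * s - c1 * t) + c1 * (cnj c1 * s + cnj c2 * t) = s" "- cnj c1 * (c2 * s - c1 * t) + c2 * (cnj c1 * s + cnj c2 * t) = t"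
          using ccc by algebra+
        have "bieval f (s,t) = bieval (subst_linear (cnj c2) c1 (- cnj c1) c2 f) (c2 * s - c1 * t, cnj c1 * s + cnj c2 * t)"
          using cub f by (subst bieval_subst_linear) (auto simp only: 1)
        also have "\<dots> = (k * (c2 * s - c1 * t) + l * (cnj c1 * s + cnj c2 * t)) * (1 + qf s1 0 s2 s t)"
          unfolding K g(2) 1 ..
        finally show ?thesis by (simp add: algebra_simps)
      qed
      thus ?thesis by blast
    qed
    thus ?thesis by blast
  next
    assume "rb = 0 \<and> (\<exists>T. ra * T\<^sup>2 = -1 \<and> (\<forall>v. bieval g1 (T,v) = 0 \<and> bieval g2 (T,v) = 0 \<and> bieval g3 (T,v) = 0))"
    then obtain T where rb: "rb = 0" and T: "ra * T\<^sup>2 = -1" and V: "\<And>v. bieval g1 (T,v) = 0" "\<And>v. bieval g2 (T,v) = 0" "\<And>v. bieval g3 (T,v) = 0" by blast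
    have s2: "s2 = 0"
    proof (rule ccontr)
      assume "s2 \<noteq> 0"
      hence s2c: "complex_of_real s2 \<noteq> 0" by simp
      have q: "s1 * c1\<^sup>2 + s2 * c2\<^sup>2 = 0" using cq by (simp add: qf_def)
      have "2 * (s1 * cnj c2 * c1 - s2 * cnj c1 * c2) = 0" using g(4) rb by (simp add: algebra_simps)
      hence r: "s1 * cnj c2 * c1 = s2 * cnj c1 * c2" by simp
      have "s2 * c2 * (c1 * cnj c1 + c2 * cnj c2) = c1 * (s2 * cnj c1 * c2) + cnj c2 * (s2 * c2\<^sup>2)"
        by (simp add: power2_eq_square algebra_simps)
      also have "\<dots> = cnj c2 * (s1 * c1\<^sup>2 + s2 * c2\<^sup>2)" unfolding r[symmetric] by (simp add: power2_eq_square algebra_simps)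
      finally have c2: "c2 = 0" using q ccc s2c by simp
      hence "c1 = 0" using q s1c by simp
      thus False using c2 ccc by simp
    qed
    have c1: "c1 = 0" using cq s2 s1c by (simp add: qf_def)
    hence c2: "c2 * cnj c2 = 1" using ccc by simp
    have "s1 * (cnj c2 * T)\<^sup>2 = -1"
    proof -
      have "qf ra rb 0 T 0 = qf s1 0 s2 (cnj c2 * T) 0" unfolding g(2) c1 by simp
      thus ?thesis using T rb by (simp add: qf_def)
    qed
    moreover have "bieval f (cnj c2 * T, v) = 0" if f: "f \<in> set F" for f v
    proof -
      interpret functional "\<lambda>p. bieval p (T, cnj c2 * v)" by (rule functional_bieval)
      have "subst_linear (cnj c2) c1 (- cnj c1) c2 f \<in> bipoly.span {g1,g2,g3}" unfolding g(3) using f by (intro bipoly.span_base) auto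
      hence "bieval (subst_linear (cnj c2) c1 (- cnj c1) c2 f) (T, cnj c2 * v) = 0" using span_zero[of "{g1,g2,g3}"] V by auto
      moreover have "c2 * (cnj c2 * v) = v" using c2 by (simp flip: mult.assoc)
      ultimately show ?thesis using cub f by (simp add: bieval_subst_linear c1)
    qed
    ultimately show ?thesis using s2 by blast
  qed
qed

section \<open>Bounds for the minimal target dimension\<close>

lemma bieval_denom_qf: "bieval (denom \<sigma>) (s,t) = 1 + qf (of_real (fst \<sigma>)) 0 (of_real (snd \<sigma>)) s t"
  by (simp add: bieval_denom qf_def)

lemma cubic_map_facts:
  assumes "reduced_pointed_cubic_sphere_map P (denom \<sigma>)"
  shows "\<forall>p\<in>set P. cubic0 p"
    "\<And>s t. (cmod s)\<^sup>2 + (cmod t)\<^sup>2 = 1 \<Longrightarrow> gram P (s,t) (s,t) =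
       (1 + qf (of_real (fst \<sigma>)) 0 (of_real (snd \<sigma>)) s t) * cnj (1 + qf (of_real (fst \<sigma>)) 0 (of_real (snd \<sigma>)) s t)"
proof -
  show "\<forall>p\<in>set P. cubic0 p"
  proof
    fix p assume p: "p \<in> set P"
    have "total_degree p \<le> map_degree P (denom \<sigma>)" unfolding map_degree_def using p by (intro Max_ge) auto
    thus "cubic0 p" using assms p unfolding reduced_pointed_cubic_sphere_map_def pointed_def by (intro cubic0I) auto
  qed
  fix s t :: complex assume st: "(cmod s)\<^sup>2 + (cmod t)\<^sup>2 = 1"
  hence "(s,t) \<in> sphere 0 1" by (simp add: norm_Pair)
  hence "(\<Sum>p\<leftarrow>P. (norm (bieval p (s,t)))\<^sup>2) = (norm (bieval (denom \<sigma>) (s,t)))\<^sup>2"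
    using assms unfolding reduced_pointed_cubic_sphere_map_def sphere_map_def by blast
  moreover have "gram P (s,t) (s,t) = complex_of_real (\<Sum>p\<leftarrow>P. (norm (bieval p (s,t)))\<^sup>2)"
    unfolding gram_def by (induction P) (simp_all add: nsq)
  ultimately show "gram P (s,t) (s,t) = (1 + qf (of_real (fst \<sigma>)) 0 (of_real (snd \<sigma>)) s t) * cnj (1 + qf (of_real (fst \<sigma>)) 0 (of_real (snd \<sigma>)) s t)"
    by (simp only: nsq bieval_denom_qf of_real_power)
qed

text \<open>Evaluating the inner variable at \<open>T\<close> gives a polynomial in \<open>z2\<close> with all values zero.\<close>
lemma line_dvd: assumes "\<And>v. bieval p (T,v) = 0" shows "[:[:-T,1:]:] dvd p"
proof -
  have "poly (poly p [:v:]) T = poly (map_poly (\<lambda>c. poly c T) p) v" for v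
    by (induction p) (simp_all add: map_poly_pCons)
  hence "poly (map_poly (\<lambda>c. poly c T) p) v = 0" for v using assms[of v] by (simp add: bieval_def)
  hence "map_poly (\<lambda>c. poly c T) p = 0" using poly_all_0_iff_0 by blast
  hence "poly (coeff p n) T = 0" for n using coeff_map_poly[of "\<lambda>c. poly c T" p n] by simp
  thus ?thesis by (simp add: const_poly_dvd_iff poly_eq_0_iff_dvd)
qed

lemma dvd_span: assumes "\<forall>f\<in>S. h dvd f" "p \<in> bipoly.span S" shows "h dvd p"
proof -
  have "bipoly.subspace {p. h dvd p}" unfolding bipoly.subspace_def by (auto intro: dvd_smult)
  hence "bipoly.span S \<subseteq> {p. h dvd p}" using assms(1) by (intro bipoly.span_minimal) auto
  thus ?thesis using assms(2) by auto
qed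

text \<open>With at most three dimensions the components would have the factor \<open>1 + q\<close> or a factor \<open>z1 - T\<close> in common
with the denominator, so the map would not be reduced.\<close>
theorem min_target_dim_ge_4:
  assumes P: "reduced_pointed_cubic_sphere_map P (denom \<sigma>)" and \<sigma>: "\<sigma> \<in> param_set" "\<sigma> \<noteq> (0,0)"
  shows "4 \<le> min_target_dim P"
proof (rule ccontr)
  assume "\<not> ?thesis"
  hence "min_target_dim P \<le> 3" by simp
  then obtain F where F: "length F = 3" "gram F = gram P" "bipoly.span (set F) = bipoly.span (set P)"
    by (rule gram_fixed_length)
  define s1 where "s1 = fst \<sigma>" define s2 where "s2 = snd \<sigma>"
  have s: "0 \<le> s2" "s2 \<le> s1" "0 < s1"
    using \<sigma> unfolding s1_def s2_def param_set_def by (cases \<sigma>; auto simp: less_le)+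
  have cF: "\<forall>f\<in>set F. cubic0 f"
  proof
    fix f assume "f \<in> set F"
    hence "f \<in> bipoly.span (set P)" unfolding F(3)[symmetric] by (rule bipoly.span_base)
    thus "cubic0 f" using cubic0_span cubic_map_facts(1)[OF P] by blast
  qed
  have PF: "p \<in> bipoly.span (set F)" if "p \<in> set P" for p using that unfolding F(3) by (rule bipoly.span_base)
  have red: "h dvd denom \<sigma> \<Longrightarrow> \<forall>p\<in>set P. h dvd p \<Longrightarrow> total_degree h = 0" for h
    using P unfolding reduced_pointed_cubic_sphere_map_def reduced_def by blast
  have "(\<forall>f\<in>set F. \<exists>k l. \<forall>s t. bieval f (s,t) = (k * s + l * t) * (1 + qf s1 0 s2 s t)) \<or>
    (s2 = 0 \<and> (\<exists>T. complex_of_real s1 * T\<^sup>2 = -1 \<and> (\<forall>f\<in>set F. \<forall>v. bieval f (T,v) = 0)))"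
    by (rule three_components_share_factor[OF F(1) cF _ s]) (use cubic_map_facts(2)[OF P] in \<open>simp add: F(2) s1_def s2_def\<close>)
  thus False
  proof
    assume A: "\<forall>f\<in>set F. \<exists>k l. \<forall>s t. bieval f (s,t) = (k * s + l * t) * (1 + qf s1 0 s2 s t)"
    have "denom \<sigma> dvd f" if fF: "f \<in> set F" for f
    proof -
      obtain k l where kl: "\<And>s t. bieval f (s,t) = (k * s + l * t) * (1 + qf s1 0 s2 s t)" using bspec[OF A fF] by blast
      have "f = bp k l 0 0 0 0 0 0 0 * denom \<sigma>"
      proof (rule bieval_ext)
        fix z :: "complex \<times> complex"
        show "bieval f z = bieval (bp k l 0 0 0 0 0 0 0 * denom \<sigma>) z"
          by (cases z) (simp add: bieval_mult kl bieval_bp bieval_denom_qf s1_def s2_def lf_def qf_def[of 0] cf_def)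
      qed
      thus ?thesis by (simp only: dvd_triv_right)
    qed
    hence "\<forall>f\<in>set F. denom \<sigma> dvd f" by blast
    hence "\<forall>p\<in>set P. denom \<sigma> dvd p" using PF by (blast intro: dvd_span)
    with dvd_refl have "total_degree (denom \<sigma>) = 0" by (rule red)
    moreover have "cc (denom \<sigma>) 2 0 \<noteq> 0" using s by (simp add: denom_def s1_def numeral_2_eq_2)
    ultimately show False using cc_bound[of "denom \<sigma>" 0 2] by simp
  next
    assume "s2 = 0 \<and> (\<exists>T. complex_of_real s1 * T\<^sup>2 = -1 \<and> (\<forall>f\<in>set F. \<forall>v. bieval f (T,v) = 0))"
    then obtain T where T: "s2 = 0" "complex_of_real s1 * T\<^sup>2 = -1" "\<And>f v. f \<in> set F \<Longrightarrow> bieval f (T,v) = 0" by blast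
    define h where "h = [:[:-T,1:]:]"
    have "h dvd denom \<sigma>" unfolding h_def
      by (rule line_dvd) (use T in \<open>simp add: bieval_denom_qf qf_def s1_def s2_def\<close>)
    moreover have "\<forall>p\<in>set P. h dvd p" using PF dvd_span line_dvd T(3) unfolding h_def by blast
    ultimately have "total_degree h = 0" by (rule red)
    moreover have "cc h 1 0 \<noteq> 0" by (simp add: h_def)
    ultimately show False using cc_bound[of h 0 1] by simp
  qed
qed

text \<open>After dehomogenization the two factors are polynomials with the same coefficients up to order, sign and
conjugation, and one of them is zero because the polynomial ring has no zero divisors.\<close>
lemma cubic_self_orthogonal:
  assumes "\<And>z1 z2. cf a b c d z1 z2 * cf (cnj a) (cnj b) (cnj c) (cnj d) (-z2) z1 = 0"
  shows "a = 0 \<and> b = 0 \<and> c = 0 \<and> d = 0"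
proof -
  have "poly ([:a,b,c,d:] * [:cnj d,-cnj c,cnj b,-cnj a:]) t = 0" for t
    by (rule trans[OF _ assms[of 1 t]]) (simp add: cf_def power2_eq_square power3_eq_cube algebra_simps)
  hence "[:a,b,c,d:] * [:cnj d,-cnj c,cnj b,-cnj a:] = 0" using poly_all_0_iff_0 by blast
  hence "[:a,b,c,d:] = 0 \<or> [:cnj d,-cnj c,cnj b,-cnj a:] = 0" by (simp only: mult_eq_0_iff)
  thus ?thesis by auto
qed

text \<open>The cubic parts \<open>C(z)\<close> of the two components are orthogonal to the linear parts, and \<open>C(z)\<close> is orthogonal
to the value of \<open>C\<close> at the point orthogonal to \<open>z\<close>. If \<open>C\<close> takes values in a complex line it
vanishes by the previous lemma. Otherwise the linear and then the quadratic parts vanish, and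
\<open>\<Sum> C cnj C = \<langle>z,u\<rangle>\<^sup>3\<close> exhibits four orthogonal nonzero coefficient vectors in a space of dimension two.\<close>
lemma rank2_no_cubic:
  assumes cub: "cubic0 f" "cubic0 g"
    and sph: "\<And>s t. (cmod s)\<^sup>2 + (cmod t)\<^sup>2 = 1 \<Longrightarrow> gram [f,g] (s,t) (s,t) = 1"
  shows "cubp f z1 z2 = 0 \<and> cubp g z1 z2 = 0"
proof -
  have q0: "qf 0 0 0 s t = 0" for s t by (simp add: qf_def)
  have cs: "\<And>h. h \<in> set [f,g] \<Longrightarrow> cubic0 h" using cub by auto
  have sp: "\<And>s t. (cmod s)\<^sup>2 + (cmod t)\<^sup>2 = 1 \<Longrightarrow> gram [f,g] (s,t) (s,t) = (1 + qf 0 0 0 s t) * cnj (1 + qf 0 0 0 s t)"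
    using sph by (simp add: q0)
  note PI = polarized_identities[OF cs sp]
  have I2: "cubp f z1 z2 * linb f u1 u2 + cubp g z1 z2 * linb g u1 u2 = 0" for z1 z2 u1 u2
    using PI(1)[of z1 z2 u1 u2] by (simp add: q0)
  have I1: "cubp f z1 z2 * quadb f u1 u2 + cubp g z1 z2 * quadb g u1 u2
     + (z1*u1+z2*u2) * (quadp f z1 z2 * linb f u1 u2 + quadp g z1 z2 * linb g u1 u2) = 0" for z1 z2 u1 u2
    using PI(2)[of z1 z2 u1 u2] by simp
  have I0: "cubp f z1 z2 * cubb f u1 u2 + cubp g z1 z2 * cubb g u1 u2
     + (z1*u1+z2*u2) * (quadp f z1 z2 * quadb f u1 u2 + quadp g z1 z2 * quadb g u1 u2)
     + (z1*u1+z2*u2)\<^sup>2 * (linp f z1 z2 * linb f u1 u2 + linp g z1 z2 * linb g u1 u2) - (z1*u1+z2*u2)^3 = 0" for z1 z2 u1 u2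
    using PI(3)[of z1 z2 u1 u2] by (simp add: q0)
  have orth: "cubp f z1 z2 * cubb f (-z2) z1 + cubp g z1 z2 * cubb g (-z2) z1 = 0" for z1 z2
    using I0[of z1 z2 "-z2" z1] by (simp add: mult.commute)
  \<comment> \<open>if the cubic part takes values on a complex line then it vanishes\<close>
  have key: "\<forall>z1 z2. cubp f z1 z2 = 0 \<and> cubp g z1 z2 = 0"
    if lin: "\<And>z1 z2. cubp f z1 z2 * k + cubp g z1 z2 * l = 0" and kl: "k \<noteq> 0 \<or> l \<noteq> 0" for k l
  proof -
    have "\<exists>F0 G0 c. cubic0 F0 \<and> (\<forall>z1 z2. cubp G0 z1 z2 = c * cubp F0 z1 z2) \<and> {F0,G0} = {f,g}"
    proof (cases "l = 0")
      case True
      hence "cubp f z1 z2 = 0 * cubp g z1 z2" for z1 z2 using lin[of z1 z2] kl by simp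
      thus ?thesis using cub by (intro exI[of _ g] exI[of _ f] exI[of _ 0]) auto
    next
      case False
      hence "cubp g z1 z2 = (- k / l) * cubp f z1 z2" for z1 z2 using lin[of z1 z2]
        by (simp add: field_simps eq_neg_iff_add_eq_0)
      thus ?thesis using cub by (intro exI[of _ f] exI[of _ g] exI[of _ "- k / l"]) auto
    qed
    then obtain F0 G0 c where FG: "\<And>z1 z2. cubp G0 z1 z2 = c * cubp F0 z1 z2" "{F0,G0} = {f,g}" by blast
    have Gb: "cubb G0 u1 u2 = cnj c * cubb F0 u1 u2" for u1 u2
      using arg_cong[OF FG(1)[of "cnj u1" "cnj u2"], of cnj] by (simp add: conjugate_forms(3)[symmetric])
    have "cubp F0 z1 z2 * cubb F0 (-z2) z1 + cubp G0 z1 z2 * cubb G0 (-z2) z1 = 0" for z1 z2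
      using orth[of z1 z2] FG(2) by (auto simp: doubleton_eq_iff algebra_simps)
    hence "(1 + c * cnj c) * (cubp F0 z1 z2 * cubb F0 (-z2) z1) = 0" for z1 z2 unfolding FG(1) Gb by (simp add: algebra_simps)
    moreover have "1 + c * cnj c \<noteq> 0"
    proof -
      have "1 + (cmod c)\<^sup>2 \<noteq> 0" using zero_le_power2[of "cmod c"] by linarith
      moreover have "1 + c * cnj c = complex_of_real (1 + (cmod c)\<^sup>2)" by (simp add: nsq)
      ultimately show ?thesis by (simp only: of_real_eq_0_iff not_False_eq_True)
    qed
    ultimately have "cubp F0 z1 z2 * cubb F0 (-z2) z1 = 0" for z1 z2 by simp
    hence "cc F0 3 0 = 0 \<and> cc F0 2 1 = 0 \<and> cc F0 1 2 = 0 \<and> cc F0 0 3 = 0"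
      unfolding cubp_def cubb_def by (rule cubic_self_orthogonal)
    hence "cubp F0 z1 z2 = 0" for z1 z2 by (simp add: cubp_def cf_def)
    thus ?thesis using FG by (metis doubleton_eq_iff mult_zero_right)
  qed
  show ?thesis
  proof (rule ccontr)
    assume N: "\<not> ?thesis"
    have L: "linb f u1 u2 = 0 \<and> linb g u1 u2 = 0" for u1 u2
      using key[of "linb f u1 u2" "linb g u1 u2"] I2 N by blast
    have "cubp f z1 z2 * quadb f u1 u2 + cubp g z1 z2 * quadb g u1 u2 = 0" for z1 z2 u1 u2
      using I1[of z1 z2 u1 u2] L by simp
    hence Q: "quadb f u1 u2 = 0 \<and> quadb g u1 u2 = 0" for u1 u2
      using key[of "quadb f u1 u2" "quadb g u1 u2"] N by blast
    have E: "cubp f z1 z2 * cubb f u1 u2 + cubp g z1 z2 * cubb g u1 u2 - (z1*u1+z2*u2)^3 = 0" for z1 z2 u1 u2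
      using I0[of z1 z2 u1 u2] L Q by simp
    obtain a0 a1 a2 a3 where a: "cubp f = cf a0 a1 a2 a3" "cubb f = cf (cnj a0) (cnj a1) (cnj a2) (cnj a3)"
      unfolding cubp_def cubb_def by blast
    obtain b0 b1 b2 b3 where b: "cubp g = cf b0 b1 b2 b3" "cubb g = cf (cnj b0) (cnj b1) (cnj b2) (cnj b3)"
      unfolding cubp_def cubb_def by blast
    have "((a0*cnj a0+b0*cnj b0-1) + (a0*cnj a1+b0*cnj b1)*t + (a0*cnj a2+b0*cnj b2)*t\<^sup>2 + (a0*cnj a3+b0*cnj b3)*t^3)
       + ((a1*cnj a0+b1*cnj b0) + (a1*cnj a1+b1*cnj b1-3)*t + (a1*cnj a2+b1*cnj b2)*t\<^sup>2 + (a1*cnj a3+b1*cnj b3)*t^3) * s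
       + ((a2*cnj a0+b2*cnj b0) + (a2*cnj a1+b2*cnj b1)*t + (a2*cnj a2+b2*cnj b2-3)*t\<^sup>2 + (a2*cnj a3+b2*cnj b3)*t^3) * s\<^sup>2
       + ((a3*cnj a0+b3*cnj b0) + (a3*cnj a1+b3*cnj b1)*t + (a3*cnj a2+b3*cnj b2)*t\<^sup>2 + (a3*cnj a3+b3*cnj b3-1)*t^3) * s^3 = 0" for s t
      by (rule trans[OF _ E[of 1 s 1 t]]) (simp add: a b cf_def power2_eq_square power3_eq_cube algebra_simps)
    note C = bicubic_zero[OF this]
    have 1: "a0*cnj a0+b0*cnj b0 = 1" "a1*cnj a1+b1*cnj b1 = 3" "a1*cnj a0+b1*cnj b0 = 0" "a3*cnj a0+b3*cnj b0 = 0" "a3*cnj a1+b3*cnj b1 = 0" "a3*cnj a3+b3*cnj b3 = 1"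
      using C by simp_all
    \<comment> \<open>three pairwise orthogonal nonzero vectors in a plane\<close>
    have "a0*cnj a1+b0*cnj b1 = 0" by (rule C)
    have "(a0*b1 - a1*b0) * (cnj a0 * cnj b1 - cnj a1 * cnj b0) = (a0*cnj a0+b0*cnj b0) * (a1*cnj a1+b1*cnj b1) - (a1*cnj a0+b1*cnj b0) * (a0*cnj a1+b0*cnj b1)"
      by (simp add: algebra_simps)
    hence d: "cnj a0 * cnj b1 - cnj a1 * cnj b0 \<noteq> 0" unfolding 1 by auto
    have "a3 * (cnj a0 * cnj b1 - cnj a1 * cnj b0) = cnj b1 * (a3*cnj a0+b3*cnj b0) - cnj b0 * (a3*cnj a1+b3*cnj b1)"
      "b3 * (cnj a0 * cnj b1 - cnj a1 * cnj b0) = cnj a0 * (a3*cnj a1+b3*cnj b1) - cnj a1 * (a3*cnj a0+b3*cnj b0)"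
      by (simp_all add: algebra_simps)
    hence "a3 = 0" "b3 = 0" using d unfolding 1 by simp_all
    thus False using 1(6) by simp
  qed
qed

text \<open>With at most two dimensions the cubic parts of all components vanish, so the degree is not three.\<close>
theorem min_target_dim_ge_3:
  assumes P: "reduced_pointed_cubic_sphere_map P (denom (0,0))"
  shows "3 \<le> min_target_dim P"
proof (rule ccontr)
  assume "\<not> ?thesis"
  hence "min_target_dim P \<le> 2" by simp
  then obtain F where F: "length F = 2" "gram F = gram P" "bipoly.span (set F) = bipoly.span (set P)"
    by (rule gram_fixed_length)
  obtain f g where fg: "F = [f,g]" using F(1) by (auto simp: length_Suc_conv numeral_2_eq_2)
  have cF: "cubic0 h" if "h \<in> set F" for h
  proof -
    have "h \<in> bipoly.span (set P)" using that unfolding F(3)[symmetric] by (rule bipoly.span_base)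
    thus ?thesis using cubic0_span cubic_map_facts(1)[OF P] by blast
  qed
  have z: "cubp f z1 z2 = 0 \<and> cubp g z1 z2 = 0" for z1 z2
  proof (rule rank2_no_cubic)
    show "cubic0 f" "cubic0 g" using cF fg by auto
    show "gram [f,g] (s,t) (s,t) = 1" if "(cmod s)\<^sup>2 + (cmod t)\<^sup>2 = 1" for s t
      using cubic_map_facts(2)[OF P that] F(2) unfolding fg by (simp add: qf_def)
  qed
  have cz: "cubp p z1 z2 = 0" if "p \<in> set P" for p z1 z2
  proof -
    interpret functional "\<lambda>p. cubp p z1 z2" by (rule functional_cubp)
    have "p \<in> bipoly.span (set F)" using that unfolding F(3) by (rule bipoly.span_base)
    thus ?thesis using span_zero[of "set F" p] z unfolding fg by auto
  qed
  have "total_degree p \<le> 2" if p: "p \<in> set P" for p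
  proof (rule total_degree_le)
    fix i j assume ij: "cc p i j \<noteq> 0"
    have c: "cubic0 p" using cubic_map_facts(1)[OF P] p by blast
    have "cc p 3 0 + cc p 2 1 * t + cc p 1 2 * t\<^sup>2 + cc p 0 3 * t^3 = 0" for t
      using cz[OF p, of 1 t] by (simp add: cubp_def cf_def)
    note Z = cubic_zero[OF this]
    have "i + j \<le> 3" using c ij unfolding cubic0_def by blast
    moreover have "i + j \<noteq> 3"
    proof
      assume "i + j = 3"
      hence "j = 0 \<and> i = 3 \<or> j = 1 \<and> i = 2 \<or> j = 2 \<and> i = 1 \<or> j = 3 \<and> i = 0" by linarith
      thus False using Z ij by auto
    qed
    ultimately show "i + j \<le> 2" by simp
  qed
  moreover have "total_degree (denom (0,0)) \<le> 2"
    by (rule total_degree_le) (auto simp: denom_def coeff_pCons split: nat.splits)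
  ultimately have "map_degree P (denom (0,0)) \<le> 2" unfolding map_degree_def by simp
  thus False using P unfolding reduced_pointed_cubic_sphere_map_def by simp
qed

text \<open>There are nine monomials of degree one, two and three.\<close>
theorem min_target_dim_le_9:
  assumes P: "reduced_pointed_cubic_sphere_map P (denom \<sigma>)"
  shows "min_target_dim P \<le> 9"
proof -
  define M where "M = [bp 1 0 0 0 0 0 0 0 0, bp 0 1 0 0 0 0 0 0 0, bp 0 0 1 0 0 0 0 0 0, bp 0 0 0 1 0 0 0 0 0, bp 0 0 0 0 1 0 0 0 0,
    bp 0 0 0 0 0 1 0 0 0, bp 0 0 0 0 0 0 1 0 0, bp 0 0 0 0 0 0 0 1 0, bp 0 0 0 0 0 0 0 0 1]"
  have "p \<in> bipoly.span (set M)" if p0: "cubic0 p" for p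
  proof -
    obtain a1 a2 a3 a4 a5 a6 a7 a8 a9 where p: "p = bp a1 a2 a3 a4 a5 a6 a7 a8 a9" using cubic0_eq[OF p0] by blast
    have "p = smult [:a1:] (M!0) + smult [:a2:] (M!1) + smult [:a3:] (M!2) + smult [:a4:] (M!3) + smult [:a5:] (M!4)
       + smult [:a6:] (M!5) + smult [:a7:] (M!6) + smult [:a8:] (M!7) + smult [:a9:] (M!8)"
      unfolding p by (simp add: M_def bp_def)
    also have "\<dots> \<in> bipoly.span (set M)"
      by (intro bipoly.span_add bipoly.span_scale bipoly.span_base nth_mem) (simp_all add: M_def)
    finally show ?thesis .
  qed
  hence "set P \<subseteq> bipoly.span (set M)" using cubic_map_facts(1)[OF P] by auto
  hence "bipoly.span (set P) \<subseteq> bipoly.span (set M)" by (intro bipoly.span_minimal) auto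
  hence "bipoly.dim (bipoly.span (set P)) \<le> card (set M)" by (intro bipoly.dim_le_card) auto
  also have "\<dots> \<le> 9" using card_length[of M] by (simp add: M_def)
  finally show ?thesis unfolding min_target_dim_def .
qed

lemma min_target_dim_le_length: "min_target_dim P \<le> length P"
proof -
  have "min_target_dim P \<le> card (set P)" unfolding min_target_dim_def by (intro bipoly.dim_le_card) auto
  thus ?thesis using card_length[of P] by simp
qed

section \<open>A criterion for sphere maps and for their dimension\<close>

lemma bieval_pCons: "bieval (pCons c p) z = poly c (fst z) + snd z * bieval p z"
  by (simp add: bieval_def)

lemma bieval_has_derivative:
  "\<exists>a b. (bieval p has_derivative (\<lambda>h. a * fst h + b * snd h)) (at z within S)"
proof (induction p)
  case 0
  show ?case by (intro exI[of _ 0]) (simp add: bieval_zero[abs_def])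
next
  case (pCons c p)
  then obtain a b where ab: "(bieval p has_derivative (\<lambda>h. a * fst h + b * snd h)) (at z within S)" by blast
  have "(poly c has_derivative (*) (poly (pderiv c) (fst z))) (at (fst z))"
    using poly_DERIV[of c "fst z"] unfolding has_field_derivative_def .
  hence "((\<lambda>z. poly c (fst z)) has_derivative (\<lambda>h. poly (pderiv c) (fst z) * fst h)) (at z within S)"
    by (rule has_derivative_compose[OF has_derivative_fst[OF has_derivative_ident]])
  hence "((\<lambda>z. poly c (fst z) + snd z * bieval p z) has_derivative
     (\<lambda>h. poly (pderiv c) (fst z) * fst h + (snd z * (a * fst h + b * snd h) + snd h * bieval p z))) (at z within S)"
    by (intro has_derivative_add has_derivative_mult has_derivative_snd has_derivative_ident ab)
  moreover have "(\<lambda>h. poly (pderiv c) (fst z) * fst h + (snd z * (a * fst h + b * snd h) + snd h * bieval p z))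
     = (\<lambda>h. (poly (pderiv c) (fst z) + snd z * a) * fst h + (snd z * b + bieval p z) * snd h)"
    by (simp add: fun_eq_iff algebra_simps)
  ultimately show ?case unfolding bieval_pCons[abs_def] by auto
qed

text \<open>On the ball \<open>|\<sigma>1 z1\<^sup>2 + \<sigma>2 z2\<^sup>2| \<le> |z1|\<^sup>2 + |z2|\<^sup>2 < 1\<close>.\<close>
lemma denom_nonzero:
  assumes \<sigma>: "\<sigma> \<in> param_set" and z: "z \<in> ball 0 1"
  shows "bieval (denom \<sigma>) z \<noteq> 0"
proof
  assume 0: "bieval (denom \<sigma>) z = 0"
  obtain s t where st: "z = (s,t)" by (cases z)
  define p q where "p = fst \<sigma>" and "q = snd \<sigma>"
  have pq: "0 \<le> q" "q \<le> p" "p < 1" using \<sigma> by (auto simp: param_set_def p_def q_def)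
  have n: "(cmod s)\<^sup>2 + (cmod t)\<^sup>2 < 1" using z by (simp add: st norm_Pair real_sqrt_lt_1_iff)
  have "of_real p * s\<^sup>2 + of_real q * t\<^sup>2 = - 1"
    using 0 unfolding st bieval_denom p_def q_def by (simp add: eq_neg_iff_add_eq_0 algebra_simps)
  hence "1 = cmod (of_real p * s\<^sup>2 + of_real q * t\<^sup>2)" by simp
  also have "\<dots> \<le> p * (cmod s)\<^sup>2 + q * (cmod t)\<^sup>2"
    using norm_triangle_ineq[of "of_real p * s\<^sup>2" "of_real q * t\<^sup>2"] pq by (simp add: norm_mult norm_power)
  also have "\<dots> \<le> 1 * (cmod s)\<^sup>2 + 1 * (cmod t)\<^sup>2"
    using pq by (intro add_mono mult_right_mono) auto
  finally show False using n by simp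
qed

lemma unit_total_degree: fixes h :: bipoly assumes "h dvd 1" shows "total_degree h = 0"
proof -
  obtain c where c: "h = [:c:]" "c dvd 1" using assms by (auto simp: is_unit_poly_iff)
  then obtain d where "c = [:d:]" by (auto simp: is_unit_poly_iff)
  hence "h = [:[:d:]:]" using c by simp
  hence "total_degree h \<le> 0" by (intro total_degree_le) (auto simp: coeff_pCons split: nat.splits)
  thus ?thesis by simp
qed

lemma reduced_pointed_cubic_sphere_mapI:
  assumes \<sigma>: "\<sigma> \<in> param_set" and cub: "\<And>p. p \<in> set P \<Longrightarrow> cubic0 p"
    and sph: "\<And>s t. (cmod s)\<^sup>2 + (cmod t)\<^sup>2 = 1 \<Longrightarrow> (\<Sum>p\<leftarrow>P. (cmod (bieval p (s,t)))\<^sup>2) = (cmod (bieval (denom \<sigma>) (s,t)))\<^sup>2"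
    and red: "\<And>h. h dvd denom \<sigma> \<Longrightarrow> (\<And>p. p \<in> set P \<Longrightarrow> h dvd p) \<Longrightarrow> h dvd 1"
    and deg: "p3 \<in> set P" "cc p3 i j \<noteq> 0" "i + j = 3"
  shows "reduced_pointed_cubic_sphere_map P (denom \<sigma>)"
  unfolding reduced_pointed_cubic_sphere_map_def
proof (intro conjI)
  show "sphere_map P (denom \<sigma>)" unfolding sphere_map_def
  proof (intro conjI ballI)
    show "denom \<sigma> \<noteq> 0" by (simp add: denom_def)
    fix p assume "p \<in> set P"
    have "\<exists>a b. ((\<lambda>z. bieval p z / bieval (denom \<sigma>) z) has_derivative (\<lambda>h. a * fst h + b * snd h)) (at z within ball 0 1)"
      if z: "z \<in> ball 0 1" for z
    proof -
      let ?g = "denom \<sigma>"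
      obtain a b where ab: "(bieval p has_derivative (\<lambda>h. a * fst h + b * snd h)) (at z within ball 0 1)" using bieval_has_derivative by blast
      obtain c d where cd: "(bieval ?g has_derivative (\<lambda>h. c * fst h + d * snd h)) (at z within ball 0 1)" using bieval_has_derivative by blast
      have nz: "bieval ?g z \<noteq> 0" using denom_nonzero[OF \<sigma> z] .
      have "((\<lambda>z. bieval p z / bieval ?g z) has_derivative (\<lambda>h. ((a * fst h + b * snd h) * bieval ?g z - bieval p z * (c * fst h + d * snd h)) / (bieval ?g z * bieval ?g z))) (at z within ball 0 1)"
        by (rule has_derivative_divide'[OF ab cd nz])
      moreover have "(\<lambda>h. ((a * fst h + b * snd h) * bieval ?g z - bieval p z * (c * fst h + d * snd h)) / (bieval ?g z * bieval ?g z))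
        = (\<lambda>h. ((a * bieval ?g z - bieval p z * c) / (bieval ?g z * bieval ?g z)) * fst h + ((b * bieval ?g z - bieval p z * d) / (bieval ?g z * bieval ?g z)) * snd h)"
        using nz by (simp add: fun_eq_iff field_simps)
      ultimately show ?thesis by (simp only:) blast
    qed
    thus "\<exists>f. holomorphic2_on f (ball 0 1) \<and> (\<forall>z\<in>ball 0 1. bieval (denom \<sigma>) z \<noteq> 0 \<longrightarrow> f z = bieval p z / bieval (denom \<sigma>) z)"
      unfolding holomorphic2_on_def by (intro exI[of _ "\<lambda>z. bieval p z / bieval (denom \<sigma>) z"]) blast
  next
    fix z :: "complex \<times> complex" assume z: "z \<in> sphere 0 1"
    obtain s t where st: "z = (s,t)" by (cases z)
    have "(cmod s)\<^sup>2 + (cmod t)\<^sup>2 = 1" using z by (simp add: st norm_Pair)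
    from sph[OF this] show "(\<Sum>p\<leftarrow>P. (cmod (bieval p z))\<^sup>2) = (cmod (bieval (denom \<sigma>) z))\<^sup>2" unfolding st .
  qed
  show "reduced P (denom \<sigma>)" unfolding reduced_def
  proof (intro allI impI, elim conjE)
    fix h assume "h dvd denom \<sigma>" "\<forall>p\<in>set P. h dvd p"
    thus "total_degree h = 0" by (intro unit_total_degree red) auto
  qed
  show "pointed P (denom \<sigma>)" unfolding pointed_def
    using cub unfolding cubic0_def bieval_0 by (fastforce simp: denom_def)
  show "map_degree P (denom \<sigma>) = 3"
  proof (rule antisym)
    have "total_degree (denom \<sigma>) \<le> 3"
      by (rule total_degree_le) (auto simp: denom_def coeff_pCons split: nat.splits)
    thus "map_degree P (denom \<sigma>) \<le> 3" unfolding map_degree_def using cub total_degree_cubic0 by auto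
    have "3 \<le> total_degree p3" using cc_bound[of p3 j i] deg by simp
    also have "\<dots> \<le> map_degree P (denom \<sigma>)" unfolding map_degree_def using deg by (intro Max_ge) auto
    finally show "3 \<le> map_degree P (denom \<sigma>)" .
  qed
qed

text \<open>Every nonzero entry has a monomial, its pivot, that does not occur in the entries after it.\<close>
fun echelon :: "bipoly list \<Rightarrow> bool" where
  "echelon [] \<longleftrightarrow> True"
| "echelon (p # ps) \<longleftrightarrow> (p = 0 \<or> (\<exists>i j. cc p i j \<noteq> 0 \<and> (\<forall>q\<in>set ps. cc q i j = 0))) \<and> echelon ps"

lemma min_target_dim_echelon:
  assumes "echelon P" and "0 \<notin> set P"
  shows "min_target_dim P = length P"
proof -
  have "bipoly.independent (set P) \<and> distinct P" using assms
  proof (induction P)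
    case (Cons p P)
    then obtain i j where ij: "cc p i j \<noteq> 0" "\<And>q. q \<in> set P \<Longrightarrow> cc q i j = 0" by auto
    interpret functional "\<lambda>p. cc p i j" by (rule functional_cc)
    have "p \<notin> bipoly.span (set P)" using span_zero[of "set P" p] ij by blast
    moreover from this have "p \<notin> set P" using bipoly.span_base by blast
    ultimately show ?case using Cons by (auto simp: bipoly.independent_insert)
  qed (simp add: bipoly.independent_empty)
  thus ?thesis unfolding min_target_dim_def
    by (simp add: bipoly.dim_eq_card_independent bipoly.dim_span distinct_card)
qed

lemma echelon_filter: "echelon P \<Longrightarrow> echelon (filter (\<lambda>p. p \<noteq> 0) P)"
  by (induction P) auto

section \<open>A family of sphere maps with given denominator\<close>

lemma cmod_lincomb_sq:
  "(cmod (of_real a * x + of_real b * y))\<^sup>2 = a\<^sup>2 * (cmod x)\<^sup>2 + 2 * a * b * Re (x * cnj y) + b\<^sup>2 * (cmod y)\<^sup>2"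
  unfolding cmod_power2 by (simp add: power2_eq_square algebra_simps)

text \<open>The polynomials \<open>r z1 (1 + q / r\<^sup>2)\<close> and \<open>r z2 (1 + q / r\<^sup>2)\<close>.\<close>
definition family_block1 :: "real \<Rightarrow> real \<Rightarrow> real \<Rightarrow> bipoly" where
  "family_block1 s1 s2 r = bp (of_real r) 0 0 0 0 (of_real (s1 / r)) 0 (of_real (s2 / r)) 0"
definition family_block2 :: "real \<Rightarrow> real \<Rightarrow> real \<Rightarrow> bipoly" where
  "family_block2 s1 s2 r = bp 0 (of_real r) 0 0 0 0 (of_real (s1 / r)) 0 (of_real (s2 / r))"

lemma bieval_family_blocks:
  assumes "r \<noteq> 0"
  shows "bieval (family_block1 s1 s2 r) (s,t) = s * (of_real r + of_real (1 / r) * (of_real s1 * s\<^sup>2 + of_real s2 * t\<^sup>2))"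
    "bieval (family_block2 s1 s2 r) (s,t) = t * (of_real r + of_real (1 / r) * (of_real s1 * s\<^sup>2 + of_real s2 * t\<^sup>2))"
  unfolding family_block1_def family_block2_def bieval_bp lf_def qf_def cf_def
  by (simp_all add: power2_eq_square power3_eq_cube add_divide_distrib algebra_simps)

text \<open>Since \<open>r1\<close> times the first block is \<open>z1 (1 + q) - (1 - r1\<^sup>2) z1\<close>, a common divisor with \<open>1 + q\<close> divides \<open>z1\<close>,
and likewise \<open>z2\<close>; hence it divides \<open>1\<close>.\<close>
lemma family_blocks_reduced:
  assumes "r1\<^sup>2 < 1" "r2\<^sup>2 < 1" "r1 \<noteq> 0" "r2 \<noteq> 0"
    and h: "h dvd denom (s1,s2)" "h dvd family_block1 s1 s2 r1" "h dvd family_block2 s1 s2 r2"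
  shows "h dvd 1"
proof -
  define z1 where "z1 = bp 1 0 0 0 0 0 0 0 0"
  define z2 where "z2 = bp 0 1 0 0 0 0 0 0 0"
  have "h dvd z1"
  proof -
    define c where "c = 1 / complex_of_real (1 - r1\<^sup>2)"
    have "complex_of_real (1 - r1\<^sup>2) \<noteq> 0" unfolding of_real_eq_0_iff using assms(1) by simp
    hence c: "c * (1 - (complex_of_real r1)\<^sup>2) = 1" by (simp add: c_def)
    have "smult [:c:] (z1 * denom (s1,s2) - smult [:of_real r1:] (family_block1 s1 s2 r1)) = z1"
    proof (rule bieval_ext)
      fix z :: "complex \<times> complex" obtain s t where z: "z = (s,t)" by (cases z)
      have "complex_of_real r1 * of_real (1 / r1) = 1" using assms(3) by simp
      hence "complex_of_real r1 * bieval (family_block1 s1 s2 r1) z = s * ((of_real r1)\<^sup>2 + of_real s1 * s\<^sup>2 + of_real s2 * t\<^sup>2)"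
        unfolding z bieval_family_blocks[OF assms(3)] by algebra
      moreover have "bieval z1 z = s" by (simp add: z z1_def bieval_bp lf_def qf_def cf_def)
      ultimately show "bieval (smult [:c:] (z1 * denom (s1,s2) - smult [:of_real r1:] (family_block1 s1 s2 r1))) z = bieval z1 z"
        unfolding bieval_smult bieval_diff bieval_mult z bieval_denom fst_conv snd_conv using c by algebra
    qed
    moreover have "h dvd smult [:c:] (z1 * denom (s1,s2) - smult [:of_real r1:] (family_block1 s1 s2 r1))"
      by (intro dvd_smult dvd_diff dvd_mult h)
    ultimately show ?thesis by simp
  qed
  have "h dvd z2"
  proof -
    define c where "c = 1 / complex_of_real (1 - r2\<^sup>2)"
    have "complex_of_real (1 - r2\<^sup>2) \<noteq> 0" unfolding of_real_eq_0_iff using assms(2) by simp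
    hence c: "c * (1 - (complex_of_real r2)\<^sup>2) = 1" by (simp add: c_def)
    have "smult [:c:] (z2 * denom (s1,s2) - smult [:of_real r2:] (family_block2 s1 s2 r2)) = z2"
    proof (rule bieval_ext)
      fix z :: "complex \<times> complex" obtain s t where z: "z = (s,t)" by (cases z)
      have "complex_of_real r2 * of_real (1 / r2) = 1" using assms(4) by simp
      hence "complex_of_real r2 * bieval (family_block2 s1 s2 r2) z = t * ((of_real r2)\<^sup>2 + of_real s1 * s\<^sup>2 + of_real s2 * t\<^sup>2)"
        unfolding z bieval_family_blocks[OF assms(4)] by algebra
      moreover have "bieval z2 z = t" by (simp add: z z2_def bieval_bp lf_def qf_def cf_def)
      ultimately show "bieval (smult [:c:] (z2 * denom (s1,s2) - smult [:of_real r2:] (family_block2 s1 s2 r2))) z = bieval z2 z"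
        unfolding bieval_smult bieval_diff bieval_mult z bieval_denom fst_conv snd_conv using c by algebra
    qed
    moreover have "h dvd smult [:c:] (z2 * denom (s1,s2) - smult [:of_real r2:] (family_block2 s1 s2 r2))"
      by (intro dvd_smult dvd_diff dvd_mult h)
    ultimately show ?thesis by simp
  qed
  have "denom (s1,s2) - (smult [:of_real s1:] (z1 * z1) + smult [:of_real s2:] (z2 * z2)) = 1"
  proof (rule bieval_ext)
    fix z :: "complex \<times> complex" obtain s t where z: "z = (s,t)" by (cases z)
    have "bieval z1 z = s" "bieval z2 z = t" by (simp_all add: z z1_def z2_def bieval_bp lf_def qf_def cf_def)
    thus "bieval (denom (s1,s2) - (smult [:of_real s1:] (z1 * z1) + smult [:of_real s2:] (z2 * z2))) z = bieval 1 z"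
      unfolding bieval_smult bieval_diff bieval_add bieval_mult z bieval_denom by (simp add: bieval_def power2_eq_square)
  qed
  moreover have "h dvd denom (s1,s2) - (smult [:of_real s1:] (z1 * z1) + smult [:of_real s2:] (z2 * z2))"
    by (intro dvd_diff dvd_add dvd_smult dvd_mult h \<open>h dvd z1\<close> \<open>h dvd z2\<close>)
  ultimately show ?thesis by simp
qed

text \<open>The two blocks, cubic components that repair the sphere identity, and three quadratic monomials. Zero
entries are removed later, so the number of components depends on how many parameters vanish.\<close>
definition family_map :: "real \<Rightarrow> real \<Rightarrow> real \<Rightarrow> real \<Rightarrow> real \<Rightarrow> real \<Rightarrow> real \<Rightarrow> real \<Rightarrow> real \<Rightarrow> real \<Rightarrow> real \<Rightarrow> real \<Rightarrow> real \<Rightarrow> bipoly list" where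
  "family_map s1 s2 r1 r2 \<alpha>1 \<beta>1 \<alpha>2 \<beta>2 \<epsilon>1 \<epsilon>2 m1 m2 m3 =
    [family_block1 s1 s2 r1, family_block2 s1 s2 r2,
     bp 0 0 0 0 0 (of_real \<alpha>1) 0 (of_real \<beta>1) 0, bp 0 0 0 0 0 0 (of_real \<alpha>2) 0 (of_real \<beta>2),
     bp 0 0 0 0 0 (of_real \<epsilon>1) 0 0 0, bp 0 0 0 0 0 0 (of_real \<epsilon>2) 0 0,
     bp 0 0 0 (of_real m1) 0 0 0 0 0, bp 0 0 (of_real m2) 0 0 0 0 0 0, bp 0 0 0 0 (of_real m3) 0 0 0 0]"

lemma bp_eq_0: "bp a b c d e f g h i = 0 \<longleftrightarrow> a = 0 \<and> b = 0 \<and> c = 0 \<and> d = 0 \<and> e = 0 \<and> f = 0 \<and> g = 0 \<and> h = 0 \<and> i = 0"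
  by (auto simp: bp_def)

lemma sum_list_filter_nonzero:
  "f 0 = (0::real) \<Longrightarrow> (\<Sum>p\<leftarrow>filter (\<lambda>p. p \<noteq> (0::bipoly)) P. f p) = (\<Sum>p\<leftarrow>P. f p)"
  by (induction P) auto

text \<open>With \<open>S = |z1|\<^sup>2\<close>, \<open>T = |z2|\<^sup>2\<close> and \<open>X = Re (z1\<^sup>2 cnj (z2\<^sup>2))\<close> every squared norm is a polynomial in \<open>S\<close>, \<open>T\<close>, \<open>X\<close>
and \<open>Re q\<close>. The terms with \<open>Re q\<close> sum to \<open>2 Re q\<close> because \<open>S + T = 1\<close>; the six hypotheses on the
coefficients are the comparison of the terms \<open>S\<^sup>3\<close>, \<open>S\<^sup>2 T\<close>, \<open>S T\<^sup>2\<close>, \<open>T\<^sup>3\<close>, \<open>S X\<close> and \<open>T X\<close>.\<close>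
lemma family_map_sphere:
  fixes s t :: complex
  assumes st: "(cmod s)\<^sup>2 + (cmod t)\<^sup>2 = 1" and r: "r1 \<noteq> 0" "r2 \<noteq> 0"
    and b1: "\<beta>1\<^sup>2 = 2 * a2 + a1 - m1\<^sup>2 - m3\<^sup>2 - s2\<^sup>2 * (1 / r1\<^sup>2 - 1)"
    and c1: "\<alpha>1 * \<beta>1 = - s1 * s2 * (1 / r1\<^sup>2 - 1)"
    and d1: "\<alpha>1\<^sup>2 + \<epsilon>1\<^sup>2 = a1 - m2\<^sup>2 - s1\<^sup>2 * (1 / r1\<^sup>2 - 1)"
    and b2: "\<beta>2\<^sup>2 = a2 - m3\<^sup>2 - s2\<^sup>2 * (1 / r2\<^sup>2 - 1)"
    and c2: "\<alpha>2 * \<beta>2 = - s1 * s2 * (1 / r2\<^sup>2 - 1)"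
    and d2: "\<alpha>2\<^sup>2 + \<epsilon>2\<^sup>2 = 2 * a1 + a2 - m1\<^sup>2 - m2\<^sup>2 - s1\<^sup>2 * (1 / r2\<^sup>2 - 1)"
    and a: "a1 = 1 - r1\<^sup>2" "a2 = 1 - r2\<^sup>2"
  shows "(\<Sum>p\<leftarrow>family_map s1 s2 r1 r2 \<alpha>1 \<beta>1 \<alpha>2 \<beta>2 \<epsilon>1 \<epsilon>2 m1 m2 m3. (cmod (bieval p (s,t)))\<^sup>2) = (cmod (bieval (denom (s1,s2)) (s,t)))\<^sup>2"
proof -
  define S T X where "S = (cmod s)\<^sup>2" and "T = (cmod t)\<^sup>2" and "X = Re (s\<^sup>2 * cnj (t\<^sup>2))"
  define q where "q = of_real s1 * s\<^sup>2 + of_real s2 * t\<^sup>2"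
  define R where "R = Re q"
  define k1 k2 where "k1 = 1 / r1\<^sup>2" and "k2 = 1 / r2\<^sup>2"
  have sq: "(cmod (s\<^sup>2))\<^sup>2 = S\<^sup>2" "(cmod (t\<^sup>2))\<^sup>2 = T\<^sup>2" by (simp_all add: S_def T_def norm_power)
  have X': "Re (t\<^sup>2 * cnj (s\<^sup>2)) = X" 
  proof -
    have "t\<^sup>2 * cnj (s\<^sup>2) = cnj (s\<^sup>2 * cnj (t\<^sup>2))" by simp
    thus ?thesis unfolding X_def by (simp only: cnj.sel)
  qed
  have Q: "(cmod q)\<^sup>2 = s1\<^sup>2 * S\<^sup>2 + 2 * s1 * s2 * X + s2\<^sup>2 * T\<^sup>2"
    unfolding q_def cmod_lincomb_sq sq X_def by simp
  have D: "(cmod (bieval (denom (s1,s2)) (s,t)))\<^sup>2 = 1 + 2 * R + (cmod q)\<^sup>2"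

  proof -
    have D: "bieval (denom (s1,s2)) (s,t) = of_real 1 * 1 + of_real 1 * q" by (simp add: bieval_denom q_def)
    show ?thesis unfolding D cmod_lincomb_sq by (simp add: R_def)
  qed
  have B: "(cmod (of_real r + of_real (1 / r) * q))\<^sup>2 = r\<^sup>2 + 2 * R + (1 / r\<^sup>2) * (cmod q)\<^sup>2" if "r \<noteq> 0" for r :: real
    using cmod_lincomb_sq[of r 1 "1 / r" q] that by (simp add: R_def power_divide)
  have e1: "(cmod (bieval (family_block1 s1 s2 r1) (s,t)))\<^sup>2 = S * (r1\<^sup>2 + 2 * R + k1 * (cmod q)\<^sup>2)"
  proof -
    have "bieval (family_block1 s1 s2 r1) (s,t) = s * (of_real r1 + of_real (1 / r1) * q)"
      unfolding bieval_family_blocks[OF r(1)] q_def ..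
    thus ?thesis using B[OF r(1)] by (simp add: norm_mult power_mult_distrib S_def k1_def)
  qed
  have e2: "(cmod (bieval (family_block2 s1 s2 r2) (s,t)))\<^sup>2 = T * (r2\<^sup>2 + 2 * R + k2 * (cmod q)\<^sup>2)"
  proof -
    have "bieval (family_block2 s1 s2 r2) (s,t) = t * (of_real r2 + of_real (1 / r2) * q)"
      unfolding bieval_family_blocks[OF r(2)] q_def ..
    thus ?thesis using B[OF r(2)] by (simp add: norm_mult power_mult_distrib T_def k2_def)
  qed
  have e3: "(cmod (bieval (bp 0 0 0 0 0 (of_real \<alpha>1) 0 (of_real \<beta>1) 0) (s,t)))\<^sup>2 = S * (\<beta>1\<^sup>2 * T\<^sup>2 + 2 * (\<alpha>1 * \<beta>1) * X + \<alpha>1\<^sup>2 * S\<^sup>2)" (is "?lhs = _")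
  proof -
    have "bieval (bp 0 0 0 0 0 (of_real \<alpha>1) 0 (of_real \<beta>1) 0) (s,t) = s * (of_real \<beta>1 * t\<^sup>2 + of_real \<alpha>1 * s\<^sup>2)"
      unfolding bieval_bp lf_def qf_def cf_def by (simp add: power2_eq_square power3_eq_cube algebra_simps)
    hence "?lhs = S * (cmod (of_real \<beta>1 * t\<^sup>2 + of_real \<alpha>1 * s\<^sup>2))\<^sup>2"
      by (simp add: norm_mult power_mult_distrib S_def)
    thus ?thesis unfolding cmod_lincomb_sq sq X' by (simp add: algebra_simps)
  qed
  have e4: "(cmod (bieval (bp 0 0 0 0 0 0 (of_real \<alpha>2) 0 (of_real \<beta>2)) (s,t)))\<^sup>2 = T * (\<beta>2\<^sup>2 * T\<^sup>2 + 2 * (\<alpha>2 * \<beta>2) * X + \<alpha>2\<^sup>2 * S\<^sup>2)" (is "?lhs = _")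
  proof -
    have "bieval (bp 0 0 0 0 0 0 (of_real \<alpha>2) 0 (of_real \<beta>2)) (s,t) = t * (of_real \<beta>2 * t\<^sup>2 + of_real \<alpha>2 * s\<^sup>2)"
      unfolding bieval_bp lf_def qf_def cf_def by (simp add: power2_eq_square power3_eq_cube algebra_simps)
    hence "?lhs = T * (cmod (of_real \<beta>2 * t\<^sup>2 + of_real \<alpha>2 * s\<^sup>2))\<^sup>2"
      by (simp add: norm_mult power_mult_distrib T_def)
    thus ?thesis unfolding cmod_lincomb_sq sq X' by (simp add: algebra_simps)
  qed
  have S3: "(cmod s ^ 3)\<^sup>2 = S ^ 3" unfolding S_def by (simp flip: power_mult)
  have e: "(cmod (bieval (bp 0 0 0 0 0 (of_real \<epsilon>1) 0 0 0) (s,t)))\<^sup>2 = \<epsilon>1\<^sup>2 * S ^ 3"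
    "(cmod (bieval (bp 0 0 0 0 0 0 (of_real \<epsilon>2) 0 0) (s,t)))\<^sup>2 = \<epsilon>2\<^sup>2 * S\<^sup>2 * T"
    "(cmod (bieval (bp 0 0 0 (of_real m1) 0 0 0 0 0) (s,t)))\<^sup>2 = m1\<^sup>2 * S * T"
    "(cmod (bieval (bp 0 0 (of_real m2) 0 0 0 0 0 0) (s,t)))\<^sup>2 = m2\<^sup>2 * S\<^sup>2"
    "(cmod (bieval (bp 0 0 0 0 (of_real m3) 0 0 0 0) (s,t)))\<^sup>2 = m3\<^sup>2 * T\<^sup>2"
    unfolding bieval_bp lf_def qf_def cf_def
    by (simp_all add: norm_mult power_mult_distrib norm_power S3 S_def[symmetric] T_def[symmetric] flip: power_mult)
      (simp_all add: S_def T_def flip: power_mult)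
  have T: "T = 1 - S" using st by (simp add: S_def T_def)
  have "(\<Sum>p\<leftarrow>family_map s1 s2 r1 r2 \<alpha>1 \<beta>1 \<alpha>2 \<beta>2 \<epsilon>1 \<epsilon>2 m1 m2 m3. (cmod (bieval p (s,t)))\<^sup>2)
    = S * (r1\<^sup>2 + 2 * R + k1 * (cmod q)\<^sup>2) + T * (r2\<^sup>2 + 2 * R + k2 * (cmod q)\<^sup>2)
    + S * (\<beta>1\<^sup>2 * T\<^sup>2 + 2 * (\<alpha>1 * \<beta>1) * X + (\<alpha>1\<^sup>2 + \<epsilon>1\<^sup>2) * S\<^sup>2) + T * (\<beta>2\<^sup>2 * T\<^sup>2 + 2 * (\<alpha>2 * \<beta>2) * X + (\<alpha>2\<^sup>2 + \<epsilon>2\<^sup>2) * S\<^sup>2)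
    + m1\<^sup>2 * S * T + m2\<^sup>2 * S\<^sup>2 + m3\<^sup>2 * T\<^sup>2"
    unfolding family_map_def list.map sum_list.Cons sum_list.Nil e1 e2 e3 e4 e
    by (simp add: power3_eq_cube power2_eq_square algebra_simps)
  also have "\<dots> = 1 + 2 * R + (cmod q)\<^sup>2"
    unfolding b1 c1 d1 b2 c2 d2 Q T a k1_def[symmetric] k2_def[symmetric] by algebra
  finally show ?thesis unfolding D .
qed

text \<open>The pivots are \<open>z1\<close>, \<open>z2\<close>, \<open>z1 z2\<^sup>2\<close>, \<open>z2\<^sup>3\<close>, \<open>z1\<^sup>3\<close>, \<open>z1\<^sup>2 z2\<close>, \<open>z1 z2\<close>, \<open>z1\<^sup>2\<close>, \<open>z2\<^sup>2\<close>.\<close>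
lemma family_map_echelon:
  assumes "r1 \<noteq> 0" "r2 \<noteq> 0" "\<beta>1 \<noteq> 0" "\<beta>2 \<noteq> 0"
  shows "echelon (family_map s1 s2 r1 r2 \<alpha>1 \<beta>1 \<alpha>2 \<beta>2 \<epsilon>1 \<epsilon>2 m1 m2 m3)"
proof -
  note D = family_block1_def family_block2_def cc_bp bp_eq_0
  have ex: "echelon (p # ps)" if "p = 0 \<or> cc p i j \<noteq> 0 \<and> (\<forall>q\<in>set ps. cc q i j = 0)" "echelon ps" for p ps i j
    using that by auto
  show ?thesis unfolding family_map_def
    apply (rule ex[where i = "Suc 0" and j = 0], use assms in \<open>simp add: D\<close>)
    apply (rule ex[where i = 0 and j = "Suc 0"], use assms in \<open>simp add: D\<close>)
    apply (rule ex[where i = "Suc 0" and j = 2], use assms in \<open>simp add: D\<close>)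
    apply (rule ex[where i = 0 and j = 3], use assms in \<open>simp add: D\<close>)
    apply (rule ex[where i = 3 and j = 0], simp add: D)
    apply (rule ex[where i = 2 and j = "Suc 0"], simp add: D)
    apply (rule ex[where i = "Suc 0" and j = "Suc 0"], simp add: D)
    apply (rule ex[where i = 2 and j = 0], simp add: D)
    apply (rule ex[where i = 0 and j = 2], simp add: D)
    apply simp
    done
qed

lemma family_map_cubic0: "p \<in> set (family_map s1 s2 r1 r2 \<alpha>1 \<beta>1 \<alpha>2 \<beta>2 \<epsilon>1 \<epsilon>2 m1 m2 m3) \<Longrightarrow> cubic0 p"
  unfolding family_map_def family_block1_def family_block2_def using cubic0_bp by auto

text \<open>The matrices with entries \<open>u_i, w_i, w_i, v_i\<close> must be positive semidefinite; then \<open>\<beta>_i\<close>, \<open>\<alpha>_i\<close>, \<open>\<epsilon>_i\<close> are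
the entries of their Cholesky factors. A singular matrix gives \<open>\<epsilon>_i = 0\<close> and saves a component.\<close>
lemma family_exists:
  fixes s1 s2 a1 a2 n1 n2 n3 :: real
  assumes \<sigma>: "(s1,s2) \<in> param_set" and a: "0 < a1" "a1 < 1" "0 < a2" "a2 < 1" and n: "0 \<le> n1" "0 \<le> n2" "0 \<le> n3"
    and u1: "u1 = a1 - n2 - s1\<^sup>2 * (1 / (1 - a1) - 1)" and v1: "v1 = 2 * a2 + a1 - n1 - n3 - s2\<^sup>2 * (1 / (1 - a1) - 1)"
    and w1: "w1 = - s1 * s2 * (1 / (1 - a1) - 1)"
    and u2: "u2 = 2 * a1 + a2 - n1 - n2 - s1\<^sup>2 * (1 / (1 - a2) - 1)" and v2: "v2 = a2 - n3 - s2\<^sup>2 * (1 / (1 - a2) - 1)"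
    and w2: "w2 = - s1 * s2 * (1 / (1 - a2) - 1)"
    and pos: "0 < v1" "0 < v2" "w1\<^sup>2 \<le> u1 * v1" "w2\<^sup>2 \<le> u2 * v2"
  shows "\<exists>P. reduced_pointed_cubic_sphere_map P (denom (s1,s2)) \<and> min_target_dim P = length P \<and>
    length P = 4 + of_bool (w1\<^sup>2 < u1 * v1) + of_bool (w2\<^sup>2 < u2 * v2) + of_bool (0 < n1) + of_bool (0 < n2) + of_bool (0 < n3)"
proof -
  define r1 r2 where "r1 = sqrt (1 - a1)" and "r2 = sqrt (1 - a2)"
  define \<beta>1 \<beta>2 where "\<beta>1 = sqrt v1" and "\<beta>2 = sqrt v2"
  define \<alpha>1 \<alpha>2 where "\<alpha>1 = w1 / \<beta>1" and "\<alpha>2 = w2 / \<beta>2"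
  define \<epsilon>1 \<epsilon>2 where "\<epsilon>1 = sqrt (u1 - w1\<^sup>2 / v1)" and "\<epsilon>2 = sqrt (u2 - w2\<^sup>2 / v2)"
  define m1 m2 m3 where "m1 = sqrt n1" and "m2 = sqrt n2" and "m3 = sqrt n3"
  have r: "r1 \<noteq> 0" "r2 \<noteq> 0" "r1\<^sup>2 = 1 - a1" "r2\<^sup>2 = 1 - a2" using a by (simp_all add: r1_def r2_def)
  have b: "\<beta>1 \<noteq> 0" "\<beta>2 \<noteq> 0" "\<beta>1\<^sup>2 = v1" "\<beta>2\<^sup>2 = v2" using pos by (simp_all add: \<beta>1_def \<beta>2_def)
  have m: "m1\<^sup>2 = n1" "m2\<^sup>2 = n2" "m3\<^sup>2 = n3" "m1 = 0 \<longleftrightarrow> \<not> 0 < n1" "m2 = 0 \<longleftrightarrow> \<not> 0 < n2" "m3 = 0 \<longleftrightarrow> \<not> 0 < n3"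
    using n by (auto simp: m1_def m2_def m3_def)
  have ge: "0 \<le> u1 - w1\<^sup>2 / v1" "0 \<le> u2 - w2\<^sup>2 / v2" using pos by (simp_all add: field_simps)
  have al: "\<alpha>1 * \<beta>1 = w1" "\<alpha>2 * \<beta>2 = w2" "\<alpha>1\<^sup>2 = w1\<^sup>2 / v1" "\<alpha>2\<^sup>2 = w2\<^sup>2 / v2"
    using b by (simp_all add: \<alpha>1_def \<alpha>2_def power_divide)
  have e: "\<epsilon>1\<^sup>2 = u1 - w1\<^sup>2 / v1" "\<epsilon>2\<^sup>2 = u2 - w2\<^sup>2 / v2" using ge by (simp_all add: \<epsilon>1_def \<epsilon>2_def)
  have e0: "\<epsilon>1 = 0 \<longleftrightarrow> \<not> w1\<^sup>2 < u1 * v1" "\<epsilon>2 = 0 \<longleftrightarrow> \<not> w2\<^sup>2 < u2 * v2"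
    using pos unfolding \<epsilon>1_def \<epsilon>2_def by (auto simp: field_simps)
  define Q where "Q = family_map s1 s2 r1 r2 \<alpha>1 \<beta>1 \<alpha>2 \<beta>2 \<epsilon>1 \<epsilon>2 m1 m2 m3"
  define P where "P = filter (\<lambda>p. p \<noteq> 0) Q"
  have "echelon P" unfolding P_def Q_def by (intro echelon_filter family_map_echelon r b)
  hence "min_target_dim P = length P" by (rule min_target_dim_echelon) (simp add: P_def)
  moreover have "length P = 4 + of_bool (w1\<^sup>2 < u1 * v1) + of_bool (w2\<^sup>2 < u2 * v2) + of_bool (0 < n1) + of_bool (0 < n2) + of_bool (0 < n3)"
    unfolding P_def Q_def family_map_def family_block1_def family_block2_def using r b by (simp add: bp_eq_0 e0 m)
  moreover have "reduced_pointed_cubic_sphere_map P (denom (s1,s2))"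
  proof (rule reduced_pointed_cubic_sphere_mapI[OF \<sigma>])
    show "cubic0 p" if "p \<in> set P" for p using that family_map_cubic0 unfolding P_def Q_def by auto
    show "(\<Sum>p\<leftarrow>P. (cmod (bieval p (s,t)))\<^sup>2) = (cmod (bieval (denom (s1,s2)) (s,t)))\<^sup>2" if st: "(cmod s)\<^sup>2 + (cmod t)\<^sup>2 = 1" for s t
    proof -
      have "(\<Sum>p\<leftarrow>P. (cmod (bieval p (s,t)))\<^sup>2) = (\<Sum>p\<leftarrow>Q. (cmod (bieval p (s,t)))\<^sup>2)"
        unfolding P_def by (rule sum_list_filter_nonzero) (simp add: bieval_zero)
      also have "\<dots> = (cmod (bieval (denom (s1,s2)) (s,t)))\<^sup>2" unfolding Q_def
        by (rule family_map_sphere[OF st r(1,2)]) (use al b e m in \<open>simp_all add: r(3,4) u1 v1 w1 u2 v2 w2\<close>)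
      finally show ?thesis .
    qed
    show "h dvd 1" if "h dvd denom (s1,s2)" "\<And>p. p \<in> set P \<Longrightarrow> h dvd p" for h
    proof (rule family_blocks_reduced[OF _ _ r(1,2) that(1)])
      have "family_block1 s1 s2 r1 \<in> set P" "family_block2 s1 s2 r2 \<in> set P"
        unfolding P_def Q_def family_map_def family_block1_def family_block2_def using r by (simp_all add: bp_eq_0)
      thus "h dvd family_block1 s1 s2 r1" "h dvd family_block2 s1 s2 r2" using that(2) by auto
    qed (use r a in auto)
    show "bp 0 0 0 0 0 0 (of_real \<alpha>2) 0 (of_real \<beta>2) \<in> set P"
      unfolding P_def Q_def family_map_def using b by (simp add: bp_eq_0)
    show "cc (bp 0 0 0 0 0 0 (of_real \<alpha>2) 0 (of_real \<beta>2)) 0 3 \<noteq> 0" using b by (simp add: cc_bp)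
  qed simp
  ultimately show ?thesis by blast
qed

section \<open>The choice of the parameters\<close>

text \<open>Up to a positive factor these are the determinants \<open>u1 v1 - w1\<^sup>2\<close> and \<open>u2 v2 - w2\<^sup>2\<close> for a map without
quadratic monomials.\<close>
definition slack1 :: "real \<Rightarrow> real \<Rightarrow> real \<Rightarrow> real \<Rightarrow> real" where
  "slack1 s1 s2 a1 a2 = (1 - a1 - s1\<^sup>2) * (2 * a2 + a1) - s2\<^sup>2 * a1"
definition slack2 :: "real \<Rightarrow> real \<Rightarrow> real \<Rightarrow> real \<Rightarrow> real" where
  "slack2 s1 s2 a1 a2 = (1 - a2 - s2\<^sup>2) * (2 * a1 + a2) - s1\<^sup>2 * a2"

lemma slack1_determinant:
  assumes "a1 < 1"
  defines "k \<equiv> 1 / (1 - a1) - 1"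
  shows "(a1 - s1\<^sup>2 * k) * (2 * a2 + a1 - s2\<^sup>2 * k) - (- s1 * s2 * k)\<^sup>2 = a1 / (1 - a1) * slack1 s1 s2 a1 a2"
    "(1 - a1) * (2 * a2 + a1 - s2\<^sup>2 * k) = slack1 s1 s2 a1 a2 + s1\<^sup>2 * (2 * a2 + a1)"
proof -
  define c where "c = 1 / (1 - a1)"
  have k: "k = a1 * c" "a1 / (1 - a1) = a1 * c" "c * (1 - a1) = 1" using assms(1) by (simp_all add: k_def c_def field_simps)
  show "(a1 - s1\<^sup>2 * k) * (2 * a2 + a1 - s2\<^sup>2 * k) - (- s1 * s2 * k)\<^sup>2 = a1 / (1 - a1) * slack1 s1 s2 a1 a2"
    unfolding slack1_def k(1,2) using k(3) by algebra
  show "(1 - a1) * (2 * a2 + a1 - s2\<^sup>2 * k) = slack1 s1 s2 a1 a2 + s1\<^sup>2 * (2 * a2 + a1)"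
    unfolding slack1_def k(1) using k(3) by algebra
qed

lemma slack2_determinant:
  assumes "a2 < 1"
  defines "k \<equiv> 1 / (1 - a2) - 1"
  shows "(2 * a1 + a2 - s1\<^sup>2 * k) * (a2 - s2\<^sup>2 * k) - (- s1 * s2 * k)\<^sup>2 = a2 / (1 - a2) * slack2 s1 s2 a1 a2"
    "(1 - a2) * (2 * a1 + a2) * (a2 - s2\<^sup>2 * k) = a2 * (slack2 s1 s2 a1 a2 + s1\<^sup>2 * a2)"
proof -
  define c where "c = 1 / (1 - a2)"
  have k: "k = a2 * c" "a2 / (1 - a2) = a2 * c" "c * (1 - a2) = 1" using assms(1) by (simp_all add: k_def c_def field_simps)
  show "(2 * a1 + a2 - s1\<^sup>2 * k) * (a2 - s2\<^sup>2 * k) - (- s1 * s2 * k)\<^sup>2 = a2 / (1 - a2) * slack2 s1 s2 a1 a2"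
    unfolding slack2_def k(1,2) using k(3) by algebra
  show "(1 - a2) * (2 * a1 + a2) * (a2 - s2\<^sup>2 * k) = a2 * (slack2 s1 s2 a1 a2 + s1\<^sup>2 * a2)"
    unfolding slack2_def k(1) using k(3) by algebra
qed

text \<open>If both slacks are positive, the conditions remain strict when small multiples \<open>d\<close> of \<open>|z1 z2|\<^sup>2\<close>,
\<open>|z1|\<^sup>4\<close>, \<open>|z2|\<^sup>4\<close> are split off; each of them adds one dimension.\<close>
lemma exists_from_slacks:
  assumes \<sigma>: "(s1,s2) \<in> param_set" and a: "0 < a1" "a1 < 1" "0 < a2" "a2 < 1"
    and F: "0 \<le> slack1 s1 s2 a1 a2" "0 \<le> slack2 s1 s2 a1 a2" and s: "s1 \<noteq> 0 \<or> 0 < slack1 s1 s2 a1 a2 \<and> 0 < slack2 s1 s2 a1 a2"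
  shows "\<exists>P. reduced_pointed_cubic_sphere_map P (denom (s1,s2)) \<and> min_target_dim P = length P \<and>
    length P = 4 + of_bool (0 < slack1 s1 s2 a1 a2) + of_bool (0 < slack2 s1 s2 a1 a2)"
    "0 < slack1 s1 s2 a1 a2 \<Longrightarrow> 0 < slack2 s1 s2 a1 a2 \<Longrightarrow> c \<in> {0..3::nat} \<Longrightarrow> \<exists>P. reduced_pointed_cubic_sphere_map P (denom (s1,s2)) \<and> min_target_dim P = length P \<and>
    length P = 6 + c"
proof -
  define k1 k2 where "k1 = 1 / (1 - a1) - 1" and "k2 = 1 / (1 - a2) - 1"
  define u1 v1 w1 where "u1 = a1 - s1\<^sup>2 * k1" and "v1 = 2 * a2 + a1 - s2\<^sup>2 * k1" and "w1 = - s1 * s2 * k1"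
  define u2 v2 w2 where "u2 = 2 * a1 + a2 - s1\<^sup>2 * k2" and "v2 = a2 - s2\<^sup>2 * k2" and "w2 = - s1 * s2 * k2"
  note D1 = slack1_determinant[OF a(2), where ?s1.0 = s1 and ?s2.0 = s2 and ?a2.0 = a2, folded k1_def, folded u1_def v1_def w1_def]
  note D2 = slack2_determinant[OF a(4), where ?s1.0 = s1 and ?s2.0 = s2 and ?a1.0 = a1, folded k2_def, folded u2_def v2_def w2_def]
  have "0 < slack1 s1 s2 a1 a2 \<or> 0 < s1\<^sup>2" "0 < slack2 s1 s2 a1 a2 \<or> 0 < s1\<^sup>2" using s by auto
  moreover have "0 \<le> s1\<^sup>2 * (2 * a2 + a1)" "0 \<le> s1\<^sup>2 * a2" "0 < s1\<^sup>2 \<Longrightarrow> 0 < s1\<^sup>2 * (2 * a2 + a1)" "0 < s1\<^sup>2 \<Longrightarrow> 0 < s1\<^sup>2 * a2"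
    using a by simp_all
  ultimately have "0 < slack1 s1 s2 a1 a2 + s1\<^sup>2 * (2 * a2 + a1)" "0 < slack2 s1 s2 a1 a2 + s1\<^sup>2 * a2" using F by linarith+
  hence "0 < (1 - a1) * v1" "0 < ((1 - a2) * (2 * a1 + a2)) * v2" using a unfolding D1(2) D2(2) by simp_all
  moreover have "0 < (1 - a2) * (2 * a1 + a2)" using a by simp
  ultimately have v1: "0 < v1" and v2: "0 < v2" using a by (simp_all only: zero_less_mult_pos diff_gt_0_iff_gt)
  have "0 < a1 / (1 - a1)" "0 < a2 / (1 - a2)" using a by simp_all
  hence "0 \<le> u1 * v1 - w1\<^sup>2" "0 \<le> u2 * v2 - w2\<^sup>2" "0 < u1 * v1 - w1\<^sup>2 \<longleftrightarrow> 0 < slack1 s1 s2 a1 a2" "0 < u2 * v2 - w2\<^sup>2 \<longleftrightarrow> 0 < slack2 s1 s2 a1 a2"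
    unfolding D1(1) D2(1) using F by (simp_all only: zero_less_mult_iff zero_le_mult_iff) auto
  hence w: "w1\<^sup>2 \<le> u1 * v1" "w2\<^sup>2 \<le> u2 * v2" and w': "w1\<^sup>2 < u1 * v1 \<longleftrightarrow> 0 < slack1 s1 s2 a1 a2" "w2\<^sup>2 < u2 * v2 \<longleftrightarrow> 0 < slack2 s1 s2 a1 a2"
    by simp_all
  show "\<exists>P. reduced_pointed_cubic_sphere_map P (denom (s1,s2)) \<and> min_target_dim P = length P \<and>
    length P = 4 + of_bool (0 < slack1 s1 s2 a1 a2) + of_bool (0 < slack2 s1 s2 a1 a2)"
    using family_exists[OF \<sigma> a order_refl order_refl order_refl refl refl refl refl refl refl] v1 v2 w
    unfolding k1_def[symmetric] k2_def[symmetric] diff_0_right u1_def[symmetric] v1_def[symmetric] w1_def[symmetric] u2_def[symmetric] v2_def[symmetric] w2_def[symmetric] w'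
    by simp
  assume FF: "0 < slack1 s1 s2 a1 a2" "0 < slack2 s1 s2 a1 a2" and c: "c \<in> {0..3::nat}"
  define c1 c2 c3 :: real where "c1 = of_bool (1 \<le> c)" and "c2 = of_bool (2 \<le> c)" and "c3 = of_bool (3 \<le> c)"
  have small: "\<forall>\<^sub>F d in at_right 0. 0 < d \<and> 0 < v1 - c1 * d - c3 * d \<and> 0 < v2 - c3 * d \<and>
     w1\<^sup>2 < (u1 - c2 * d) * (v1 - c1 * d - c3 * d) \<and> w2\<^sup>2 < (u2 - c1 * d - c2 * d) * (v2 - c3 * d)"
  proof (intro eventually_conj)
    show "\<forall>\<^sub>F d in at_right 0. (0::real) < d" by (rule eventually_at_right_less)
    have "((\<lambda>d. v1 - c1 * d - c3 * d) \<longlongrightarrow> v1) (at_right 0)" by (auto intro!: tendsto_eq_intros)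
    thus "\<forall>\<^sub>F d in at_right 0. 0 < v1 - c1 * d - c3 * d" using v1 by (rule order_tendstoD)
    have "((\<lambda>d. v2 - c3 * d) \<longlongrightarrow> v2) (at_right 0)" by (auto intro!: tendsto_eq_intros)
    thus "\<forall>\<^sub>F d in at_right 0. 0 < v2 - c3 * d" using v2 by (rule order_tendstoD)
    have "((\<lambda>d. (u1 - c2 * d) * (v1 - c1 * d - c3 * d)) \<longlongrightarrow> u1 * v1) (at_right 0)" by (auto intro!: tendsto_eq_intros)
    thus "\<forall>\<^sub>F d in at_right 0. w1\<^sup>2 < (u1 - c2 * d) * (v1 - c1 * d - c3 * d)" by (rule order_tendstoD) (use w' FF in simp)
    have "((\<lambda>d. (u2 - c1 * d - c2 * d) * (v2 - c3 * d)) \<longlongrightarrow> u2 * v2) (at_right 0)" by (auto intro!: tendsto_eq_intros)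
    thus "\<forall>\<^sub>F d in at_right 0. w2\<^sup>2 < (u2 - c1 * d - c2 * d) * (v2 - c3 * d)" by (rule order_tendstoD) (use w' FF in simp)
  qed
  then obtain d where d: "0 < d" "0 < v1 - c1 * d - c3 * d" "0 < v2 - c3 * d"
    "w1\<^sup>2 < (u1 - c2 * d) * (v1 - c1 * d - c3 * d)" "w2\<^sup>2 < (u2 - c1 * d - c2 * d) * (v2 - c3 * d)"
    using eventually_happens[OF small] by auto
  have n: "0 \<le> c1 * d" "0 \<le> c2 * d" "0 \<le> c3 * d" using d(1) by (simp_all add: c1_def c2_def c3_def)
  have "\<exists>P. reduced_pointed_cubic_sphere_map P (denom (s1,s2)) \<and> min_target_dim P = length P \<and>
    length P = 4 + of_bool (w1\<^sup>2 < (u1 - c2 * d) * (v1 - c1 * d - c3 * d)) + of_bool (w2\<^sup>2 < (u2 - c1 * d - c2 * d) * (v2 - c3 * d))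
       + of_bool (0 < c1 * d) + of_bool (0 < c2 * d) + of_bool (0 < c3 * d)"
    by (rule family_exists[OF \<sigma> a n _ _ _ _ _ _ d(2,3)])
      (use d in \<open>simp_all add: u1_def v1_def w1_def u2_def v2_def w2_def k1_def k2_def\<close>)
  moreover have "(of_bool (0 < c1 * d) + of_bool (0 < c2 * d) + of_bool (0 < c3 * d) :: nat) = c"
    using d(1) c by (auto simp: c1_def c2_def c3_def zero_less_mult_iff)
  ultimately show "\<exists>P. reduced_pointed_cubic_sphere_map P (denom (s1,s2)) \<and> min_target_dim P = length P \<and> length P = 6 + c"
    using d(4,5) by (simp add: add.assoc)
qed

text \<open>For \<open>a2 = r a1\<close> the equation \<open>slack1 = 0\<close> has the solution \<open>a1 = A(r)\<close>, and \<open>slack2\<close> is then \<open>A(r)\<close> times the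
difference of the two sides of the last inequality. Let \<open>r0\<close> be the least \<open>r \<ge> 0\<close> with \<open>A(r) \<ge> 0\<close>. If
\<open>r0 > 0\<close>, the difference at \<open>r0\<close> is \<open>D / (2 x)\<close>, where
\<open>D = ((p + q)\<^sup>2 - 1) (1 - (q - p)\<^sup>2)\<close> with \<open>p = sqrt x\<close>, \<open>q = sqrt y\<close>, and this is positive precisely by
the condition \<open>p + q > 1\<close>. If \<open>r0 = 0\<close>, the difference is \<open>2 y\<close>. Values of \<open>r\<close> slightly larger than \<open>r0\<close>
serve the purpose.\<close>
lemma exists_ray:
  assumes \<sigma>: "(s1,s2) \<in> param_set"
  obtains r A where "0 < r" "0 < A" "A = 1 - s1\<^sup>2 - s2\<^sup>2 / (2 * r + 1)" "s1\<^sup>2 * r < (1 - s2\<^sup>2 - r * A) * (2 + r)"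
proof -
  define x y where "x = 1 - s1\<^sup>2" and "y = 1 - s2\<^sup>2"
  have s: "0 \<le> s2" "s2 \<le> s1" "s1 < 1" and pq: "1 < sqrt x + sqrt y" using \<sigma> by (auto simp: param_set_def x_def y_def)
  have s2: "s1\<^sup>2 < 1" "s2\<^sup>2 \<le> s1\<^sup>2" using s by (auto simp: power_less_one_iff abs_square_less_1 intro: power_mono)
  hence xy: "0 < x" "x \<le> y" "y \<le> 1" by (auto simp: x_def y_def)
  define D where "D = 2 * x + 2 * y - 1 - (x - y)\<^sup>2"
  have "0 < D"
  proof -
    define p q where "p = sqrt x" and "q = sqrt y"
    have sq: "x = p\<^sup>2" "y = q\<^sup>2" using xy by (simp_all add: p_def q_def)
    have pos: "0 < p" "p \<le> q" "q \<le> 1" "1 < p + q" using xy pq by (simp_all add: p_def q_def)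
    have "D = ((p + q) - 1) * ((p + q) + 1) * ((1 - (q - p)) * (1 + (q - p)))" unfolding D_def sq by algebra
    also have "\<dots> > 0" using pos by (intro mult_pos_pos) auto
    finally show ?thesis .
  qed
  define r0 where "r0 = max 0 ((1 - x - y) / (2 * x))"
  define A where "A r = x - (1 - y) / (2 * r + 1)" for r
  have r0: "0 \<le> r0" "0 \<le> 2 * x * r0 + x + y - 1"
    using xy by (auto simp: r0_def max_def field_simps)
  have A_pos: "0 < A r" if "r0 < r" for r
  proof -
    have "0 \<le> 2 * x * r0 + x + y - 1" by (rule r0)
    also have "\<dots> < 2 * x * r + x + y - 1" using that xy by simp
    finally show ?thesis using that r0 unfolding A_def by (simp add: field_simps)
  qed
  have G0: "0 < (y - r0 * A r0) * (2 + r0) - (1 - x) * r0"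
  proof (cases "1 - x - y \<le> 0")
    case True
    hence "(1 - x - y) / (2 * x) \<le> 0" using xy by (simp add: divide_nonpos_pos)
    hence "r0 = 0" by (simp add: r0_def)
    thus ?thesis using xy by simp
  next
    case False
    hence r: "r0 = (1 - x - y) / (2 * x)" using xy by (simp add: r0_def max_def)
    have rx: "2 * x * r0 = 1 - x - y" using xy by (simp add: r)
    hence "(1 - y) = x * (2 * r0 + 1)" by (simp add: algebra_simps)
    hence A0: "A r0 = 0" using r0(1) by (simp add: A_def)
    have "2 * x * (y * (2 + r0) - (1 - x) * r0) = 4 * x * y - (1 - x - y) * (2 * x * r0)" by (simp add: algebra_simps)
    also have "\<dots> = D" unfolding rx D_def by algebra
    finally have "0 < (2 * x) * (y * (2 + r0) - (1 - x) * r0)" using \<open>0 < D\<close> by simp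
    moreover have "0 < 2 * x" using xy by simp
    ultimately have "0 < y * (2 + r0) - (1 - x) * r0" by (simp only: zero_less_mult_pos)
    thus ?thesis using A0 by simp
  qed
  have "((\<lambda>r. (y - r * A r) * (2 + r) - (1 - x) * r) \<longlongrightarrow> (y - r0 * A r0) * (2 + r0) - (1 - x) * r0) (at_right r0)"
    unfolding A_def using r0(1) by (auto intro!: tendsto_eq_intros)
  hence "\<forall>\<^sub>F r in at_right r0. 0 < (y - r * A r) * (2 + r) - (1 - x) * r" using G0 by (rule order_tendstoD)
  hence ev: "\<forall>\<^sub>F r in at_right r0. r0 < r \<and> 0 < (y - r * A r) * (2 + r) - (1 - x) * r"
    by (intro eventually_conj eventually_at_right_less)
  obtain r where "r0 < r" "0 < (y - r * A r) * (2 + r) - (1 - x) * r" using eventually_happens[OF ev] by auto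
  thus ?thesis using that[of r "A r"] A_pos r0(1) by (simp add: A_def x_def y_def)
qed

lemma slack_on_ray: "slack1 s1 s2 a (r * a) = a * ((1 - s1\<^sup>2 - a) * (2 * r + 1) - s2\<^sup>2)"
  "slack2 s1 s2 a (r * a) = a * ((1 - s2\<^sup>2 - r * a) * (2 + r) - s1\<^sup>2 * r)"
  unfolding slack1_def slack2_def by (simp_all add: power2_eq_square algebra_simps)

text \<open>On the ray through a point with \<open>slack1 = 0 < slack2\<close> both slacks are positive closer to the origin.\<close>
theorem exists_dim_6_to_9:
  assumes \<sigma>: "(s1,s2) \<in> param_set" and N: "6 \<le> N" "N \<le> 9"
  shows "\<exists>P. reduced_pointed_cubic_sphere_map P (denom (s1,s2)) \<and> min_target_dim P = length P \<and> length P = N"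
proof -
  obtain r A where r: "0 < r" "0 < A" "A = 1 - s1\<^sup>2 - s2\<^sup>2 / (2 * r + 1)" "s1\<^sup>2 * r < (1 - s2\<^sup>2 - r * A) * (2 + r)"
    by (rule exists_ray[OF \<sigma>])
  define a where "a = A / 2"
  have a: "0 < a" "a < A" using r by (simp_all add: a_def)
  have "0 \<le> s2\<^sup>2 / (2 * r + 1)" using r(1) by simp
  hence A1: "A \<le> 1" unfolding r(3) using zero_le_power2[of s1] by linarith
  have "0 \<le> s1\<^sup>2 * r" using r(1) by simp
  hence "0 < (1 - s2\<^sup>2 - r * A) * (2 + r)" using r(4) by linarith
  hence "0 < 1 - s2\<^sup>2 - r * A" using r(1) by (simp add: zero_less_mult_iff)
  hence rA: "r * A < 1" using zero_le_power2[of s2] by linarith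
  have ra: "r * a < r * A" using a r(1) by simp
  have "r * a < 1" using ra rA by linarith
  have "(1 - s1\<^sup>2 - A) * (2 * r + 1) = s2\<^sup>2" using r(1) by (simp add: r(3))
  moreover have "(1 - s1\<^sup>2 - A) * (2 * r + 1) < (1 - s1\<^sup>2 - a) * (2 * r + 1)" using a r(1) by simp
  ultimately have 1: "0 < slack1 s1 s2 a (r * a)" unfolding slack_on_ray using a(1) by simp
  have "(1 - s2\<^sup>2 - r * A) * (2 + r) < (1 - s2\<^sup>2 - r * a) * (2 + r)" using ra r by simp
  hence 2: "0 < slack2 s1 s2 a (r * a)" unfolding slack_on_ray using a r(4) by simp
  obtain c where c: "N = 6 + c" using N by (metis le_iff_add)
  show ?thesis unfolding c
    by (rule exists_from_slacks(2)[OF \<sigma> a(1) _ _ _ less_imp_le[OF 1] less_imp_le[OF 2] _ 1 2])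
       (use a A1 \<open>r * a < 1\<close> r(1) 1 2 N c in auto)
qed

text \<open>On the curve \<open>slack1 = 0\<close> the point provided by the previous lemmas has \<open>slack2 > 0\<close>, which leaves five
components. Since \<open>A(r)\<close> does not decrease, \<open>r A(r)\<close> exceeds \<open>1\<close> for large \<open>r\<close>, where \<open>slack2\<close> is
negative; a zero in between leaves four components.\<close>
theorem exists_dim_4_5:
  assumes \<sigma>: "(s1,s2) \<in> param_set" and s1: "s1 \<noteq> 0"
  shows "\<exists>P. reduced_pointed_cubic_sphere_map P (denom (s1,s2)) \<and> min_target_dim P = length P \<and> length P = 4"
    "\<exists>P. reduced_pointed_cubic_sphere_map P (denom (s1,s2)) \<and> min_target_dim P = length P \<and> length P = 5"
proof -
  obtain r A where r: "0 < r" "0 < A" "A = 1 - s1\<^sup>2 - s2\<^sup>2 / (2 * r + 1)" "s1\<^sup>2 * r < (1 - s2\<^sup>2 - r * A) * (2 + r)"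
    by (rule exists_ray[OF \<sigma>])
  define a where "a r = 1 - s1\<^sup>2 - s2\<^sup>2 / (2 * r + 1)" for r
  define G where "G r = (1 - s2\<^sup>2 - r * a r) * (2 + r) - s1\<^sup>2 * r" for r
  have A: "a r = A" using r by (simp add: a_def)
  have a1: "a t < 1" if "0 < t" for t
  proof -
    have "0 \<le> s2\<^sup>2 / (2 * t + 1)" using that by simp
    moreover have "0 < s1\<^sup>2" using s1 by simp
    ultimately show ?thesis unfolding a_def by linarith
  qed
  have Fa: "slack1 s1 s2 (a t) (t * a t) = 0" "slack2 s1 s2 (a t) (t * a t) = a t * G t" if "0 < t" for t
    using that unfolding slack_on_ray by (simp_all add: a_def G_def)
  have ta: "t * a t < 1" if "0 < t" "0 \<le> G t" for t
  proof -
    have "0 < (1 - s2\<^sup>2 - t * a t) * (2 + t)" 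
    proof -
      have "0 < s1\<^sup>2 * t" using that(1) s1 by simp
      thus ?thesis using that(2) unfolding G_def by linarith
    qed
    hence "0 < 1 - s2\<^sup>2 - t * a t" using that(1) by (simp add: zero_less_mult_iff)
    thus ?thesis using zero_le_power2[of s2] by linarith
  qed
  have ex: "\<exists>P. reduced_pointed_cubic_sphere_map P (denom (s1,s2)) \<and> min_target_dim P = length P \<and> length P = 4 + of_bool (0 < G t)"
    if t: "0 < t" "0 < a t" "0 \<le> G t" for t
    using exists_from_slacks(1)[OF \<sigma> t(2) a1[OF t(1)] mult_pos_pos[OF t(1,2)] ta[OF t(1,3)]] s1 t
    unfolding Fa[OF t(1)] by (simp add: zero_less_mult_iff)
  have Gr: "0 < G r" using r(4) by (simp add: G_def A)
  show "\<exists>P. reduced_pointed_cubic_sphere_map P (denom (s1,s2)) \<and> min_target_dim P = length P \<and> length P = 5"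
    using ex[of r] r A Gr by simp
  have mono: "A \<le> a t" if "r \<le> t" for t
    using that r(1) unfolding a_def r(3) by (simp add: frac_le)
  define R where "R = max r (1 / A)"
  have R: "r \<le> R" "1 \<le> R * A" using r(2) by (auto simp: R_def max_def field_simps)
  have "G R \<le> 0"
  proof -
    have "R * A \<le> R * a R" using mono[OF R(1)] R(1) r(1) by simp
    hence "1 - s2\<^sup>2 - R * a R \<le> 0" using R(2) zero_le_power2[of s2] by linarith
    hence "(1 - s2\<^sup>2 - R * a R) * (2 + R) \<le> 0" using R(1) r(1) by (simp add: mult_nonpos_nonneg)
    moreover have "0 \<le> s1\<^sup>2 * R" using R(1) r(1) by simp
    ultimately show ?thesis unfolding G_def by linarith
  qed
  moreover have "continuous_on {r..R} G" unfolding G_def a_def using r(1) by (auto intro!: continuous_intros)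
  ultimately obtain t where t: "r \<le> t" "t \<le> R" "G t = 0" using IVT2'[of G R 0 r] Gr R(1) by auto
  show "\<exists>P. reduced_pointed_cubic_sphere_map P (denom (s1,s2)) \<and> min_target_dim P = length P \<and> length P = 4"
    using ex[of t] t mono[OF t(1)] r by simp
qed

section \<open>Monomial maps\<close>

definition monomial_map :: "real \<Rightarrow> real \<Rightarrow> real \<Rightarrow> real \<Rightarrow> real \<Rightarrow> real \<Rightarrow> bipoly list" where
  "monomial_map c10 c11 c30 c21 c12 c03 =
    [bp (of_real c10) 0 0 0 0 0 0 0 0, bp 0 0 0 (of_real c11) 0 0 0 0 0, bp 0 0 0 0 0 (of_real c30) 0 0 0,
     bp 0 0 0 0 0 0 (of_real c21) 0 0, bp 0 0 0 0 0 0 0 (of_real c12) 0, bp 0 0 0 0 0 0 0 0 (of_real c03)]"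

lemma monomial_map_echelon: "echelon (monomial_map c10 c11 c30 c21 c12 c03)"
proof -
  have ex: "echelon (p # ps)" if "p = 0 \<or> cc p i j \<noteq> 0 \<and> (\<forall>q\<in>set ps. cc q i j = 0)" "echelon ps" for p ps i j
    using that by auto
  show ?thesis unfolding monomial_map_def
    apply (rule ex[where i = "Suc 0" and j = 0], simp add: cc_bp bp_eq_0)
    apply (rule ex[where i = "Suc 0" and j = "Suc 0"], simp add: cc_bp bp_eq_0)
    apply (rule ex[where i = 3 and j = 0], simp add: cc_bp bp_eq_0)
    apply (rule ex[where i = 2 and j = "Suc 0"], simp add: cc_bp bp_eq_0)
    apply (rule ex[where i = "Suc 0" and j = 2], simp add: cc_bp bp_eq_0)
    apply (rule ex[where i = 0 and j = 3], simp add: cc_bp bp_eq_0)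
    apply simp
    done
qed

lemma monomial_map_exists:
  assumes c: "0 \<le> c10" "0 \<le> c11" "0 \<le> c30" "0 \<le> c21" "0 \<le> c12" "0 < c03"
    and sph: "\<And>S T :: real. S + T = 1 \<Longrightarrow> c10 * S + c11 * S * T + c30 * S ^ 3 + c21 * S\<^sup>2 * T + c12 * S * T\<^sup>2 + c03 * T ^ 3 = 1"
  shows "\<exists>P. reduced_pointed_cubic_sphere_map P (denom (0,0)) \<and> min_target_dim P = length P \<and>
    length P = 1 + of_bool (0 < c10) + of_bool (0 < c11) + of_bool (0 < c30) + of_bool (0 < c21) + of_bool (0 < c12)"
proof -
  define Q where "Q = monomial_map (sqrt c10) (sqrt c11) (sqrt c30) (sqrt c21) (sqrt c12) (sqrt c03)"
  define P where "P = filter (\<lambda>p. p \<noteq> 0) Q"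
  have "echelon P" unfolding P_def Q_def by (intro echelon_filter monomial_map_echelon)
  hence "min_target_dim P = length P" by (rule min_target_dim_echelon) (simp add: P_def)
  moreover have "length P = 1 + of_bool (0 < c10) + of_bool (0 < c11) + of_bool (0 < c30) + of_bool (0 < c21) + of_bool (0 < c12)"
    unfolding P_def Q_def monomial_map_def using c by (simp add: bp_eq_0 less_le)
  moreover have "reduced_pointed_cubic_sphere_map P (denom (0,0))"
  proof (rule reduced_pointed_cubic_sphere_mapI)
    show "(0,0) \<in> param_set" by (simp add: param_set_def)
    show "cubic0 p" if "p \<in> set P" for p
    proof -
      have "p \<in> set Q" using that by (simp add: P_def)
      thus ?thesis unfolding Q_def monomial_map_def using cubic0_bp by auto
    qed
    show "(\<Sum>p\<leftarrow>P. (cmod (bieval p (s,t)))\<^sup>2) = (cmod (bieval (denom (0,0)) (s,t)))\<^sup>2" if st: "(cmod s)\<^sup>2 + (cmod t)\<^sup>2 = 1" for s t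
    proof -
      have "(\<Sum>p\<leftarrow>P. (cmod (bieval p (s,t)))\<^sup>2) = (\<Sum>p\<leftarrow>Q. (cmod (bieval p (s,t)))\<^sup>2)"
        unfolding P_def by (rule sum_list_filter_nonzero) (simp add: bieval_zero)
      also have "\<dots> = c10 * (cmod s)\<^sup>2 + c11 * (cmod s)\<^sup>2 * (cmod t)\<^sup>2 + c30 * ((cmod s)\<^sup>2) ^ 3 + c21 * ((cmod s)\<^sup>2)\<^sup>2 * (cmod t)\<^sup>2
          + c12 * (cmod s)\<^sup>2 * ((cmod t)\<^sup>2)\<^sup>2 + c03 * ((cmod t)\<^sup>2) ^ 3"
        unfolding Q_def monomial_map_def using c
        by (simp add: bieval_bp lf_def qf_def cf_def norm_mult norm_power power_mult_distrib flip: power_mult)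
      also have "\<dots> = 1" by (rule sph[OF st])
      finally show ?thesis by (simp add: bieval_denom)
    qed
    show "h dvd 1" if "h dvd denom (0,0)" for h
      using that by (simp add: denom_def flip: one_pCons)
    show "bp 0 0 0 0 0 0 0 0 (of_real (sqrt c03)) \<in> set P"
      unfolding P_def Q_def monomial_map_def using c by (simp add: bp_eq_0)
    show "cc (bp 0 0 0 0 0 0 0 0 (of_real (sqrt c03))) 0 3 \<noteq> 0" using c by (simp add: cc_bp)
  qed simp
  ultimately show ?thesis by blast
qed

text \<open>The identities are \<open>(S + T)\<^sup>3 = 1\<close>, the same with \<open>3 S\<^sup>2 T + 3 S T\<^sup>2\<close> replaced by \<open>3 S T\<close>, and
\<open>S / 2 + (S / 2 + T) (S + T)\<^sup>2 = 1\<close>.\<close>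
theorem exists_dim_3_4_5_constant_denominator:
  assumes "3 \<le> N" "N \<le> 5"
  shows "\<exists>P. reduced_pointed_cubic_sphere_map P (denom (0,0)) \<and> min_target_dim P = length P \<and> length P = N"
proof -
  have T: "T = 1 - S" if "S + T = 1" for S T :: real using that by simp
  consider "N = 3" | "N = 4" | "N = 5" using assms by linarith
  thus ?thesis
  proof cases
    case 1
    have "0 * S + 3 * S * T + 1 * S ^ 3 + 0 * S\<^sup>2 * T + 0 * S * T\<^sup>2 + 1 * T ^ 3 = 1" if "S + T = 1" for S T :: real
      unfolding T[OF that] by (simp add: power2_eq_square power3_eq_cube algebra_simps)
    from monomial_map_exists[OF _ _ _ _ _ _ this] show ?thesis unfolding 1 by (simp add: eval_nat_numeral)
  next
    case 2
    have "0 * S + 0 * S * T + 1 * S ^ 3 + 3 * S\<^sup>2 * T + 3 * S * T\<^sup>2 + 1 * T ^ 3 = 1" if "S + T = 1" for S T :: real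
      unfolding T[OF that] by (simp add: power2_eq_square power3_eq_cube algebra_simps)
    from monomial_map_exists[OF _ _ _ _ _ _ this] show ?thesis unfolding 2 by (simp add: eval_nat_numeral)
  next
    case 3
    have "1/2 * S + 0 * S * T + 1/2 * S ^ 3 + 2 * S\<^sup>2 * T + 5/2 * S * T\<^sup>2 + 1 * T ^ 3 = 1" if "S + T = 1" for S T :: real
      unfolding T[OF that] by (simp add: power2_eq_square power3_eq_cube algebra_simps)
    from monomial_map_exists[OF _ _ _ _ _ _ this] show ?thesis unfolding 3 by (simp add: eval_nat_numeral)
  qed
qed

section \<open>The dimensions that occur\<close>

theorem theorem1p3:
  fixes \<sigma> :: "real \<times> real" and N :: nat
  assumes "\<sigma> \<in> param_set" and "N > 0"
  shows
    "(\<sigma> \<noteq> (0, 0) \<longrightarrow>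
        ((\<exists>P. reduced_pointed_cubic_sphere_map P (denom \<sigma>) \<and> min_target_dim P = N)
           \<longleftrightarrow> 4 \<le> N \<and> N \<le> 9)) \<and>
     (\<sigma> = (0, 0) \<longrightarrow>
        ((\<exists>P. reduced_pointed_cubic_sphere_map P (denom \<sigma>) \<and> min_target_dim P = N)
           \<longleftrightarrow> 3 \<le> N \<and> N \<le> 9)) \<and>
     (\<forall>\<tau>\<in>param_set. \<tau> \<noteq> (0, 0) \<longrightarrow>
        (\<exists>P. reduced_pointed_cubic_sphere_map P (denom \<tau>) \<and> length P = 4) \<and>
        (\<forall>P. reduced_pointed_cubic_sphere_map P (denom \<tau>) \<longrightarrow> 4 \<le> length P))"
proof -
  have ex: "\<exists>P. reduced_pointed_cubic_sphere_map P (denom \<tau>) \<and> min_target_dim P = length P \<and> length P = M"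
    if \<tau>: "\<tau> \<in> param_set" "\<tau> \<noteq> (0,0)" and M: "4 \<le> M" "M \<le> 9" for \<tau> M
  proof -
    obtain s1 s2 where s: "\<tau> = (s1,s2)" by (cases \<tau>)
    have "s1 \<noteq> 0" using \<tau> by (auto simp: s param_set_def)
    moreover have "M = 4 \<or> M = 5 \<or> 6 \<le> M" using M by linarith
    ultimately show ?thesis using exists_dim_4_5 exists_dim_6_to_9 \<tau> M unfolding s by blast
  qed
  have ex0: "\<exists>P. reduced_pointed_cubic_sphere_map P (denom (0,0)) \<and> min_target_dim P = length P \<and> length P = M"
    if M: "3 \<le> M" "M \<le> 9" for M
  proof (cases "M \<le> 5")
    case True
    thus ?thesis using exists_dim_3_4_5_constant_denominator M by blast
  next
    case False
    thus ?thesis using exists_dim_6_to_9[of 0 0 M] M by (simp add: param_set_def)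
  qed
  show ?thesis
  proof (intro conjI impI ballI iffI allI)
    show "\<exists>P. reduced_pointed_cubic_sphere_map P (denom \<sigma>) \<and> min_target_dim P = N" if "\<sigma> \<noteq> (0,0)" "4 \<le> N \<and> N \<le> 9"
      using ex[OF assms(1) that(1)] that(2) by blast
    show "\<exists>P. reduced_pointed_cubic_sphere_map P (denom \<sigma>) \<and> min_target_dim P = N" if "\<sigma> = (0,0)" "3 \<le> N \<and> N \<le> 9"
      using ex0 that by metis
    fix \<tau> assume \<tau>: "\<tau> \<in> param_set" "\<tau> \<noteq> (0,0)"
    show "\<exists>P. reduced_pointed_cubic_sphere_map P (denom \<tau>) \<and> length P = 4" using ex[OF \<tau>, of 4] by auto
    show "4 \<le> length P" if "reduced_pointed_cubic_sphere_map P (denom \<tau>)" for P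
      using min_target_dim_ge_4[OF that \<tau>] min_target_dim_le_length[of P] by linarith
  qed (use assms min_target_dim_ge_4 min_target_dim_ge_3 min_target_dim_le_9 in blast)+
qed

end
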